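(* The alternating elements of the quantum torus $T_q$ are expressed in the basis $\{x^ay^b: a,b\in\mathbb Z\}$ as follows. For every $j\in\mathbb N$: (i) if $k=2j$, then $$w_{k+1}=\binom{2j}{j}(q+q^{-1})^{-2j}(y+y^{-1}),\qquad w_{-k}=\binom{2j}{j}(q+q^{-1})^{-2j}(x+x^{-1}),$$ $$g_k=\tilde g_k=-\binom{2j}{j}(q-q^{-1})(q+q^{-1})^{2-2j};$$ (ii) if $k=2j+1$, then $$w_{k+1}=0,\qquad w_{-k}=0,$$ $$g_k=\binom{2j}{j}\,q\,(q-q^{-1})(q+q^{-1})^{1-2j}(xy^{-1}+x^{-1}y),$$ $$\tilde g_k=\binom{2j}{j}\,q^{-1}(q-q^{-1})(q+q^{-1})^{1-2j}(xy+x^{-1}y^{-1}).$$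
   Context: $K$ is a field of characteristic $0$; $q\in K$ is nonzero with $q^4\neq 1$. Algebras are associative, unital, over $K$. $\mathbb N=\{0,1,2,\dots\}$. $[u,v]=uv-vu$ and $[u,v]_r=ruv-r^{-1}vu$ for nonzero $r\in K$. The $q$-Onsager algebra $O_q$ has generators $W_0,W_1$ and relations $[W_0,[W_0,[W_0,W_1]_q]_{q^{-1}}]=-(q^2-q^{-2})^2[W_0,W_1]$ and $[W_1,[W_1,[W_1,W_0]_q]_{q^{-1}}]=-(q^2-q^{-2})^2[W_1,W_0]$. Its alternating central extension $\mathcal O_q$ has generators $\mathcal W_{-k},\mathcal W_{k+1},\mathcal G_{k+1},\tilde{\mathcal G}_{k+1}$ ($k\in\mathbb N$) and, with $\rho=-(q^2-q^{-2})^2$, the relations, for all $k,\ell\in\mathbb N$: $[\mathcal W_0,\mathcal W_{k+1}]=[\mathcal W_{-k},\mathcal W_1]=(\tilde{\mathcal G}_{k+1}-\mathcal G_{k+1})/(q+q^{-1})$; $[\mathcal W_0,\mathcal G_{k+1}]_q=[\tilde{\mathcal G}_{k+1},\mathcal W_0]_q=\rho\mathcal W_{-k-1}-\rho\mathcal W_{k+1}$; $[\mathcal G_{k+1},\mathcal W_1]_q=[\mathcal W_1,\tilde{\mathcal G}_{k+1}]_q=\rho\mathcal W_{k+2}-\rho\mathcal W_{-k}$; $[\mathcal W_{-k},\mathcal W_{-\ell}]=0$; $[\mathcal W_{k+1},\mathcal W_{\ell+1}]=0$; $[\mathcal W_{-k},\mathcal W_{\ell+1}]+[\mathcal W_{k+1},\mathcal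 W_{-\ell}]=0$; $[\mathcal W_{-k},\mathcal G_{\ell+1}]+[\mathcal G_{k+1},\mathcal W_{-\ell}]=0$; $[\mathcal W_{-k},\tilde{\mathcal G}_{\ell+1}]+[\tilde{\mathcal G}_{k+1},\mathcal W_{-\ell}]=0$; $[\mathcal W_{k+1},\mathcal G_{\ell+1}]+[\mathcal G_{k+1},\mathcal W_{\ell+1}]=0$; $[\mathcal W_{k+1},\tilde{\mathcal G}_{\ell+1}]+[\tilde{\mathcal G}_{k+1},\mathcal W_{\ell+1}]=0$; $[\mathcal G_{k+1},\mathcal G_{\ell+1}]=0$; $[\tilde{\mathcal G}_{k+1},\tilde{\mathcal G}_{\ell+1}]=0$; $[\tilde{\mathcal G}_{k+1},\mathcal G_{\ell+1}]+[\mathcal G_{k+1},\tilde{\mathcal G}_{\ell+1}]=0$. Put $\mathcal G_0=\tilde{\mathcal G}_0=-(q-q^{-1})(q+q^{-1})^2$. Let $\mathcal W^-(t)=\sum_{i\ge0}\mathcal W_{-i}t^i$, $\mathcal W^+(t)=\sum_{i\ge0}\mathcal W_{i+1}t^i$, $\mathcal G(t)=\sum_{i\ge0}\mathcal G_it^i$, $\tilde{\mathcal G}(t)=\sum_{i\ge0}\tilde{\mathcal G}_it^i$. Let $T=\frac{q+q^{-1}}{qt+q^{-1}t^{-1}}=(q+q^{-1})\sum_{\ell\ge0}(-1)^\ell q^{2\ell+1}t^{2\ell+1}$ and $S=\frac{q+q^{-1}}{qt^{-1}+q^{-1}t}=(q+q^{-1})\sum_{\ell\ge0}(-1)^\ell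 q^{-(2\ell+1)}t^{2\ell+1}$ (power series in $t$ without constant term, so $t^{-1}ST$ is a power series). Elements $\mathcal Z_i\in\mathcal O_q$ ($i\ge0$) are given by $$\sum_{i\ge0}\mathcal Z_i(q+q^{-1})^it^i=t^{-1}ST\,\mathcal W^-(S)\mathcal W^+(T)+tST\,\mathcal W^+(S)\mathcal W^-(T)-q^2ST\,\mathcal W^-(S)\mathcal W^-(T)-q^{-2}ST\,\mathcal W^+(S)\mathcal W^+(T)+(q^2-q^{-2})^{-2}\mathcal G(S)\tilde{\mathcal G}(T);$$ one has $\mathcal Z_0=(q+q^{-1})^2$. Part of the standing setup is the previously known fact that the $\mathcal Z_i$ are central and that there is an algebra isomorphism $\phi:O_q\otimes K[z_1,z_2,\dots]\to\mathcal O_q$ with $W_0\otimes1\mapsto\mathcal W_0$, $W_1\otimes1\mapsto\mathcal W_1$, $1\otimes z_i\mapsto\mathcal Z_i$ ($i\ge1$), where the $z_i$ are commuting indeterminates. The homomorphism $\gamma:\mathcal O_q\to O_q$ is $\phi^{-1}$ followed by setting all $z_i=0$; so $\gamma(\mathcal W_0)=W_0$, $\gamma(\mathcal W_1)=W_1$, $\gamma(\mathcal Z_i)=0$ for $i\ge1$. The alternating elements of $O_q$ are $W_{-k}=\gamma(\mathcal W_{-k})$, $W_{k+1}=\gamma(\mathcal W_{k+1})$, $G_{k+1}=\gamma(\mathcal G_{k+1})$, $\tilde G_{k+1}=\gamma(\tilde{\mathcal G}_{k+1})$, $k\in\mathbb N$. The quantum torus $T_q$ is the algebra with generators $x,y,x^{-1},y^{-1}$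 and relations $xx^{-1}=1=x^{-1}x$, $yy^{-1}=1=y^{-1}y$, $xy=q^2yx$; it has basis $\{x^ay^b: a,b\in\mathbb Z\}$. There is an algebra homomorphism $p:O_q\to T_q$ with $W_0\mapsto x+x^{-1}$, $W_1\mapsto y+y^{-1}$. The alternating elements of $T_q$ are $w_{-k}=p(W_{-k})$, $w_{k+1}=p(W_{k+1})$, $g_{k+1}=p(G_{k+1})$, $\tilde g_{k+1}=p(\tilde G_{k+1})$ for $k\in\mathbb N$, and by convention $g_0=\tilde g_0=-(q-q^{-1})(q+q^{-1})^2$. *)

theory Defs
  imports
    "HOL-Library.Poly_Mapping"
    "HOL-Computational_Algebra.Formal_Power_Series"
    "HOL-Algebra.QuotRing"
    "HOL-Algebra.Module"
begin

section \<open>Algebras given by generators and relations\<close>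

text \<open>Words form a monoid under concatenation. The operation is written additively
  because \<^type>\<open>poly_mapping\<close> forms monoid algebras of additively written monoids.\<close>

datatype 'g word = Word (letters: "'g list")

instantiation word :: (type) monoid_add
begin

definition zero_word :: "'g word" where
  "zero_word = Word []"

definition plus_word :: "'g word \<Rightarrow> 'g word \<Rightarrow> 'g word" where
  "plus_word u v = Word (letters u @ letters v)"

instance
  by standard (simp_all add: zero_word_def plus_word_def)

end

text \<open>Elements of the free algebra are noncommutative polynomials; \<open>(*)\<close> on this type is the
  convolution product.\<close>

type_synonym ('g, 'k) ncpoly = "'g word \<Rightarrow>\<^sub>0 'k"

definition gen :: "'g \<Rightarrow> ('g, 'k::field) ncpoly" where
  "gen g = Poly_Mapping.single (Word [g]) 1"

definition scal :: "'k \<Rightarrow> ('g, 'k::field) ncpoly" where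
  "scal c = Poly_Mapping.single 0 c"

text \<open>A \<open>K\<close>-algebra (not necessarily commutative) is a record of type \<^typ>\<open>('k, 'a) module\<close>,
  i.e. a ring together with a scalar multiplication, whose field of scalars is the type
  \<^typ>\<open>'k\<close>. The library locale \<^locale>\<open>algebra\<close> only covers commutative algebras.\<close>

locale k_algebra = ring B for B :: "('k::field, 'b) module" (structure) +
  assumes scale_closed: "x \<in> carrier B \<Longrightarrow> c \<odot> x \<in> carrier B"
    and scale_add_left: "x \<in> carrier B \<Longrightarrow> (c + d) \<odot> x = c \<odot> x \<oplus> d \<odot> x"
    and scale_add_right:
      "x \<in> carrier B \<Longrightarrow> y \<in> carrier B \<Longrightarrow> c \<odot> (x \<oplus> y) = c \<odot> x \<oplus> c \<odot> y"
    and scale_scale: "x \<in> carrier B \<Longrightarrow> c \<odot> (d \<odot> x) = (c * d) \<odot> x"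
    and scale_one: "x \<in> carrier B \<Longrightarrow> 1 \<odot> x = x"
    and scale_mult_left:
      "x \<in> carrier B \<Longrightarrow> y \<in> carrier B \<Longrightarrow> (c \<odot> x) \<otimes> y = c \<odot> (x \<otimes> y)"
    and scale_mult_right:
      "x \<in> carrier B \<Longrightarrow> y \<in> carrier B \<Longrightarrow> x \<otimes> (c \<odot> y) = c \<odot> (x \<otimes> y)"

definition alg_hom :: "('k, 'a) module \<Rightarrow> ('k, 'b) module \<Rightarrow> ('a \<Rightarrow> 'b) set" where
  "alg_hom A B = {h \<in> ring_hom A B. \<forall>c. \<forall>x \<in> carrier A. h (c \<odot>\<^bsub>A\<^esub> x) = c \<odot>\<^bsub>B\<^esub> h x}"

definition alg_iso :: "('k, 'a) module \<Rightarrow> ('k, 'b) module \<Rightarrow> ('a \<Rightarrow> 'b) set" where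
  "alg_iso A B = {h \<in> alg_hom A B. bij_betw h (carrier A) (carrier B)}"

definition free_alg :: "'g set \<Rightarrow> ('k::field, ('g, 'k) ncpoly) module" where
  "free_alg X =
    \<lparr>carrier = {f. \<forall>w \<in> Poly_Mapping.keys f. set (letters w) \<subseteq> X},
     mult = (*), one = 1, zero = 0, add = (+), smult = (\<lambda>c f. scal c * f)\<rparr>"

text \<open>A relation \<open>u = v\<close> is a pair \<open>(u, v)\<close>. For noncommutative rings \<^const>\<open>genideal\<close>
  yields the generated two-sided ideal.\<close>

definition rel_ideal ::
  "'g set \<Rightarrow> (('g, 'k::field) ncpoly \<times> ('g, 'k) ncpoly) set \<Rightarrow> ('g, 'k) ncpoly set" where
  "rel_ideal X R = genideal (free_alg X) {u - v |u v. (u, v) \<in> R}"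

definition residue ::
  "'g set \<Rightarrow> (('g, 'k::field) ncpoly \<times> ('g, 'k) ncpoly) set \<Rightarrow> ('g, 'k) ncpoly
     \<Rightarrow> ('g, 'k) ncpoly set" where
  "residue X R f = rel_ideal X R +>\<^bsub>free_alg X\<^esub> f"

definition presented_alg ::
  "'g set \<Rightarrow> (('g, 'k::field) ncpoly \<times> ('g, 'k) ncpoly) set
     \<Rightarrow> ('k, ('g, 'k) ncpoly set) module" where
  "presented_alg X R =
    ring.extend (free_alg X Quot rel_ideal X R)
      (module.fields (\<lambda>c u. residue X R (scal c) \<otimes>\<^bsub>free_alg X Quot rel_ideal X R\<^esub> u))"

text \<open>The algebra homomorphism out of a presented algebra determined by the images \<open>h\<close> of the
  generators (see \<open>induced_hom_alg_hom\<close> below).\<close>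

definition word_eval :: "('k::field, 'b) module \<Rightarrow> ('g \<Rightarrow> 'b) \<Rightarrow> 'g list \<Rightarrow> 'b" where
  "word_eval B h gs = foldr (\<lambda>g u. h g \<otimes>\<^bsub>B\<^esub> u) gs \<one>\<^bsub>B\<^esub>"

definition free_lift :: "('k::field, 'b) module \<Rightarrow> ('g \<Rightarrow> 'b) \<Rightarrow> ('g, 'k) ncpoly \<Rightarrow> 'b" where
  "free_lift B h f =
    (\<Oplus>\<^bsub>B\<^esub> w \<in> Poly_Mapping.keys f. Poly_Mapping.lookup f w \<odot>\<^bsub>B\<^esub> word_eval B h (letters w))"

definition induced_hom ::
  "('k::field, 'b) module \<Rightarrow> ('g \<Rightarrow> 'b) \<Rightarrow> ('g, 'k) ncpoly set \<Rightarrow> 'b" where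
  "induced_hom B h u = the_elem (free_lift B h ` u)"


section \<open>Tensor products and the polynomial algebra\<close>

text \<open>\<open>A \<otimes> B\<close> is generated by the symbols \<open>a \<otimes> b\<close>, subject to bilinearity over \<open>K\<close> and
  \<open>(a \<otimes> b)(a' \<otimes> b') = aa' \<otimes> bb'\<close>, \<open>1 \<otimes> 1 = 1\<close>.\<close>

inductive_set tensor_rels ::
  "('k::field, 'a) module \<Rightarrow> ('k, 'b) module
     \<Rightarrow> (('a \<times> 'b, 'k) ncpoly \<times> ('a \<times> 'b, 'k) ncpoly) set"
  for A B where
  "a \<in> carrier A \<Longrightarrow> a' \<in> carrier A \<Longrightarrow> b \<in> carrier B \<Longrightarrow>
     (gen (a \<oplus>\<^bsub>A\<^esub> a', b), gen (a, b) + gen (a', b)) \<in> tensor_rels A B"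
| "a \<in> carrier A \<Longrightarrow> b \<in> carrier B \<Longrightarrow> b' \<in> carrier B \<Longrightarrow>
     (gen (a, b \<oplus>\<^bsub>B\<^esub> b'), gen (a, b) + gen (a, b')) \<in> tensor_rels A B"
| "a \<in> carrier A \<Longrightarrow> b \<in> carrier B \<Longrightarrow>
     (gen (c \<odot>\<^bsub>A\<^esub> a, b), scal c * gen (a, b)) \<in> tensor_rels A B"
| "a \<in> carrier A \<Longrightarrow> b \<in> carrier B \<Longrightarrow>
     (gen (a, c \<odot>\<^bsub>B\<^esub> b), scal c * gen (a, b)) \<in> tensor_rels A B"
| "a \<in> carrier A \<Longrightarrow> a' \<in> carrier A \<Longrightarrow> b \<in> carrier B \<Longrightarrow> b' \<in> carrier B \<Longrightarrow>
     (gen (a, b) * gen (a', b'), gen (a \<otimes>\<^bsub>A\<^esub> a', b \<otimes>\<^bsub>B\<^esub> b')) \<in> tensor_rels A B"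
| "(gen (\<one>\<^bsub>A\<^esub>, \<one>\<^bsub>B\<^esub>), 1) \<in> tensor_rels A B"

definition tensor_alg ::
  "('k::field, 'a) module \<Rightarrow> ('k, 'b) module \<Rightarrow> ('k, ('a \<times> 'b, 'k) ncpoly set) module" where
  "tensor_alg A B = presented_alg (carrier A \<times> carrier B) (tensor_rels A B)"

definition tensor ::
  "('k::field, 'a) module \<Rightarrow> ('k, 'b) module \<Rightarrow> 'a \<Rightarrow> 'b \<Rightarrow> ('a \<times> 'b, 'k) ncpoly set" where
  "tensor A B a b = residue (carrier A \<times> carrier B) (tensor_rels A B) (gen (a, b))"

text \<open>The commutative polynomial algebra \<open>K[z\<^sub>1, z\<^sub>2, \<dots>]\<close>. Exponent vectors are indexed from 0,
  so \<open>zvar i\<close> stands for \<open>z\<^bsub>i+1\<^esub>\<close>, and every index occurs.\<close>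

type_synonym 'k zpoly = "(nat \<Rightarrow>\<^sub>0 nat) \<Rightarrow>\<^sub>0 'k"

definition zvar :: "nat \<Rightarrow> 'k::field zpoly" where
  "zvar i = Poly_Mapping.single (Poly_Mapping.single i 1) 1"

definition zpoly_alg :: "('k::field, 'k zpoly) module" where
  "zpoly_alg =
    \<lparr>carrier = UNIV, mult = (*), one = 1, zero = 0, add = (+),
     smult = (\<lambda>c f. Poly_Mapping.single 0 c * f)\<rparr>"


section \<open>The algebras of the theorem\<close>

definition comm :: "'a::ring_1 \<Rightarrow> 'a \<Rightarrow> 'a" where
  "comm u v = u * v - v * u"

definition qcomm :: "'k \<Rightarrow> ('g, 'k::field) ncpoly \<Rightarrow> ('g, 'k) ncpoly \<Rightarrow> ('g, 'k) ncpoly" where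
  "qcomm r u v = scal r * u * v - scal (inverse r) * v * u"

definition rho :: "'k::field \<Rightarrow> 'k" where
  "rho q = - (q\<^sup>2 - inverse q ^ 2)\<^sup>2"

subsection \<open>The q-Onsager algebra\<close>

datatype onsager_gen = OW0 | OW1

definition onsager_rels :: "'k::field \<Rightarrow> ((onsager_gen, 'k) ncpoly \<times> (onsager_gen, 'k) ncpoly) set"
  where
  "onsager_rels q =
    {(comm (gen OW0) (qcomm (inverse q) (gen OW0) (qcomm q (gen OW0) (gen OW1))),
      scal (rho q) * comm (gen OW0) (gen OW1)),
     (comm (gen OW1) (qcomm (inverse q) (gen OW1) (qcomm q (gen OW1) (gen OW0))),
      scal (rho q) * comm (gen OW1) (gen OW0))}"

definition onsager_alg :: "'k::field \<Rightarrow> ('k, (onsager_gen, 'k) ncpoly set) module" where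
  "onsager_alg q = presented_alg UNIV (onsager_rels q)"

definition onsager_elem :: "'k::field \<Rightarrow> (onsager_gen, 'k) ncpoly \<Rightarrow> (onsager_gen, 'k) ncpoly set"
  where "onsager_elem q = residue UNIV (onsager_rels q)"

subsection \<open>The alternating central extension\<close>

text \<open>\<open>AWm k\<close>, \<open>AWp k\<close>, \<open>AG k\<close>, \<open>AGt k\<close> stand for the generators with indices
  \<open>-k\<close>, \<open>k+1\<close>, \<open>k+1\<close>, \<open>k+1\<close> respectively.\<close>

datatype ace_gen = AWm nat | AWp nat | AG nat | AGt nat

abbreviation "Wm k \<equiv> gen (AWm k)"
abbreviation "Wp k \<equiv> gen (AWp k)"
abbreviation "Gp k \<equiv> gen (AG k)"
abbreviation "Gt k \<equiv> gen (AGt k)"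

inductive_set ace_rels :: "'k::field \<Rightarrow> ((ace_gen, 'k) ncpoly \<times> (ace_gen, 'k) ncpoly) set"
  for q :: 'k where
  "(comm (Wm 0) (Wp k), scal (inverse (q + inverse q)) * (Gt k - Gp k)) \<in> ace_rels q"
| "(comm (Wm k) (Wp 0), scal (inverse (q + inverse q)) * (Gt k - Gp k)) \<in> ace_rels q"
| "(qcomm q (Wm 0) (Gp k), scal (rho q) * Wm (k + 1) - scal (rho q) * Wp k) \<in> ace_rels q"
| "(qcomm q (Gt k) (Wm 0), scal (rho q) * Wm (k + 1) - scal (rho q) * Wp k) \<in> ace_rels q"
| "(qcomm q (Gp k) (Wp 0), scal (rho q) * Wp (k + 1) - scal (rho q) * Wm k) \<in> ace_rels q"
| "(qcomm q (Wp 0) (Gt k), scal (rho q) * Wp (k + 1) - scal (rho q) * Wm k) \<in> ace_rels q"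
| "(comm (Wm k) (Wm l), 0) \<in> ace_rels q"
| "(comm (Wp k) (Wp l), 0) \<in> ace_rels q"
| "(comm (Wm k) (Wp l) + comm (Wp k) (Wm l), 0) \<in> ace_rels q"
| "(comm (Wm k) (Gp l) + comm (Gp k) (Wm l), 0) \<in> ace_rels q"
| "(comm (Wm k) (Gt l) + comm (Gt k) (Wm l), 0) \<in> ace_rels q"
| "(comm (Wp k) (Gp l) + comm (Gp k) (Wp l), 0) \<in> ace_rels q"
| "(comm (Wp k) (Gt l) + comm (Gt k) (Wp l), 0) \<in> ace_rels q"
| "(comm (Gp k) (Gp l), 0) \<in> ace_rels q"
| "(comm (Gt k) (Gt l), 0) \<in> ace_rels q"
| "(comm (Gt k) (Gp l) + comm (Gp k) (Gt l), 0) \<in> ace_rels q"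

definition ace_alg :: "'k::field \<Rightarrow> ('k, (ace_gen, 'k) ncpoly set) module" where
  "ace_alg q = presented_alg UNIV (ace_rels q)"

definition ace_elem :: "'k::field \<Rightarrow> (ace_gen, 'k) ncpoly \<Rightarrow> (ace_gen, 'k) ncpoly set" where
  "ace_elem q = residue UNIV (ace_rels q)"

subsection \<open>The central elements\<close>

definition G0 :: "'k::field \<Rightarrow> 'k" where
  "G0 q = - (q - inverse q) * (q + inverse q)\<^sup>2"

definition Wm_series :: "(ace_gen, 'k::field) ncpoly fps" where
  "Wm_series = Abs_fps Wm"

definition Wp_series :: "(ace_gen, 'k::field) ncpoly fps" where
  "Wp_series = Abs_fps Wp"

definition G_series :: "'k::field \<Rightarrow> (ace_gen, 'k) ncpoly fps" where
  "G_series q = Abs_fps (\<lambda>i. case i of 0 \<Rightarrow> scal (G0 q) | Suc k \<Rightarrow> Gp k)"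

definition Gt_series :: "'k::field \<Rightarrow> (ace_gen, 'k) ncpoly fps" where
  "Gt_series q = Abs_fps (\<lambda>i. case i of 0 \<Rightarrow> scal (G0 q) | Suc k \<Rightarrow> Gt k)"

text \<open>\<open>T = (q + q\<^sup>-\<^sup>1) / (q t + q\<^sup>-\<^sup>1 t\<^sup>-\<^sup>1)\<close>, with numerator and denominator multiplied by \<open>t\<close>.
  \<open>S\<close> arises from \<open>T\<close> by exchanging \<open>q\<close> and \<open>q\<^sup>-\<^sup>1\<close>. The expansions into series are
  \<open>T_ser_nth\<close> and \<open>S_ser_nth\<close> below.\<close>

definition T_ser :: "'k::field \<Rightarrow> 'k fps" where
  "T_ser q = fps_const (q + inverse q) * fps_X /
    (fps_const q * fps_X\<^sup>2 + fps_const (inverse q))"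

definition S_ser :: "'k::field \<Rightarrow> 'k fps" where
  "S_ser q = fps_const (q + inverse q) * fps_X /
    (fps_const q + fps_const (inverse q) * fps_X\<^sup>2)"

definition scal_fps :: "'k::field fps \<Rightarrow> ('g, 'k) ncpoly fps" where
  "scal_fps f = Abs_fps (\<lambda>n. scal (fps_nth f n))"

definition fps_subst :: "('g, 'k::field) ncpoly fps \<Rightarrow> 'k fps \<Rightarrow> ('g, 'k) ncpoly fps" where
  "fps_subst F f = F oo scal_fps f"

text \<open>The series on the right-hand side of the definition of the central elements, with
  coefficients in the free algebra. \<open>fps_shift 1\<close> is multiplication by \<open>t\<^sup>-\<^sup>1\<close>.\<close>

definition Z_series :: "'k::field \<Rightarrow> (ace_gen, 'k) ncpoly fps" where
  "Z_series q = (let S = S_ser q; T = T_ser q in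
      scal_fps (fps_shift 1 (S * T)) * fps_subst Wm_series S * fps_subst Wp_series T
    + scal_fps (fps_X * S * T) * fps_subst Wp_series S * fps_subst Wm_series T
    - scal_fps (fps_const (q\<^sup>2) * S * T) * fps_subst Wm_series S * fps_subst Wm_series T
    - scal_fps (fps_const (inverse q ^ 2) * S * T) * fps_subst Wp_series S * fps_subst Wp_series T
    + scal_fps (fps_const (inverse ((q\<^sup>2 - inverse q ^ 2)\<^sup>2)))
        * fps_subst (G_series q) S * fps_subst (Gt_series q) T)"

text \<open>The generating function of the central elements is in the variable \<open>(q + q\<^sup>-\<^sup>1) t\<close>.\<close>

definition Z_elem :: "'k::field \<Rightarrow> nat \<Rightarrow> (ace_gen, 'k) ncpoly set" where
  "Z_elem q i = ace_elem q (scal (inverse ((q + inverse q) ^ i)) * fps_nth (Z_series q) i)"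

subsection \<open>The quantum torus\<close>

datatype torus_gen = TX | TXinv | TY | TYinv

definition torus_rels :: "'k::field \<Rightarrow> ((torus_gen, 'k) ncpoly \<times> (torus_gen, 'k) ncpoly) set" where
  "torus_rels q =
    {(gen TX * gen TXinv, 1), (gen TXinv * gen TX, 1),
     (gen TY * gen TYinv, 1), (gen TYinv * gen TY, 1),
     (gen TX * gen TY, scal (q\<^sup>2) * gen TY * gen TX)}"

definition torus_alg :: "'k::field \<Rightarrow> ('k, (torus_gen, 'k) ncpoly set) module" where
  "torus_alg q = presented_alg UNIV (torus_rels q)"

definition torus_elem :: "'k::field \<Rightarrow> (torus_gen, 'k) ncpoly \<Rightarrow> (torus_gen, 'k) ncpoly set" where
  "torus_elem q = residue UNIV (torus_rels q)"

abbreviation "tX q \<equiv> torus_elem q (gen TX)"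
abbreviation "tXinv q \<equiv> torus_elem q (gen TXinv)"
abbreviation "tY q \<equiv> torus_elem q (gen TY)"
abbreviation "tYinv q \<equiv> torus_elem q (gen TYinv)"

subsection \<open>The homomorphisms and the alternating elements\<close>

type_synonym 'k onsager_z = "((onsager_gen, 'k) ncpoly set \<times> 'k zpoly, 'k) ncpoly set"

definition onsager_z_alg :: "'k::field \<Rightarrow> ('k, 'k onsager_z) module" where
  "onsager_z_alg q = tensor_alg (onsager_alg q) zpoly_alg"

text \<open>The known isomorphism from \<open>O\<^sub>q \<otimes> K[z\<^sub>1, z\<^sub>2, \<dots>]\<close> to the alternating central
  extension; it is determined on the carrier by the listed values on generators. That the \<open>Z_elem q i\<close> are central is a consequence.\<close>

definition standard_iso ::
  "'k::field \<Rightarrow> ('k onsager_z \<Rightarrow> (ace_gen, 'k) ncpoly set) \<Rightarrow> bool" where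
  "standard_iso q \<phi> \<longleftrightarrow>
     \<phi> \<in> alg_iso (onsager_z_alg q) (ace_alg q) \<and>
     \<phi> (tensor (onsager_alg q) zpoly_alg (onsager_elem q (gen OW0)) 1) = ace_elem q (Wm 0) \<and>
     \<phi> (tensor (onsager_alg q) zpoly_alg (onsager_elem q (gen OW1)) 1) = ace_elem q (Wp 0) \<and>
     (\<forall>i. \<phi> (tensor (onsager_alg q) zpoly_alg \<one>\<^bsub>onsager_alg q\<^esub> (zvar i)) = Z_elem q (i + 1))"

text \<open>Setting all \<open>z\<^sub>i = 0\<close>: the homomorphism \<open>a \<otimes> f \<mapsto> f(0) a\<close>, where \<open>f(0)\<close> is the constant
  term of \<open>f\<close> (see \<open>set_z_zero_props\<close> below).\<close>

definition set_z_zero :: "'k::field \<Rightarrow> 'k onsager_z \<Rightarrow> (onsager_gen, 'k) ncpoly set" where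
  "set_z_zero q =
     induced_hom (onsager_alg q) (\<lambda>(a, f). Poly_Mapping.lookup f 0 \<odot>\<^bsub>onsager_alg q\<^esub> a)"

definition gamma ::
  "'k::field \<Rightarrow> ('k onsager_z \<Rightarrow> (ace_gen, 'k) ncpoly set)
     \<Rightarrow> (ace_gen, 'k) ncpoly set \<Rightarrow> (onsager_gen, 'k) ncpoly set" where
  "gamma q \<phi> u = set_z_zero q (inv_into (carrier (onsager_z_alg q)) \<phi> u)"

text \<open>That this is an algebra homomorphism with the prescribed values is \<open>torus_hom_props\<close> below.\<close>

definition torus_hom ::
  "'k::field \<Rightarrow> (onsager_gen, 'k) ncpoly set \<Rightarrow> (torus_gen, 'k) ncpoly set" where
  "torus_hom q = induced_hom (torus_alg q)
     (\<lambda>g. case g of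
        OW0 \<Rightarrow> tX q \<oplus>\<^bsub>torus_alg q\<^esub> tXinv q
      | OW1 \<Rightarrow> tY q \<oplus>\<^bsub>torus_alg q\<^esub> tYinv q)"

text \<open>\<open>w_minus k\<close>, \<open>w_plus k\<close> have index \<open>-k\<close>, \<open>k+1\<close>; \<open>g_alt k\<close>, \<open>gt_alt k\<close> have index \<open>k\<close>.\<close>

definition w_minus where
  "w_minus q \<phi> k = torus_hom q (gamma q \<phi> (ace_elem q (Wm k)))"

definition w_plus where
  "w_plus q \<phi> k = torus_hom q (gamma q \<phi> (ace_elem q (Wp k)))"

definition g_alt where
  "g_alt q \<phi> k = (case k of
      0 \<Rightarrow> G0 q \<odot>\<^bsub>torus_alg q\<^esub> \<one>\<^bsub>torus_alg q\<^esub>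
    | Suc l \<Rightarrow> torus_hom q (gamma q \<phi> (ace_elem q (Gp l))))"

definition gt_alt where
  "gt_alt q \<phi> k = (case k of
      0 \<Rightarrow> G0 q \<odot>\<^bsub>torus_alg q\<^esub> \<one>\<^bsub>torus_alg q\<^esub>
    | Suc l \<Rightarrow> torus_hom q (gamma q \<phi> (ace_elem q (Gt l))))"


section \<open>Basic facts\<close>

lemma T_ser_nth:
  assumes "q \<noteq> 0"
  shows "T_ser q = Abs_fps (\<lambda>n. if odd n then (q + inverse q) * (-1) ^ (n div 2) * q ^ n else 0)"
proof -
  let ?A = "Abs_fps (\<lambda>n. if odd n then (q + inverse q) * (-1) ^ (n div 2) * q ^ n else 0)"
  let ?D = "fps_const q * fps_X\<^sup>2 + fps_const (inverse q)"
  have eq: "?A * ?D = fps_const (q + inverse q) * fps_X"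
  proof (rule fps_ext)
    fix n
    have *: "?A * ?D = fps_const q * (fps_X\<^sup>2 * ?A) + fps_const (inverse q) * ?A"
      by (simp add: algebra_simps)
    show "fps_nth (?A * ?D) n = fps_nth (fps_const (q + inverse q) * fps_X) n"
    proof (cases "n < 2")
      case True
      then have "n = 0 \<or> n = 1" by auto
      then show ?thesis unfolding * using assms by (auto simp: fps_X_power_mult_nth)
    next
      case False
      then obtain m where m: "n = Suc (Suc m)" by (metis add_2_eq_Suc le_Suc_ex not_less)
      show ?thesis unfolding * m using assms
        by (auto simp: fps_X_power_mult_nth)
    qed
  qed
  have nz: "?D \<noteq> 0"
  proof
    assume "?D = 0"
    then have "fps_nth ?D 0 = 0" by simp
    then show False using assms by (simp add: power2_eq_square)
  qed
  show ?thesis unfolding T_ser_def eq[symmetric]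
    by (rule nonzero_mult_div_cancel_right[OF nz])
qed

lemma S_ser_eq: "S_ser q = T_ser (inverse q)"
  by (simp add: S_ser_def T_ser_def add.commute)

lemma S_ser_nth:
  assumes "q \<noteq> 0"
  shows "S_ser q = Abs_fps (\<lambda>n. if odd n then (q + inverse q) * (-1) ^ (n div 2) * inverse q ^ n else 0)"
  using T_ser_nth[of "inverse q"] assms
  by (simp only: S_ser_eq inverse_inverse_eq inverse_nonzero_iff_nonzero add.commute not_False_eq_True)

lemma scal_mult: "scal c * scal d = scal (c * d)"
  by (simp add: scal_def mult_single)
lemma scal_add: "scal (c + d) = scal c + scal d"
  by (simp add: scal_def single_add)
lemma scal_1: "scal 1 = 1"
  by (simp add: scal_def)
lemma scal_0: "scal 0 = 0"
  by (simp add: scal_def)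

lemma scal_times_single: "scal c * Poly_Mapping.single w d = Poly_Mapping.single w (c * d)"
  by (simp add: scal_def mult_single)

lemma single_times_scal: "Poly_Mapping.single w d * scal c = Poly_Mapping.single w (d * c)"
  by (simp add: scal_def mult_single)

lemma poly_sum: "f = (\<Sum>w\<in>Poly_Mapping.keys f. Poly_Mapping.single w (Poly_Mapping.lookup f w))"
  by (rule poly_mapping_eqI) (simp add: lookup_sum lookup_single when_def in_keys_iff)

lemma scal_commute: "scal c * f = f * (scal c :: ('g, 'k::field) ncpoly)"
proof -
  have "scal c * (\<Sum>w\<in>Poly_Mapping.keys f. Poly_Mapping.single w (Poly_Mapping.lookup f w))
      = (\<Sum>w\<in>Poly_Mapping.keys f. Poly_Mapping.single w (Poly_Mapping.lookup f w)) * scal c"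
    by (simp add: sum_distrib_left sum_distrib_right scal_times_single single_times_scal mult.commute)
  then show ?thesis using poly_sum[of f] by simp
qed

lemma free_alg_ring: "ring (free_alg X :: ('k::field, ('g,'k) ncpoly) module)"
proof (rule ringI)
  show "abelian_group (free_alg X :: ('k::field, ('g,'k) ncpoly) module)"
  proof (rule abelian_groupI)
    fix x y :: "('g,'k) ncpoly"
    assume "x \<in> carrier (free_alg X)" "y \<in> carrier (free_alg X)"
    then show "x \<oplus>\<^bsub>free_alg X\<^esub> y \<in> carrier (free_alg X)"
      using keys_add[of x y] by (fastforce simp: free_alg_def)
  next
    fix x :: "('g,'k) ncpoly"
    assume x: "x \<in> carrier (free_alg X)"
    show "\<exists>y\<in>carrier (free_alg X). y \<oplus>\<^bsub>free_alg X\<^esub> x = \<zero>\<^bsub>free_alg X\<^esub>"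
      by (rule bexI[of _ "-x"]) (use x in \<open>auto simp: free_alg_def\<close>)
  qed (auto simp: free_alg_def add_ac)
  show "Group.monoid (free_alg X :: ('k::field, ('g,'k) ncpoly) module)"
  proof (rule monoidI)
    fix x y :: "('g,'k) ncpoly"
    assume "x \<in> carrier (free_alg X)" "y \<in> carrier (free_alg X)"
    then show "x \<otimes>\<^bsub>free_alg X\<^esub> y \<in> carrier (free_alg X)"
      using keys_mult[of x y] by (fastforce simp: free_alg_def plus_word_def)
  qed (auto simp: free_alg_def mult.assoc zero_word_def)
qed (auto simp: free_alg_def algebra_simps)

lemma scal_in_free: "scal c \<in> carrier (free_alg X)"
  by (auto simp: scal_def free_alg_def zero_word_def)

lemma gen_in_free: "g \<in> X \<Longrightarrow> gen g \<in> carrier (free_alg X)"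
  by (auto simp: gen_def free_alg_def)

lemma rel_ideal_ideal:
  assumes "R \<subseteq> carrier (free_alg X) \<times> carrier (free_alg X)"
  shows "ideal (rel_ideal X R) (free_alg X)"
proof -
  interpret F: ring "free_alg X" by (rule free_alg_ring)
  have "u - v \<in> carrier (free_alg X)" if "u \<in> carrier (free_alg X)" "v \<in> carrier (free_alg X)" 
    for u v :: "('a, 'b) ncpoly"
  proof -
    have "- v \<in> carrier (free_alg X)" using that(2) by (auto simp: free_alg_def)
    then have "u \<oplus>\<^bsub>free_alg X\<^esub> (- v) \<in> carrier (free_alg X)" using that(1) F.a_closed by blast
    then show ?thesis by (simp add: free_alg_def)
  qed
  then show ?thesis unfolding rel_ideal_def using assms
    by (intro F.genideal_ideal) blast
qed

lemma presented_simps: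
  "carrier (presented_alg X R) = carrier (free_alg X Quot rel_ideal X R)"
  "mult (presented_alg X R) = mult (free_alg X Quot rel_ideal X R)"
  "one (presented_alg X R) = one (free_alg X Quot rel_ideal X R)"
  "add (presented_alg X R) = add (free_alg X Quot rel_ideal X R)"
  "zero (presented_alg X R) = zero (free_alg X Quot rel_ideal X R)"
  "smult (presented_alg X R) c u = residue X R (scal c) \<otimes>\<^bsub>free_alg X Quot rel_ideal X R\<^esub> u"
  by (simp_all add: presented_alg_def ring.defs module.defs)

lemma residue_hom:
  assumes "R \<subseteq> carrier (free_alg X) \<times> carrier (free_alg X)"
  shows "residue X R \<in> ring_hom (free_alg X) (free_alg X Quot rel_ideal X R)"
  using ideal.rcos_ring_hom[OF rel_ideal_ideal[OF assms]] unfolding residue_def .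

lemma residue_surj:
  assumes "u \<in> carrier (presented_alg X R)"
  obtains f where "f \<in> carrier (free_alg X)" "u = residue X R f"
  using assms unfolding presented_simps residue_def FactRing_def A_RCOSETS_def' by auto

lemma presented_k_algebra:
  assumes R: "R \<subseteq> carrier (free_alg X) \<times> carrier (free_alg X)"
  shows "k_algebra (presented_alg X R)"
proof -
  interpret F: ring "free_alg X" by (rule free_alg_ring)
  interpret Q: ring "free_alg X Quot rel_ideal X R"
    by (rule ideal.quotient_is_ring[OF rel_ideal_ideal[OF R]])
  interpret H: ring_hom_ring "free_alg X" "free_alg X Quot rel_ideal X R" "residue X R"
    by (rule ring_hom_ringI2) (auto intro: F.ring_axioms Q.ring_axioms residue_hom[OF R])
  have ring: "ring (presented_alg X R)"
  proof (rule ringI)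
    show "abelian_group (presented_alg X R)"
    proof (rule abelian_groupI, goal_cases)
      case (3 x y z)
      then show ?case using Q.a_assoc by (simp add: presented_simps)
    next
      case (4 x y)
      then show ?case using Q.a_comm by (simp add: presented_simps)
    next
      case (6 x)
      then show ?case using Q.l_neg Q.a_inv_closed by (auto simp: presented_simps)
    qed (simp_all add: presented_simps)
    show "Group.monoid (presented_alg X R)"
      by (rule monoidI) (auto simp: presented_simps Q.m_assoc)
  qed (auto simp: presented_simps Q.l_distr Q.r_distr)
  have h1: "residue X R (c + d) = residue X R c \<oplus>\<^bsub>free_alg X Quot rel_ideal X R\<^esub> residue X R d"
    if "c \<in> carrier (free_alg X)" "d \<in> carrier (free_alg X)" for c d
    using H.hom_add[OF that] by (simp add: free_alg_def)
  have h2: "residue X R (c * d) = residue X R c \<otimes>\<^bsub>free_alg X Quot rel_ideal X R\<^esub> residue X R d"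
    if "c \<in> carrier (free_alg X)" "d \<in> carrier (free_alg X)" for c d
    using H.hom_mult[OF that] by (simp add: free_alg_def)
  have h3: "residue X R 1 = \<one>\<^bsub>free_alg X Quot rel_ideal X R\<^esub>"
    using H.hom_one by (simp add: free_alg_def)
  note [simp] = scal_in_free H.hom_closed
  show ?thesis
  proof (intro k_algebra.intro ring k_algebra_axioms.intro, goal_cases)
    case (7 x y c)
    then obtain f where f: "f \<in> carrier (free_alg X)" "x = residue X R f" by (elim residue_surj)
    have "x \<otimes>\<^bsub>free_alg X Quot rel_ideal X R\<^esub> residue X R (scal c)
        = residue X R (scal c) \<otimes>\<^bsub>free_alg X Quot rel_ideal X R\<^esub> x"
      using f by (simp flip: h2 add: scal_commute)
    with 7 show ?case by (simp add: presented_simps flip: Q.m_assoc)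
  qed (auto simp: presented_simps scal_add h1 Q.l_distr Q.r_distr h2 h3 scal_1 Q.m_assoc
        simp flip: scal_mult)
qed

lemma residue_alg_hom:
  assumes R: "R \<subseteq> carrier (free_alg X) \<times> carrier (free_alg X)"
  shows "residue X R \<in> alg_hom (free_alg X) (presented_alg X R)"
proof -
  have "residue X R (scal c * f) = residue X R (scal c) \<otimes>\<^bsub>free_alg X Quot rel_ideal X R\<^esub> residue X R f"
    if "f \<in> carrier (free_alg X)" for c f
    using ring_hom_mult[OF residue_hom[OF R] scal_in_free that] by (simp add: free_alg_def)
  then show ?thesis
    using residue_hom[OF R] unfolding alg_hom_def ring_hom_def
    by (simp add: presented_simps) (simp add: free_alg_def)
qed

context k_algebra begin

lemma scale_zero_left: assumes "x \<in> carrier B" shows "0 \<odot> x = \<zero>"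
proof -
  have "0 \<odot> x \<oplus> 0 \<odot> x = 0 \<odot> x" using scale_add_left[OF assms, of 0 0] by simp
  then show ?thesis using scale_closed[OF assms] by (metis add.r_cancel_one')
qed

lemma word_eval_closed:
  "h \<in> X \<rightarrow> carrier B \<Longrightarrow> set gs \<subseteq> X \<Longrightarrow> word_eval B h gs \<in> carrier B"
  by (induction gs) (auto simp: word_eval_def)

lemma word_eval_append:
  "h \<in> X \<rightarrow> carrier B \<Longrightarrow> set gs \<subseteq> X \<Longrightarrow> set gs' \<subseteq> X \<Longrightarrow>
    word_eval B h (gs @ gs') = word_eval B h gs \<otimes> word_eval B h gs'"
proof (induction gs)
  case Nil
  then show ?case using word_eval_closed[of h X gs'] by (auto simp: word_eval_def)
next
  case (Cons g gs)
  then have "word_eval B h (gs @ gs') = word_eval B h gs \<otimes> word_eval B h gs'" by simp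
  then have "word_eval B h ((g # gs) @ gs') = h g \<otimes> (word_eval B h gs \<otimes> word_eval B h gs')"
    by (simp add: word_eval_def)
  moreover have "h g \<in> carrier B" using Cons.prems by (auto dest: funcset_mem)
  ultimately show ?case using Cons.prems word_eval_closed[of h X gs'] word_eval_closed[of h X gs]
    by (simp add: word_eval_def m_assoc)
qed

lemma free_lift_alt:
  assumes "h \<in> X \<rightarrow> carrier B" "finite S" "Poly_Mapping.keys f \<subseteq> S" "\<forall>w\<in>S. set (letters w) \<subseteq> X"
  shows "free_lift B h f = (\<Oplus>w\<in>S. Poly_Mapping.lookup f w \<odot> word_eval B h (letters w))"
  unfolding free_lift_def
  by (rule add.finprod_mono_neutral_cong_left)
    (use assms in \<open>auto simp: in_keys_iff scale_zero_left scale_closed word_eval_closed\<close>)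

lemma free_lift_closed:
  assumes "h \<in> X \<rightarrow> carrier B" "f \<in> carrier (free_alg X)"
  shows "free_lift B h f \<in> carrier B"
  unfolding free_lift_def
  by (rule finsum_closed)
    (use assms in \<open>auto simp: free_alg_def intro!: scale_closed word_eval_closed[of h X]\<close>)

lemma free_lift_add:
  assumes h: "h \<in> X \<rightarrow> carrier B" and f: "f \<in> carrier (free_alg X)" "g \<in> carrier (free_alg X)"
  shows "free_lift B h (f + g) = free_lift B h f \<oplus> free_lift B h g"
proof -
  let ?S = "Poly_Mapping.keys f \<union> Poly_Mapping.keys g"
  have S: "finite ?S" "\<forall>w\<in>?S. set (letters w) \<subseteq> X" "Poly_Mapping.keys (f + g) \<subseteq> ?S"
    using f keys_add[of f g] by (auto simp: free_alg_def)
  have c: "word_eval B h (letters w) \<in> carrier B" if "w \<in> ?S" for w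
    using word_eval_closed[OF h] S(2) that by blast
  let ?t = "\<lambda>f w. Poly_Mapping.lookup f w \<odot> word_eval B h (letters w)"
  have "free_lift B h (f + g) = (\<Oplus>w\<in>?S. ?t (f + g) w)"
    by (rule free_lift_alt[OF h S(1) S(3) S(2)])
  also have "\<dots> = (\<Oplus>w\<in>?S. ?t f w \<oplus> ?t g w)"
    by (rule finsum_cong') (auto simp: lookup_add scale_add_left c scale_closed)
  also have "\<dots> = (\<Oplus>w\<in>?S. ?t f w) \<oplus> (\<Oplus>w\<in>?S. ?t g w)"
    by (rule finsum_addf) (auto simp: c scale_closed)
  also have "(\<Oplus>w\<in>?S. ?t f w) = free_lift B h f"
    by (rule free_lift_alt[OF h S(1) _ S(2), symmetric]) simp
  also have "(\<Oplus>w\<in>?S. ?t g w) = free_lift B h g"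
    by (rule free_lift_alt[OF h S(1) _ S(2), symmetric]) simp
  finally show ?thesis .
qed

lemma free_lift_zero: "free_lift B h 0 = \<zero>"
  by (simp add: free_lift_def)

lemma free_lift_single:
  assumes "h \<in> X \<rightarrow> carrier B" "set (letters w) \<subseteq> X"
  shows "free_lift B h (Poly_Mapping.single w c) = c \<odot> word_eval B h (letters w)"
  by (subst free_lift_alt[of h X "{w}"])
    (use assms in \<open>auto simp: scale_closed word_eval_closed\<close>)

lemma free_induct [consumes 1, case_names zero add]:
  assumes f: "f \<in> carrier (free_alg X)"
    and "P 0"
    and add: "\<And>w c g. set (letters w) \<subseteq> X \<Longrightarrow> g \<in> carrier (free_alg X) \<Longrightarrow> P g \<Longrightarrow>
        P (Poly_Mapping.single w c + g)"
  shows "P (f :: ('g, 'k::field) ncpoly)"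
proof -
  interpret F: ring "free_alg X" by (rule free_alg_ring)
  have "P (\<Sum>w\<in>S. Poly_Mapping.single w (Poly_Mapping.lookup f w)) \<and>
      (\<Sum>w\<in>S. Poly_Mapping.single w (Poly_Mapping.lookup f w)) \<in> carrier (free_alg X)"
    if "finite S" "\<forall>w\<in>S. set (letters w) \<subseteq> X" for S
    using that
  proof (induction S)
    case empty
    then show ?case using assms(2) F.zero_closed by (simp add: free_alg_def)
  next
    case (insert w S)
    have "Poly_Mapping.single w (Poly_Mapping.lookup f w) \<in> carrier (free_alg X)"
      using insert by (auto simp: free_alg_def)
    then have "Poly_Mapping.single w (Poly_Mapping.lookup f w) \<oplus>\<^bsub>free_alg X\<^esub>
        (\<Sum>w\<in>S. Poly_Mapping.single w (Poly_Mapping.lookup f w)) \<in> carrier (free_alg X)"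
      using insert by (intro F.a_closed) auto
    then have "Poly_Mapping.single w (Poly_Mapping.lookup f w) +
        (\<Sum>w\<in>S. Poly_Mapping.single w (Poly_Mapping.lookup f w)) \<in> carrier (free_alg X)"
      by (simp add: free_alg_def)
    then show ?case using insert add by auto
  qed
  from this[of "Poly_Mapping.keys f"] f show ?thesis
    using poly_sum[of f] by (auto simp: free_alg_def)
qed

lemma free_lift_mult:
  assumes h: "h \<in> X \<rightarrow> carrier B" and f: "f \<in> carrier (free_alg X)" and g: "g \<in> carrier (free_alg X)"
  shows "free_lift B h (f * g) = free_lift B h f \<otimes> free_lift B h g"
proof -
  interpret F: ring "free_alg X" by (rule free_alg_ring)
  have mc: "a * b \<in> carrier (free_alg X)" if "a \<in> carrier (free_alg X)" "b \<in> carrier (free_alg X)"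
    for a b using F.m_closed[OF that] by (simp add: free_alg_def)
  have sc: "Poly_Mapping.single w c \<in> carrier (free_alg X)" if "set (letters w) \<subseteq> X" for w c
    using that by (auto simp: free_alg_def)
  have 1: "free_lift B h (Poly_Mapping.single w c * g) = free_lift B h (Poly_Mapping.single w c) \<otimes> free_lift B h g"
    if w: "set (letters w) \<subseteq> X" for w c
    using g
  proof (induction g rule: free_induct)
    case zero
    then show ?case by (simp add: free_lift_zero free_lift_closed[OF h sc[OF w]])
  next
    case (add v d g)
    have "free_lift B h (Poly_Mapping.single w c * Poly_Mapping.single v d)
      = (c * d) \<odot> word_eval B h (letters w @ letters v)"
      using add w by (simp add: mult_single free_lift_single[OF h] plus_word_def)
    also have "\<dots> = free_lift B h (Poly_Mapping.single w c) \<otimes> free_lift B h (Poly_Mapping.single v d)"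
      using add w
      by (simp add: free_lift_single[OF h] word_eval_append[OF h] scale_mult_left scale_mult_right
          word_eval_closed[OF h] scale_closed scale_scale mult.commute)
    finally show ?case using add w
      by (simp add: distrib_left free_lift_add[OF h] mc sc r_distr free_lift_closed[OF h])
  qed
  show ?thesis using f
  proof (induction f rule: free_induct)
    case zero
    then show ?case by (simp add: free_lift_zero free_lift_closed[OF h g])
  next
    case (add w c f)
    then show ?case
      by (simp add: distrib_right free_lift_add[OF h] mc sc l_distr free_lift_closed[OF h] g 1)
  qed
qed

lemma free_lift_scal: "h \<in> X \<rightarrow> carrier B \<Longrightarrow> free_lift B h (scal c) = c \<odot> \<one>"
  using free_lift_single[of h X 0 c] by (simp add: scal_def zero_word_def word_eval_def)

lemma free_lift_gen: "h \<in> X \<rightarrow> carrier B \<Longrightarrow> g \<in> X \<Longrightarrow> free_lift B h (gen g) = h g"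
  using free_lift_single[of h X "Word [g]" 1] funcset_mem[of h X "carrier B" g]
  by (simp add: gen_def word_eval_def scale_one)

lemma free_lift_ring_hom:
  assumes h: "h \<in> X \<rightarrow> carrier B"
  shows "free_lift B h \<in> ring_hom (free_alg X) B"
proof -
  have "free_lift B h 1 = \<one>"
    using free_lift_scal[OF h, of 1] by (simp add: scal_1 scale_one)
  then show ?thesis
    using free_lift_closed[OF h] free_lift_add[OF h] free_lift_mult[OF h]
    by (intro ring_hom_memI) (simp_all add: free_alg_def)
qed

lemma induced_hom_residue:
  assumes R: "R \<subseteq> carrier (free_alg X) \<times> carrier (free_alg X)"
    and h: "h \<in> X \<rightarrow> carrier B"
    and rels: "\<And>u v. (u, v) \<in> R \<Longrightarrow> free_lift B h u = free_lift B h v"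
    and f: "f \<in> carrier (free_alg X)"
  shows "induced_hom B h (residue X R f) = free_lift B h f"
proof -
  interpret F: ring "free_alg X" by (rule free_alg_ring)
  interpret H: ring_hom_ring "free_alg X" B "free_lift B h"
    by (rule ring_hom_ringI2) (auto intro: F.ring_axioms ring_axioms free_lift_ring_hom[OF h])
  interpret I: ideal "rel_ideal X R" "free_alg X" by (rule rel_ideal_ideal[OF R])
  let ?K = "a_kernel (free_alg X) B (free_lift B h)"
  have "u - v \<in> ?K" if uv: "(u, v) \<in> R" for u v
  proof -
    have "u \<in> carrier (free_alg X)" and v: "v \<in> carrier (free_alg X)" using R uv by auto
    moreover have "- v = \<ominus>\<^bsub>free_alg X\<^esub> v"
      by (rule F.minus_equality[symmetric]) (use v in \<open>auto simp: free_alg_def\<close>)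
    then have "u - v = u \<oplus>\<^bsub>free_alg X\<^esub> \<ominus>\<^bsub>free_alg X\<^esub> v"
      by (metis (no_types, lifting) free_alg_def ring.select_convs(2) diff_conv_add_uminus)
    moreover have "free_lift B h (u \<oplus>\<^bsub>free_alg X\<^esub> \<ominus>\<^bsub>free_alg X\<^esub> v) = \<zero>"
      using rels[OF uv] H.hom_closed[OF v] H.hom_add[OF \<open>u \<in> _\<close> F.a_inv_closed[OF v]]
        H.hom_a_inv[OF v] by (simp only: r_neg)
    moreover have "u \<oplus>\<^bsub>free_alg X\<^esub> \<ominus>\<^bsub>free_alg X\<^esub> v \<in> carrier (free_alg X)"
      using \<open>u \<in> _\<close> v by (intro F.a_closed F.a_inv_closed)
    ultimately show ?thesis by (simp only: a_kernel_def' mem_Collect_eq simp_thms)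
  qed
  then have "rel_ideal X R \<subseteq> ?K"
    unfolding rel_ideal_def by (intro F.genideal_minimal H.kernel_is_ideal) auto
  then have "free_lift B h (i \<oplus>\<^bsub>free_alg X\<^esub> f) = free_lift B h f" if "i \<in> rel_ideal X R" for i
  proof -
    have "i \<in> carrier (free_alg X)" "free_lift B h i = \<zero>"
      using that \<open>_ \<subseteq> ?K\<close> unfolding a_kernel_def' by blast+
    then show ?thesis using H.hom_add[of i f] f free_lift_closed[OF h f] by (simp only: l_zero)
  qed
  then have "free_lift B h ` residue X R f \<subseteq> {free_lift B h f}"
    unfolding residue_def a_r_coset_def' by blast
  moreover have "f \<in> residue X R f"
    unfolding residue_def using I.a_rcos_self[OF f] .
  ultimately have "free_lift B h ` residue X R f = {free_lift B h f}" by auto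
  then show ?thesis by (simp add: induced_hom_def)
qed

lemma induced_hom_alg_hom:
  assumes R: "R \<subseteq> carrier (free_alg X) \<times> carrier (free_alg X)"
    and h: "h \<in> X \<rightarrow> carrier B"
    and rels: "\<And>u v. (u, v) \<in> R \<Longrightarrow> free_lift B h u = free_lift B h v"
  shows "induced_hom B h \<in> alg_hom (presented_alg X R) B"
    and "g \<in> X \<Longrightarrow> induced_hom B h (residue X R (gen g)) = h g"
proof -
  have ev: "induced_hom B h (residue X R f) = free_lift B h f" if "f \<in> carrier (free_alg X)" for f
    using that rels by (intro induced_hom_residue[OF R h])
  interpret F: ring "free_alg X" by (rule free_alg_ring)
  have r: "residue X R \<in> alg_hom (free_alg X) (presented_alg X R)" by (rule residue_alg_hom[OF R])
  let ?P = "presented_alg X R"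
  have r': "residue X R \<in> ring_hom (free_alg X) ?P" using r by (simp add: alg_hom_def)
  note l = free_lift_ring_hom[OF h]
  have mult: "induced_hom B h (x \<otimes>\<^bsub>?P\<^esub> y) = induced_hom B h x \<otimes> induced_hom B h y"
    and add: "induced_hom B h (x \<oplus>\<^bsub>?P\<^esub> y) = induced_hom B h x \<oplus> induced_hom B h y"
    if xy: "x \<in> carrier ?P" "y \<in> carrier ?P" for x y
  proof -
    obtain f where f: "f \<in> carrier (free_alg X)" "x = residue X R f" using xy by (elim residue_surj)
    obtain g where g: "g \<in> carrier (free_alg X)" "y = residue X R g" using xy by (elim residue_surj)
    show "induced_hom B h (x \<otimes>\<^bsub>?P\<^esub> y) = induced_hom B h x \<otimes> induced_hom B h y"
      using f g by (simp flip: ring_hom_mult[OF r'] add: ev ring_hom_mult[OF l])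
    show "induced_hom B h (x \<oplus>\<^bsub>?P\<^esub> y) = induced_hom B h x \<oplus> induced_hom B h y"
      using f g by (simp flip: ring_hom_add[OF r'] add: ev ring_hom_add[OF l])
  qed
  have closed: "induced_hom B h x \<in> carrier B" if x: "x \<in> carrier ?P" for x
  proof -
    obtain f where f: "f \<in> carrier (free_alg X)" "x = residue X R f" using x by (elim residue_surj)
    then show ?thesis by (simp add: ev free_lift_closed[OF h])
  qed
  have one: "induced_hom B h \<one>\<^bsub>?P\<^esub> = \<one>"
    using ev[OF F.one_closed] by (simp add: ring_hom_one[OF r'] ring_hom_one[OF l])
  have smult: "induced_hom B h (c \<odot>\<^bsub>?P\<^esub> x) = c \<odot> induced_hom B h x" if x: "x \<in> carrier ?P" for c x
  proof -
    obtain f where f: "f \<in> carrier (free_alg X)" "x = residue X R f" using x by (elim residue_surj)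
    have s: "scal c \<otimes>\<^bsub>free_alg X\<^esub> f = c \<odot>\<^bsub>free_alg X\<^esub> f" by (simp add: free_alg_def)
    have "c \<odot>\<^bsub>?P\<^esub> x = residue X R (scal c \<otimes>\<^bsub>free_alg X\<^esub> f)"
      using r f by (simp add: alg_hom_def s)
    then have "induced_hom B h (c \<odot>\<^bsub>?P\<^esub> x) = free_lift B h (scal c) \<otimes> free_lift B h f"
      using ev f F.m_closed[OF scal_in_free[of c] f(1)] by (simp add: ring_hom_mult[OF l scal_in_free])
    then show ?thesis
      using f by (simp add: free_lift_scal[OF h] scale_mult_left free_lift_closed[OF h] ev)
  qed
  show "induced_hom B h \<in> alg_hom ?P B"
    using mult add closed one smult unfolding alg_hom_def ring_hom_def by auto
  show "g \<in> X \<Longrightarrow> induced_hom B h (residue X R (gen g)) = h g"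
    by (simp add: ev gen_in_free free_lift_gen[OF h])
qed

lemma free_lift_diff:
  assumes h: "h \<in> X \<rightarrow> carrier B" and f: "f \<in> carrier (free_alg X)" "g \<in> carrier (free_alg X)"
  shows "free_lift B h (f - g) = free_lift B h f \<oplus> (-1) \<odot> free_lift B h g"
proof -
  interpret F: ring "free_alg X" by (rule free_alg_ring)
  have "scal (-1) * g \<in> carrier (free_alg X)"
    using F.m_closed[OF scal_in_free f(2)] by (simp add: free_alg_def)
  moreover have "f - g = f + scal (-1) * g"
    by (simp add: scal_def single_uminus)
  ultimately show ?thesis
    using f by (simp only: free_lift_add[OF h] free_lift_mult[OF h] scal_in_free free_lift_scal[OF h]
      scale_mult_left one_closed l_one free_lift_closed[OF h])
qed

definition qc where
  "qc r u v = r \<odot> (u \<otimes> v) \<oplus> (- inverse r) \<odot> (v \<otimes> u)"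

lemma qc_closed: "u \<in> carrier B \<Longrightarrow> v \<in> carrier B \<Longrightarrow> qc r u v \<in> carrier B"
  by (simp add: qc_def scale_closed)

lemma qc_add: "u \<in> carrier B \<Longrightarrow> v \<in> carrier B \<Longrightarrow> v' \<in> carrier B \<Longrightarrow> 
   qc r u (v \<oplus> v') = qc r u v \<oplus> qc r u v'"
  by (simp add: qc_def scale_closed l_distr r_distr scale_add_right a_ac)

lemma qc_scale: "u \<in> carrier B \<Longrightarrow> v \<in> carrier B \<Longrightarrow> qc r u (c \<odot> v) = c \<odot> qc r u v"
  by (simp add: qc_def scale_closed scale_mult_left scale_mult_right scale_scale scale_add_right mult.commute)

lemma scale_collect: "u \<in> carrier B \<Longrightarrow> v \<in> carrier B \<Longrightarrow> 
   (a \<odot> u \<oplus> b \<odot> v) \<oplus> (c \<odot> u \<oplus> d \<odot> v) = (a + c) \<odot> u \<oplus> (b + d) \<odot> v"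
  by (simp add: scale_add_left scale_closed a_ac)

lemma qc_qc:
  assumes c: "x \<in> carrier B" "xi \<in> carrier B" "y \<in> carrier B"
    and i: "xi \<otimes> x = \<one>" "x \<otimes> xi = \<one>"
    and yx: "y \<otimes> x = (inverse q ^ 2) \<odot> (x \<otimes> y)" and yxi: "y \<otimes> xi = (q ^ 2) \<odot> (xi \<otimes> y)"
    and q: "q \<noteq> 0"
  shows "qc (inverse q) (x \<oplus> xi) (qc q (x \<oplus> xi) y) = rho q \<odot> y"
proof -
  have sc: "q + - inverse q * inverse q ^ 2 = q - inverse q ^ 3" "q + - inverse q * q ^ 2 = 0"
      "inverse q + - q * inverse q ^ 2 = 0" "inverse q + - q * q ^ 2 = inverse q - q ^ 3"
    using q by (simp_all add: power2_eq_square power3_eq_cube mult.assoc flip: mult.assoc)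
  have "qc q (x \<oplus> xi) y = (q \<odot> (x \<otimes> y) \<oplus> q \<odot> (xi \<otimes> y)) \<oplus>
      ((- inverse q * inverse q ^ 2) \<odot> (x \<otimes> y) \<oplus> (- inverse q * q ^ 2) \<odot> (xi \<otimes> y))"
    using c by (simp add: qc_def l_distr r_distr scale_add_right scale_closed yx yxi scale_scale)
  also have "\<dots> = (q - inverse q ^ 3) \<odot> (x \<otimes> y) \<oplus> 0 \<odot> (xi \<otimes> y)"
    using c by (subst scale_collect) (simp_all only: sc m_closed)
  finally have A: "qc q (x \<oplus> xi) y = (q - inverse q ^ 3) \<odot> (x \<otimes> y)"
    using c by (simp add: scale_zero_left scale_closed)
  have e: "xi \<otimes> (x \<otimes> y) = y" "(x \<otimes> y) \<otimes> x = (inverse q ^ 2) \<odot> (x \<otimes> (x \<otimes> y))"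
      "(x \<otimes> y) \<otimes> xi = (q ^ 2) \<odot> y"
    using c by (simp_all add: m_assoc yx yxi scale_mult_right)
      (simp_all add: i flip: m_assoc)
  have "qc (inverse q) (x \<oplus> xi) (x \<otimes> y) = (inverse q \<odot> (x \<otimes> (x \<otimes> y)) \<oplus> inverse q \<odot> y) \<oplus>
      ((- q * inverse q ^ 2) \<odot> (x \<otimes> (x \<otimes> y)) \<oplus> (- q * q ^ 2) \<odot> y)"
    using c by (simp add: qc_def l_distr[of x xi] r_distr[of x xi] scale_add_right scale_closed e scale_scale)
  also have "\<dots> = 0 \<odot> (x \<otimes> (x \<otimes> y)) \<oplus> (inverse q - q ^ 3) \<odot> y"
    using c by (subst scale_collect) (simp_all only: sc m_closed)
  finally have "qc (inverse q) (x \<oplus> xi) (x \<otimes> y) = (inverse q - q ^ 3) \<odot> y"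
    using c by (simp add: scale_zero_left scale_closed)
  moreover have "(q - inverse q ^ 3) * (inverse q - q ^ 3) = rho q"
    using q by (simp add: rho_def field_simps power2_eq_square power3_eq_cube)
  ultimately show ?thesis using c by (simp add: A qc_scale scale_scale)
qed

lemma free_lift_qcomm:
  assumes h: "h \<in> X \<rightarrow> carrier B" and f: "f \<in> carrier (free_alg X)" "g \<in> carrier (free_alg X)"
  shows "free_lift B h (qcomm r f g) = qc r (free_lift B h f) (free_lift B h g)"
proof -
  interpret F: ring "free_alg X" by (rule free_alg_ring)
  have mc: "a * b \<in> carrier (free_alg X)" if "a \<in> carrier (free_alg X)" "b \<in> carrier (free_alg X)"
    for a b using F.m_closed[OF that] by (simp add: free_alg_def)
  show ?thesis using f
    by (simp add: qcomm_def qc_def free_lift_diff[OF h] free_lift_mult[OF h] mc scal_in_free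
        free_lift_closed[OF h] scale_one free_lift_scal[OF h] scale_mult_left scale_scale scale_closed)
qed

lemma free_lift_comm:
  assumes h: "h \<in> X \<rightarrow> carrier B" and f: "f \<in> carrier (free_alg X)" "g \<in> carrier (free_alg X)"
  shows "free_lift B h (comm f g) = qc 1 (free_lift B h f) (free_lift B h g)"
proof -
  have "comm f g = qcomm 1 f g" by (simp add: comm_def qcomm_def scal_1)
  then show ?thesis by (simp only: free_lift_qcomm[OF h f])
qed

end

lemma onsager_rels_carrier: "onsager_rels q \<subseteq> carrier (free_alg UNIV) \<times> carrier (free_alg UNIV)"
  by (auto simp: free_alg_def)

lemma torus_rels_carrier: "torus_rels q \<subseteq> carrier (free_alg UNIV) \<times> carrier (free_alg UNIV)"
  by (auto simp: free_alg_def)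

lemma rel_residue_eq:
  assumes R: "R \<subseteq> carrier (free_alg X) \<times> carrier (free_alg X)" and uv: "(u, v) \<in> R"
  shows "residue X R u = residue X R v"
proof -
  interpret F: ring "free_alg X" by (rule free_alg_ring)
  interpret I: ideal "rel_ideal X R" "free_alg X" by (rule rel_ideal_ideal[OF R])
  have c: "u \<in> carrier (free_alg X)" "v \<in> carrier (free_alg X)" using R uv by auto
  have "- v = \<ominus>\<^bsub>free_alg X\<^esub> v"
    by (rule F.minus_equality[symmetric]) (use c in \<open>auto simp: free_alg_def\<close>)
  then have m: "u \<ominus>\<^bsub>free_alg X\<^esub> v = u - v"
    unfolding a_minus_def by (simp add: free_alg_def flip: diff_conv_add_uminus)
  have "u - v \<in> rel_ideal X R"
    using uv unfolding rel_ideal_def genideal_def by blast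
  then show ?thesis
    unfolding residue_def using F.quotient_eq_iff_same_a_r_cos[OF I.ideal_axioms c] m by simp
qed

lemma torus_hom_props:
  fixes q :: "'k::field"
  assumes q: "q \<noteq> 0"
  shows "torus_hom q \<in> alg_hom (onsager_alg q) (torus_alg q)"
    and "torus_hom q (onsager_elem q (gen OW0)) = tX q \<oplus>\<^bsub>torus_alg q\<^esub> tXinv q"
    and "torus_hom q (onsager_elem q (gen OW1)) = tY q \<oplus>\<^bsub>torus_alg q\<^esub> tYinv q"
proof -
  interpret B: k_algebra "torus_alg q"
    unfolding torus_alg_def by (rule presented_k_algebra[OF torus_rels_carrier])
  let ?B = "torus_alg q"
  have res: "torus_elem q \<in> alg_hom (free_alg UNIV) ?B"
    unfolding torus_elem_def torus_alg_def by (rule residue_alg_hom[OF torus_rels_carrier])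
  have fc: "f \<in> carrier (free_alg UNIV)" for f :: "('g,'k) ncpoly" by (simp add: free_alg_def)
  have cl: "torus_elem q f \<in> carrier ?B" for f
    using res fc by (auto simp: alg_hom_def ring_hom_def)
  have mu: "torus_elem q (f * g) = torus_elem q f \<otimes>\<^bsub>?B\<^esub> torus_elem q g" for f g
    using ring_hom_mult[of "torus_elem q" "free_alg UNIV" ?B f g] res fc
    by (simp add: alg_hom_def) (simp add: free_alg_def)
  have on: "torus_elem q 1 = \<one>\<^bsub>?B\<^esub>"
    using ring_hom_one[of "torus_elem q" "free_alg UNIV" ?B] res by (simp add: alg_hom_def) (simp add: free_alg_def)
  have sm: "torus_elem q (scal c * f) = c \<odot>\<^bsub>?B\<^esub> torus_elem q f" for c f
    using res fc[of f] by (simp add: alg_hom_def) (simp add: free_alg_def)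
  have rel: "torus_elem q u = torus_elem q v" if "(u, v) \<in> torus_rels q" for u v
    unfolding torus_elem_def by (rule rel_residue_eq[OF torus_rels_carrier that])
  let ?x = "tX q" and ?xi = "tXinv q" and ?y = "tY q" and ?yi = "tYinv q"
  have inv: "?x \<otimes>\<^bsub>?B\<^esub> ?xi = \<one>\<^bsub>?B\<^esub>" "?xi \<otimes>\<^bsub>?B\<^esub> ?x = \<one>\<^bsub>?B\<^esub>"
    "?y \<otimes>\<^bsub>?B\<^esub> ?yi = \<one>\<^bsub>?B\<^esub>" "?yi \<otimes>\<^bsub>?B\<^esub> ?y = \<one>\<^bsub>?B\<^esub>"
    unfolding mu[symmetric] on[symmetric] by (rule rel; simp add: torus_rels_def)+
  have xy: "?x \<otimes>\<^bsub>?B\<^esub> ?y = (q\<^sup>2) \<odot>\<^bsub>?B\<^esub> (?y \<otimes>\<^bsub>?B\<^esub> ?x)"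
    unfolding mu[symmetric] sm[symmetric] mult.assoc[symmetric] by (rule rel) (simp add: torus_rels_def)
  have swap: "b \<otimes>\<^bsub>?B\<^esub> ai = c \<odot>\<^bsub>?B\<^esub> (ai \<otimes>\<^bsub>?B\<^esub> b)"
    if "a \<in> carrier ?B" "ai \<in> carrier ?B" "b \<in> carrier ?B" "a \<otimes>\<^bsub>?B\<^esub> ai = \<one>\<^bsub>?B\<^esub>" "ai \<otimes>\<^bsub>?B\<^esub> a = \<one>\<^bsub>?B\<^esub>"
      and ab: "a \<otimes>\<^bsub>?B\<^esub> b = c \<odot>\<^bsub>?B\<^esub> (b \<otimes>\<^bsub>?B\<^esub> a)" for a ai b c
  proof -
    have "b \<otimes>\<^bsub>?B\<^esub> ai = ai \<otimes>\<^bsub>?B\<^esub> (a \<otimes>\<^bsub>?B\<^esub> b) \<otimes>\<^bsub>?B\<^esub> ai"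
      using that(1-5) by (simp flip: B.m_assoc)
    also have "\<dots> = c \<odot>\<^bsub>?B\<^esub> (ai \<otimes>\<^bsub>?B\<^esub> b \<otimes>\<^bsub>?B\<^esub> (a \<otimes>\<^bsub>?B\<^esub> ai))"
      unfolding ab using that(1-3) by (simp add: B.scale_mult_left B.scale_mult_right B.m_assoc)
    finally show ?thesis using that(1-5) by simp
  qed
  have flip: "b \<otimes>\<^bsub>?B\<^esub> a = inverse c \<odot>\<^bsub>?B\<^esub> (a \<otimes>\<^bsub>?B\<^esub> b)"
    if "a \<in> carrier ?B" "b \<in> carrier ?B" "c \<noteq> 0" "a \<otimes>\<^bsub>?B\<^esub> b = c \<odot>\<^bsub>?B\<^esub> (b \<otimes>\<^bsub>?B\<^esub> a)" for a b c
    using that by (simp add: B.scale_scale B.scale_one)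
  have yxi: "?y \<otimes>\<^bsub>?B\<^esub> ?xi = q\<^sup>2 \<odot>\<^bsub>?B\<^esub> (?xi \<otimes>\<^bsub>?B\<^esub> ?y)"
    by (rule swap[OF _ _ _ inv(1,2) xy]) (rule cl)+
  have xiyi: "?xi \<otimes>\<^bsub>?B\<^esub> ?yi = q\<^sup>2 \<odot>\<^bsub>?B\<^esub> (?yi \<otimes>\<^bsub>?B\<^esub> ?xi)"
    by (rule swap[OF _ _ _ inv(3,4) yxi]) (rule cl)+
  have yix: "?yi \<otimes>\<^bsub>?B\<^esub> ?x = q\<^sup>2 \<odot>\<^bsub>?B\<^esub> (?x \<otimes>\<^bsub>?B\<^esub> ?yi)"
    by (rule swap[OF _ _ _ inv(2,1) xiyi]) (rule cl)+
  have q2: "q\<^sup>2 \<noteq> 0" using q by simp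
  note fl = flip[OF cl cl q2, folded power_inverse]
  let ?X = "?x \<oplus>\<^bsub>?B\<^esub> ?xi" and ?Y = "?y \<oplus>\<^bsub>?B\<^esub> ?yi"
  have c': "?X \<in> carrier ?B" "?Y \<in> carrier ?B" by (simp_all add: cl)
  have dg: "B.qc (inverse q) (u \<oplus>\<^bsub>?B\<^esub> ui) (B.qc q (u \<oplus>\<^bsub>?B\<^esub> ui) (v \<oplus>\<^bsub>?B\<^esub> vi)) = rho q \<odot>\<^bsub>?B\<^esub> (v \<oplus>\<^bsub>?B\<^esub> vi)"
    if "u \<in> carrier ?B" "ui \<in> carrier ?B" "v \<in> carrier ?B" "vi \<in> carrier ?B"
      "ui \<otimes>\<^bsub>?B\<^esub> u = \<one>\<^bsub>?B\<^esub>" "u \<otimes>\<^bsub>?B\<^esub> ui = \<one>\<^bsub>?B\<^esub>"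
      "v \<otimes>\<^bsub>?B\<^esub> u = inverse q ^ 2 \<odot>\<^bsub>?B\<^esub> (u \<otimes>\<^bsub>?B\<^esub> v)" "v \<otimes>\<^bsub>?B\<^esub> ui = q\<^sup>2 \<odot>\<^bsub>?B\<^esub> (ui \<otimes>\<^bsub>?B\<^esub> v)"
      "vi \<otimes>\<^bsub>?B\<^esub> ui = inverse q ^ 2 \<odot>\<^bsub>?B\<^esub> (ui \<otimes>\<^bsub>?B\<^esub> vi)" "vi \<otimes>\<^bsub>?B\<^esub> u = q\<^sup>2 \<odot>\<^bsub>?B\<^esub> (u \<otimes>\<^bsub>?B\<^esub> vi)"
    for u ui v vi
    using B.qc_qc[of u ui v q] B.qc_qc[of ui u vi q] that q B.a_comm[of u ui]
    by (simp add: B.qc_add B.qc_closed B.scale_add_right)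
  have dg0: "B.qc (inverse q) ?X (B.qc q ?X ?Y) = rho q \<odot>\<^bsub>?B\<^esub> ?Y"
    by (rule dg) (rule cl inv yxi yix fl[OF xy] fl[OF xiyi])+
  have dg1: "B.qc (inverse q) ?Y (B.qc q ?Y (?xi \<oplus>\<^bsub>?B\<^esub> ?x)) = rho q \<odot>\<^bsub>?B\<^esub> (?xi \<oplus>\<^bsub>?B\<^esub> ?x)"
    by (rule dg) (rule cl inv xy xiyi fl[OF yxi] fl[OF yix])+
  define h where "h = (\<lambda>g. case g of OW0 \<Rightarrow> ?X | OW1 \<Rightarrow> ?Y)"
  have h: "h \<in> UNIV \<rightarrow> carrier ?B" using c' by (auto simp: h_def split: onsager_gen.split)
  have rels: "free_lift ?B h u = free_lift ?B h v" if "(u, v) \<in> onsager_rels q" for u v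
  proof -
    from that obtain A C :: onsager_gen
      where AC: "(A, C) = (OW0, OW1) \<or> (A, C) = (OW1, OW0)"
        and u: "u = comm (gen A) (qcomm (inverse q) (gen A) (qcomm q (gen A) (gen C)))"
        and v: "v = scal (rho q) * comm (gen A) (gen C)"
      unfolding onsager_rels_def by auto
    have g: "free_lift ?B h (gen g) = h g" for g by (rule B.free_lift_gen[OF h]) simp
    have hc: "h g \<in> carrier ?B" for g using h by auto
    have "B.qc (inverse q) (h A) (B.qc q (h A) (h C)) = rho q \<odot>\<^bsub>?B\<^esub> h C"
      using AC dg0 dg1 B.a_comm[of ?x ?xi] by (auto simp: h_def cl)
    then show ?thesis
      unfolding u v
      by (simp add: B.free_lift_comm[OF h] B.free_lift_qcomm[OF h] B.free_lift_mult[OF h] fc g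
          B.free_lift_scal[OF h] B.scale_mult_left B.qc_closed hc B.qc_scale)
  qed
  have th: "torus_hom q = induced_hom ?B h" by (simp add: torus_hom_def h_def)
  show "torus_hom q \<in> alg_hom (onsager_alg q) ?B"
    unfolding th onsager_alg_def by (rule B.induced_hom_alg_hom(1)[OF onsager_rels_carrier h]) (rule rels)
  show "torus_hom q (onsager_elem q (gen OW0)) = ?X" "torus_hom q (onsager_elem q (gen OW1)) = ?Y"
    unfolding th onsager_elem_def using B.induced_hom_alg_hom(2)[OF onsager_rels_carrier h] rels by (simp_all add: h_def)
qed

lemma tensor_rels_carrier:
  assumes "k_algebra A" "k_algebra B"
  shows "tensor_rels A B \<subseteq> carrier (free_alg (carrier A \<times> carrier B)) \<times>
    carrier (free_alg (carrier A \<times> carrier B))"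
proof -
  interpret A: k_algebra A by fact
  interpret B: k_algebra B by fact
  interpret F: ring "free_alg (carrier A \<times> carrier B)" by (rule free_alg_ring)
  have mc: "a * b \<in> carrier (free_alg (carrier A \<times> carrier B))" 
    if "a \<in> carrier (free_alg (carrier A \<times> carrier B))" "b \<in> carrier (free_alg (carrier A \<times> carrier B))"
    for a b using F.m_closed[OF that] by (simp add: free_alg_def)
  have ac: "a + b \<in> carrier (free_alg (carrier A \<times> carrier B))" 
    if "a \<in> carrier (free_alg (carrier A \<times> carrier B))" "b \<in> carrier (free_alg (carrier A \<times> carrier B))"
    for a b using F.a_closed[OF that] by (simp add: free_alg_def)
  have oc: "1 \<in> carrier (free_alg (carrier A \<times> carrier B))"
    using F.one_closed by (simp add: free_alg_def)
  show ?thesis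
    by (auto elim!: tensor_rels.cases intro!: mc ac gen_in_free scal_in_free oc A.scale_closed B.scale_closed)
qed

lemma zpoly_k_algebra: "k_algebra (zpoly_alg :: ('k::field, 'k zpoly) module)"
proof -
  have sm: "Poly_Mapping.single 0 (c * d) =
      (Poly_Mapping.single 0 c * Poly_Mapping.single 0 d :: 'k zpoly)" for c d
    by (simp add: mult_single)
  show ?thesis
  proof (intro k_algebra.intro k_algebra_axioms.intro ringI abelian_groupI monoidI, goal_cases)
    case (6 x)
    then show ?case by (auto simp: zpoly_alg_def intro: exI[of _ "-x"])
  qed (simp_all add: zpoly_alg_def algebra_simps single_add sm)
qed

lemma set_z_zero_props:
  fixes q :: "'k::field"
  shows "set_z_zero q \<in> alg_hom (onsager_z_alg q) (onsager_alg q)"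
    and "a \<in> carrier (onsager_alg q) \<Longrightarrow>
      set_z_zero q (tensor (onsager_alg q) zpoly_alg a f) = Poly_Mapping.lookup f 0 \<odot>\<^bsub>onsager_alg q\<^esub> a"
proof -
  interpret B: k_algebra "onsager_alg q"
    unfolding onsager_alg_def by (rule presented_k_algebra[OF onsager_rels_carrier])
  let ?B = "onsager_alg q" and ?X = "carrier (onsager_alg q) \<times> carrier (zpoly_alg :: ('k, 'k zpoly) module)"
  define h where "h = (\<lambda>(a, f :: 'k zpoly). Poly_Mapping.lookup f 0 \<odot>\<^bsub>?B\<^esub> a)"
  note R = tensor_rels_carrier[OF B.k_algebra_axioms zpoly_k_algebra]
  have h: "h \<in> ?X \<rightarrow> carrier ?B" by (auto simp: h_def B.scale_closed)
  have l0: "Poly_Mapping.lookup (f * g) 0 = Poly_Mapping.lookup f 0 * Poly_Mapping.lookup g 0"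
    for f g :: "'k zpoly"
  proof -
    have "k + l = 0 \<longleftrightarrow> k = 0 \<and> l = 0" for k l :: "nat \<Rightarrow>\<^sub>0 nat"
      by (auto simp: poly_mapping_eq_iff fun_eq_iff lookup_add)
    moreover have "(\<Sum>b. Poly_Mapping.lookup g b when a = 0 \<and> b = 0) =
        (Poly_Mapping.lookup g 0 when a = 0)" for a :: "nat \<Rightarrow>\<^sub>0 nat"
      by (cases "a = 0") simp_all
    ultimately show ?thesis
      by (simp add: lookup_mult mult_when)
  qed
  have cu: "f \<in> carrier zpoly_alg" for f :: "'k zpoly" by (simp add: zpoly_alg_def)
  interpret F: ring "free_alg ?X" by (rule free_alg_ring)
  have L: "free_lift ?B h (gen (a, f)) = Poly_Mapping.lookup f 0 \<odot>\<^bsub>?B\<^esub> a"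
    and G: "gen (a, f) \<in> carrier (free_alg ?X)" if "a \<in> carrier ?B" for a f
    using that cu by (simp_all add: B.free_lift_gen[OF h] gen_in_free) (simp add: h_def)
  have one: "free_lift ?B h 1 = \<one>\<^bsub>?B\<^esub>"
    using B.free_lift_scal[OF h, of 1] by (simp add: scal_1 B.scale_one)
  have Z: "f \<oplus>\<^bsub>zpoly_alg\<^esub> g = f + g" "f \<otimes>\<^bsub>zpoly_alg\<^esub> g = f * g" "\<one>\<^bsub>zpoly_alg\<^esub> = (1 :: 'k zpoly)"
      "c \<odot>\<^bsub>zpoly_alg\<^esub> f = Poly_Mapping.single 0 c * f" for c and f g :: "'k zpoly"
    by (simp_all add: zpoly_alg_def)
  have rels: "free_lift ?B h u = free_lift ?B h v" if "(u, v) \<in> tensor_rels ?B zpoly_alg" for u v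
    using that
    by (cases rule: tensor_rels.cases)
      (simp_all add: B.free_lift_add[OF h] B.free_lift_mult[OF h] L G scal_in_free
        B.free_lift_scal[OF h] B.scale_closed Z lookup_add B.scale_add_left B.scale_add_right
        B.scale_mult_left B.scale_mult_right B.scale_scale l0 B.scale_one one mult.commute)
  have th: "set_z_zero q = induced_hom ?B h" by (simp add: set_z_zero_def h_def)
  show "set_z_zero q \<in> alg_hom (onsager_z_alg q) (onsager_alg q)"
    unfolding th onsager_z_alg_def tensor_alg_def by (rule B.induced_hom_alg_hom(1)[OF R h]) (rule rels)
  show "a \<in> carrier (onsager_alg q) \<Longrightarrow>
      set_z_zero q (tensor (onsager_alg q) zpoly_alg a f) = Poly_Mapping.lookup f 0 \<odot>\<^bsub>onsager_alg q\<^esub> a"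
    unfolding th tensor_def using B.induced_hom_alg_hom(2)[OF R h, of "(a, f)"] rels by (simp add: h_def cu)
qed

end

theory Submission
  imports Defs
begin

text \<open>
  Let \<open>\<Psi>\<close> be the canonical map from the free algebra on the generators of the alternating central
  extension to the extension, followed by \<open>\<gamma>\<close> and \<open>p\<close>. It satisfies the defining relations and kills \<open>\<Z>\<^sub>n\<close> for \<open>n \<ge> 1\<close>, and
  this determines it: \<open>[\<W>\<^sub>-\<^sub>k, \<W>\<^sub>1]\<close> gives the difference of the two generators \<open>\<G>\<close> of index
  \<open>n = k + 1\<close>; up to generators of lower index, \<open>\<Z>\<^sub>n\<close> is a nonzero multiple of \<open>q\<^sup>-\<^sup>n\<close> times the
  first plus \<open>q\<^sup>n\<close> times the second, which gives both when \<open>q\<^sup>n + q\<^sup>-\<^sup>n \<noteq> 0\<close>; and the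
  \<open>q\<close>-commutators of \<open>\<G>\<^sub>n\<close> with \<open>\<W>\<^sub>0\<close> and \<open>\<W>\<^sub>1\<close> give the next \<open>\<W>\<close>'s. So it suffices that the
  claimed values satisfy these relations and make all \<open>\<Z>\<^sub>n\<close> with \<open>n \<ge> 1\<close> vanish. The latter holds
  because \<open>f(t) = (1 - 4t\<^sup>2/(q + q\<^sup>-\<^sup>1)\<^sup>2)\<^bsup>-1/2\<^esup>\<close>, the generating function of the values, becomes rational
  in \<open>t\<close> after substituting \<open>S\<close> or \<open>T\<close>.

  If \<open>q\<^sup>n + q\<^sup>-\<^sup>n = 0\<close> for some \<open>n\<close>, take the least one: setting \<open>z\<^sub>n = 1\<close> instead of \<open>z\<^sub>n = 0\<close> does not
  change the values of lower index, hence not that of \<open>\<Z>\<^sub>n\<close>, so \<open>0 = 1\<close> in \<open>T\<^sub>q\<close>.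
\<close>

section \<open>Homomorphisms out of the free algebra\<close>

lemma free_alg_closed:
  fixes f g :: "('g, 'k::field) ncpoly"
  assumes "f \<in> carrier (free_alg X)" "g \<in> carrier (free_alg X)"
  shows "f + g \<in> carrier (free_alg X)" "f * g \<in> carrier (free_alg X)" "f - g \<in> carrier (free_alg X)"
proof -
  interpret F: ring "free_alg X :: ('k, ('g, 'k) ncpoly) module" by (rule free_alg_ring)
  have ac: "a + b \<in> carrier (free_alg X)" and mc: "a * b \<in> carrier (free_alg X)"
    if "a \<in> carrier (free_alg X)" "b \<in> carrier (free_alg X)" for a b :: "('g, 'k) ncpoly"
    using F.a_closed[OF that] F.m_closed[OF that] by (simp_all add: free_alg_def)
  show "f + g \<in> carrier (free_alg X)" "f * g \<in> carrier (free_alg X)"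
    using assms ac mc by auto
  have "f - g = f + scal (- 1) * g" by (simp add: scal_def single_uminus)
  then show "f - g \<in> carrier (free_alg X)"
    using ac mc assms scal_in_free by metis
qed

lemma free_alg_zero_closed: "0 \<in> carrier (free_alg X)"
  by (simp add: free_alg_def)

lemma free_alg_sum_closed:
  "(\<And>i. i \<in> A \<Longrightarrow> f i \<in> carrier (free_alg X)) \<Longrightarrow> sum f A \<in> carrier (free_alg X)"
  by (induction A rule: infinite_finite_induct) (auto intro: free_alg_closed free_alg_zero_closed)

lemma free_alg_mono: "X \<subseteq> Y \<Longrightarrow> carrier (free_alg X) \<subseteq> carrier (free_alg Y)"
  by (auto simp: free_alg_def)

lemma free_alg_UNIV: "f \<in> carrier (free_alg UNIV)"
  by (simp add: free_alg_def)

text \<open>Homomorphisms are kept on the free algebra instead of the quotient: a relation is then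
  an equation between two values of \<open>H\<close>, and no cosets occur in the
  computations.\<close>

locale free_hom = k_algebra B for B :: "('k::field, 'b) module" (structure) +
  fixes H :: "('g, 'k) ncpoly \<Rightarrow> 'b"
  assumes H_alg_hom: "H \<in> alg_hom (free_alg UNIV) B"
begin

lemma hom_closed: "H f \<in> carrier B"
  using H_alg_hom free_alg_UNIV[of f] by (auto simp: alg_hom_def ring_hom_def)

lemma hom_add: "H (f + g) = H f \<oplus> H g"
  using H_alg_hom ring_hom_add[of H "free_alg UNIV" B f g]
  by (auto simp: alg_hom_def free_alg_def)

lemma hom_mult: "H (f * g) = H f \<otimes> H g"
  using H_alg_hom ring_hom_mult[of H "free_alg UNIV" B f g]
  by (auto simp: alg_hom_def free_alg_def)

lemma hom_one: "H 1 = \<one>"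
  using H_alg_hom ring_hom_one[of H "free_alg UNIV" B]
  by (auto simp: alg_hom_def free_alg_def)

lemma hom_smult: "H (scal c * f) = c \<odot> H f"
  using H_alg_hom by (auto simp: alg_hom_def free_alg_def)

lemma hom_scal: "H (scal c) = c \<odot> \<one>"
  using hom_smult[of c 1] by (simp add: hom_one)

lemma hom_zero: "H 0 = \<zero>"
  using hom_smult[of 0 0] by (simp add: scal_0 scale_zero_left hom_closed)

lemma hom_diff: "H (f - g) = H f \<oplus> (- 1) \<odot> H g"
proof -
  have "f - g = f + scal (- 1) * g" by (simp add: scal_def single_uminus)
  then show ?thesis by (simp only: hom_add hom_smult)
qed

lemma hom_qcomm: "H (qcomm r u v) = qc r (H u) (H v)"
  by (simp add: qcomm_def qc_def hom_diff hom_mult hom_scal mult.assoc scale_scale scale_mult_left hom_closed)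

lemma hom_sum_cong: "(\<And>i. i \<in> A \<Longrightarrow> H (f i) = H (g i)) \<Longrightarrow> H (sum f A) = H (sum g A)"
  by (induction A rule: infinite_finite_induct) (auto simp: hom_add)

end

text \<open>Words in \<open>X\<close> span the subalgebra generated by \<open>X\<close>. Restricting
  to \<open>X\<close> is what later permits an induction over the degree of the generators.\<close>

lemma free_hom_eqI:
  fixes B :: "('k::field, 'b) module"
  assumes "free_hom B H" "free_hom B H'"
    and eq: "\<And>g. g \<in> X \<Longrightarrow> H (gen g) = H' (gen g)" and f: "f \<in> carrier (free_alg X)"
  shows "H f = H' f"
proof -
  interpret H: free_hom B H by fact
  interpret H': free_hom B H' by fact
  have word: "H (Poly_Mapping.single (Word gs) 1) = H' (Poly_Mapping.single (Word gs) 1)"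
    if "set gs \<subseteq> X" for gs
    using that
  proof (induction gs)
    case Nil
    show ?case using H.hom_one H'.hom_one by (simp flip: zero_word_def)
  next
    case (Cons g gs)
    have "Poly_Mapping.single (Word (g # gs)) (1::'k) = gen g * Poly_Mapping.single (Word gs) 1"
      by (simp add: gen_def mult_single plus_word_def)
    then show ?case using Cons eq by (simp add: H.hom_mult H'.hom_mult)
  qed
  from f show ?thesis
  proof (induction f rule: H.free_induct)
    case zero
    show ?case by (simp add: H.hom_zero H'.hom_zero)
  next
    case (add w c g)
    have "Poly_Mapping.single w c = scal c * Poly_Mapping.single (Word (letters w)) 1"
      by (simp add: scal_times_single)
    then show ?case
      using add word[of "letters w"] by (simp add: H.hom_add H'.hom_add H.hom_smult H'.hom_smult)
  qed
qed

section \<open>Uniqueness of the alternating elements\<close>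

text \<open>Graded so that \<open>\<Z>\<^sub>n\<close> lies in degree \<open>n - 1\<close> up to a combination of the \<open>\<G>\<close>'s of index \<open>n\<close>.\<close>

fun ace_deg :: "ace_gen \<Rightarrow> nat" where
  "ace_deg (AWm i) = i"
| "ace_deg (AWp i) = i"
| "ace_deg (AG i) = Suc i"
| "ace_deg (AGt i) = Suc i"

text \<open>A subalgebra, not a filtration by total degree: products of any length in generators of
  degree at most \<open>n\<close> stay inside.\<close>

definition ace_low :: "nat \<Rightarrow> (ace_gen, 'k::field) ncpoly set" where
  "ace_low n = carrier (free_alg {g. ace_deg g \<le> n})"

lemma ace_low_gen: "ace_deg g \<le> n \<Longrightarrow> gen g \<in> ace_low n"
  by (simp add: ace_low_def gen_in_free)

lemma ace_low_mono: "f \<in> ace_low m \<Longrightarrow> m \<le> n \<Longrightarrow> f \<in> ace_low n"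
  unfolding ace_low_def by (rule subsetD[OF free_alg_mono]) auto

lemmas ace_low_closed =
  free_alg_closed[of _ "{g. ace_deg g \<le> n}" for n, folded ace_low_def]
  free_alg_sum_closed[of _ _ "{g. ace_deg g \<le> n}" for n, folded ace_low_def]
  scal_in_free[of _ "{g. ace_deg g \<le> n}" for n, folded ace_low_def]
  free_alg_zero_closed[of "{g. ace_deg g \<le> n}" for n, folded ace_low_def]

section \<open>Scalar series and the degrees of coefficients\<close>

lemma scal_scal: "scal c * (scal d * f) = scal (c * d) * f"
  by (simp add: scal_mult flip: mult.assoc)

lemma scal_sum: "scal (sum f A) = (\<Sum>i\<in>A. scal (f i))"
  by (induction A rule: infinite_finite_induct) (simp_all add: scal_0 scal_add)

lemma scal_fps_mult: "scal_fps (F * G) = scal_fps F * scal_fps G"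
  by (rule fps_ext) (simp add: scal_fps_def fps_mult_nth scal_sum scal_mult)

lemma scal_fps_add: "scal_fps (F + G) = scal_fps F + scal_fps G"
  by (rule fps_ext) (simp add: scal_fps_def scal_add)

lemma scal_fps_const: "scal_fps (fps_const c) = fps_const (scal c)"
  by (rule fps_ext) (simp add: scal_fps_def scal_0)

lemma scal_fps_power: "scal_fps (F ^ n) = scal_fps F ^ n"
proof (induction n)
  case 0
  show ?case using scal_fps_const[of 1] by (simp add: scal_1)
qed (simp add: scal_fps_mult)

lemma scal_fps_commute: "scal_fps F * G = G * scal_fps F"
proof (rule fps_ext)
  fix n
  have "fps_nth (scal_fps F * G) n = (\<Sum>i=0..n. fps_nth G (n - i) * scal (fps_nth F i))"
    by (simp add: fps_mult_nth scal_fps_def scal_commute)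
  also have "\<dots> = (\<Sum>i=0..n. fps_nth G i * scal (fps_nth F (n - i)))"
    by (rule sum.reindex_bij_witness[of _ "\<lambda>i. n - i" "\<lambda>i. n - i"]) auto
  finally show "fps_nth (scal_fps F * G) n = fps_nth (G * scal_fps F) n"
    by (simp add: fps_mult_nth scal_fps_def)
qed

lemma fps_subst_nth: "fps_nth (fps_subst F f) n = (\<Sum>i=0..n. scal (fps_nth (f ^ i) n) * fps_nth F i)"
proof -
  have "fps_nth F i * fps_nth (scal_fps (f ^ i)) n = scal (fps_nth (f ^ i) n) * fps_nth F i" for i
    by (simp add: scal_fps_def scal_commute)
  then show ?thesis
    by (simp add: fps_subst_def fps_compose_nth flip: scal_fps_power)
qed

lemma fps_subst_low: "(\<And>i. fps_nth F i \<in> ace_low i) \<Longrightarrow> fps_nth (fps_subst F f) n \<in> ace_low n"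
  unfolding fps_subst_nth by (intro ace_low_closed) (auto intro: ace_low_mono)

text \<open>A scalar factor without constant term lowers the index by at least one, so coefficient
  \<open>Suc n\<close> only meets coefficients of \<open>F\<close> and \<open>G\<close> of index at
  most \<open>n\<close>. This keeps the W's of degree n+1 out of the coefficient n+1 of
  \<open>Z_series\<close>.\<close>

lemma scal_fps_mult_low:
  assumes "fps_nth f 0 = 0" "\<And>i. fps_nth F i \<in> ace_low i" "\<And>i. fps_nth G i \<in> ace_low i"
  shows "fps_nth (scal_fps f * F * G) (Suc n) \<in> ace_low n"
proof -
  have "fps_nth (F * G) i \<in> ace_low i" for i
    unfolding fps_mult_nth by (intro ace_low_closed) (auto intro: ace_low_mono assms)
  then have "scal (fps_nth f i) * fps_nth (F * G) (Suc n - i) \<in> ace_low n" for i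
  proof (cases i)
    case (Suc k)
    then show ?thesis
      using ace_low_mono[OF \<open>\<And>i. fps_nth (F * G) i \<in> ace_low i\<close>, of "n - k" n] by (simp add: ace_low_closed)
  qed (simp add: assms(1) scal_0 ace_low_closed)
  then show ?thesis
    unfolding mult.assoc fps_mult_nth[of "scal_fps f"] by (intro ace_low_closed(4)) (simp add: scal_fps_def)
qed

lemma W_series_low: "fps_nth Wm_series i \<in> ace_low i" "fps_nth Wp_series i \<in> ace_low i"
  by (simp_all add: Wm_series_def Wp_series_def ace_low_gen)

lemma G_series_low: "fps_nth (G_series q) i \<in> ace_low i" "fps_nth (Gt_series q) i \<in> ace_low i"
  by (auto simp: G_series_def Gt_series_def split: nat.split intro: ace_low_gen ace_low_closed)

section \<open>Leading terms of the coefficients of \<open>Z_series\<close>\<close>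

lemma T_ser_0: "q \<noteq> 0 \<Longrightarrow> fps_nth (T_ser q) 0 = 0"
  by (simp add: T_ser_nth)

lemma S_ser_0: "q \<noteq> 0 \<Longrightarrow> fps_nth (S_ser q) 0 = 0"
  by (simp add: S_ser_nth)

text \<open>Since \<open>f\<close> has no constant term, \<open>f ^ Suc n\<close> starts in degree
  n+1 with the coefficient \<open>fps_nth f 1 ^ Suc n\<close>; the lower powers of \<open>f\<close>
  only bring in coefficients of \<open>F\<close> of index at most \<open>n\<close>.\<close>

lemma fps_subst_top:
  assumes f: "fps_nth f 0 = 0" and F: "\<And>i. fps_nth F i \<in> ace_low i"
  shows "\<exists>L \<in> ace_low n. fps_nth (fps_subst F f) (Suc n) =
    scal (fps_nth f 1 ^ Suc n) * fps_nth F (Suc n) + L"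
proof
  have "fps_nth (f ^ Suc n) (Suc n) = fps_nth f 1 ^ Suc n"
    using f by (rule startsby_zero_power_nth_same)
  then show "fps_nth (fps_subst F f) (Suc n) = scal (fps_nth f 1 ^ Suc n) * fps_nth F (Suc n) +
    (\<Sum>i=0..n. scal (fps_nth (f ^ i) (Suc n)) * fps_nth F i)"
    unfolding fps_subst_nth sum.atLeast0_atMost_Suc by (simp add: add.commute del: power_Suc)
  show "(\<Sum>i=0..n. scal (fps_nth (f ^ i) (Suc n)) * fps_nth F i) \<in> ace_low n"
    by (intro ace_low_closed) (auto intro: ace_low_mono[OF F])
qed

text \<open>The product of the factor in front of G(S) times Gt(T), the constant term of either
  series, and the power of q + q^-1 that comes from the first coefficients of \<open>S\<close> and
  \<open>T\<close>.\<close>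

definition Z_lead :: "'k::field \<Rightarrow> nat \<Rightarrow> 'k" where
  "Z_lead q n = inverse ((q\<^sup>2 - inverse q ^ 2)\<^sup>2) * G0 q * (q + inverse q) ^ n"

text \<open>Degree n+1 is reached only in the two extreme terms of the Cauchy product of G(S) and
  Gt(T), where the other factor is the scalar \<open>G0 q\<close>. As \<open>S\<close> and
  \<open>T\<close> start with (q + q^-1) q^-1 t and (q + q^-1) q t, these terms carry opposite
  powers of q.\<close>

lemma Z_series_top:
  fixes q :: "'k::field"
  assumes q: "q \<noteq> 0"
  shows "\<exists>L \<in> ace_low n. fps_nth (Z_series q) (Suc n) =
    scal (Z_lead q (Suc n)) * (scal (inverse q ^ Suc n) * Gp n + scal (q ^ Suc n) * Gt n) + L"
proof -
  let ?S = "S_ser q" and ?T = "T_ser q" and ?k = "inverse ((q\<^sup>2 - inverse q ^ 2)\<^sup>2)"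
  let ?r = "q + inverse q"
  note low = fps_subst_low[OF W_series_low(1)] fps_subst_low[OF W_series_low(2)]
  have S0: "fps_nth ?S 0 = 0" "fps_nth ?T 0 = 0" using q by (simp_all add: T_ser_0 S_ser_0)
  have S1: "fps_nth ?S 1 = ?r * inverse q" "fps_nth ?T 1 = ?r * q"
    using q by (simp_all add: S_ser_nth T_ser_nth)
  let ?G = "fps_subst (G_series q) ?S" and ?Gt = "fps_subst (Gt_series q) ?T"
  obtain L1 where L1: "L1 \<in> ace_low n" "fps_nth ?G (Suc n) = scal ((?r * inverse q) ^ Suc n) * Gp n + L1"
    using fps_subst_top[OF S0(1) G_series_low(1), where n=n] unfolding S1 by (auto simp: G_series_def)
  obtain L2 where L2: "L2 \<in> ace_low n" "fps_nth ?Gt (Suc n) = scal ((?r * q) ^ Suc n) * Gt n + L2"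
    using fps_subst_top[OF S0(2) G_series_low(2), where n=n] unfolding S1 by (auto simp: Gt_series_def)
  have G0: "fps_nth ?G 0 = scal (G0 q)" "fps_nth ?Gt 0 = scal (G0 q)"
    by (simp_all add: fps_subst_nth G_series_def Gt_series_def scal_1)
  \<comment> \<open>The inner terms of the Cauchy product: both indices lie between 1 and n.\<close>
  define M where "M = (\<Sum>i=1..n. fps_nth ?G i * fps_nth ?Gt (Suc n - i))"
  have M: "M \<in> ace_low n" unfolding M_def
    by (intro ace_low_closed) (auto intro: ace_low_mono[OF fps_subst_low[OF G_series_low(1)]]
        ace_low_mono[OF fps_subst_low[OF G_series_low(2)]])
  have GG: "fps_nth (?G * ?Gt) (Suc n) = scal (G0 q) * fps_nth ?Gt (Suc n) + M + scal (G0 q) * fps_nth ?G (Suc n)"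
    unfolding fps_mult_nth M_def by (simp add: sum.atLeast_Suc_atMost G0 scal_commute add.assoc)
  \<comment> \<open>The four products of W series. Their scalar factors have no constant term; for
    the shifted one this holds because S T starts in degree 2.\<close>
  define L where "L = fps_nth (scal_fps (fps_shift 1 (?S * ?T)) * fps_subst Wm_series ?S * fps_subst Wp_series ?T) (Suc n)
    + fps_nth (scal_fps (fps_X * ?S * ?T) * fps_subst Wp_series ?S * fps_subst Wm_series ?T) (Suc n)
    - fps_nth (scal_fps (fps_const (q\<^sup>2) * ?S * ?T) * fps_subst Wm_series ?S * fps_subst Wm_series ?T) (Suc n)
    - fps_nth (scal_fps (fps_const (inverse q ^ 2) * ?S * ?T) * fps_subst Wp_series ?S * fps_subst Wp_series ?T) (Suc n)"
  have L: "L \<in> ace_low n"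
    unfolding L_def
    by (intro ace_low_closed scal_fps_mult_low low) (auto simp: S0 fps_mult_nth)
  have "fps_nth (Z_series q) (Suc n) = L + scal ?k * fps_nth (?G * ?Gt) (Suc n)"
    unfolding Z_series_def L_def by (simp add: Let_def scal_fps_const mult.assoc)
  also have "\<dots> = scal (Z_lead q (Suc n)) * (scal (inverse q ^ Suc n) * Gp n + scal (q ^ Suc n) * Gt n)
      + (L + scal ?k * (scal (G0 q) * L2 + M + scal (G0 q) * L1))"
    unfolding GG L1(2) L2(2) Z_lead_def power_mult_distrib
    by (simp add: distrib_left scal_scal ac_simps del: power_Suc)
  finally show ?thesis
    by (rule bexI) (intro ace_low_closed L L1 L2 M)
qed

text \<open>The part of the relations that, together with the \<open>\<Z>\<^sub>n\<close>, determines the homomorphism.\<close>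

locale ace_hom = free_hom B H for B :: "('k::field, 'b) module" (structure)
  and H :: "(ace_gen, 'k) ncpoly \<Rightarrow> 'b" +
  fixes q :: 'k
  assumes rel_W: "H (comm (Wm k) (Wp 0)) = H (scal (inverse (q + inverse q)) * (Gt k - Gp k))"
    and rel_Wm: "H (qcomm q (Wm 0) (Gp k)) = H (scal (rho q) * Wm (k + 1) - scal (rho q) * Wp k)"
    and rel_Wp: "H (qcomm q (Gp k) (Wp 0)) = H (scal (rho q) * Wp (k + 1) - scal (rho q) * Wm k)"

lemma free_hom_eq_on_low:
  assumes "free_hom B H" "free_hom B H'"
    and "\<And>g. ace_deg g \<le> n \<Longrightarrow> H (gen g) = H' (gen g)" and "f \<in> ace_low n"
  shows "H f = H' f"
  by (rule free_hom_eqI[OF assms(1,2), of "{g. ace_deg g \<le> n}"]) (use assms(3,4) in \<open>auto simp: ace_low_def\<close>)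

section \<open>The relations solved for one generator each\<close>

context ace_hom begin

lemma hom_Gt:
  assumes r: "q + inverse q \<noteq> 0"
  shows "H (Gt k) = H (Gp k + scal (q + inverse q) * comm (Wm k) (Wp 0))"
proof -
  have "H (Gt k) = H (Gp k + scal (q + inverse q) * (scal (inverse (q + inverse q)) * (Gt k - Gp k)))"
    using r by (simp add: scal_scal scal_1)
  also have "\<dots> = H (Gp k + scal (q + inverse q) * comm (Wm k) (Wp 0))"
    by (simp only: hom_add hom_smult rel_W)
  finally show ?thesis .
qed

lemma hom_Wm:
  assumes "rho q \<noteq> 0"
  shows "H (Wm (Suc k)) = H (Wp k + scal (inverse (rho q)) * qcomm q (Wm 0) (Gp k))"
proof -
  have "H (Wm (Suc k)) = H (Wp k + scal (inverse (rho q)) * (scal (rho q) * Wm (k + 1) - scal (rho q) * Wp k))"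
    using assms by (simp add: right_diff_distrib scal_scal scal_1)
  also have "\<dots> = H (Wp k + scal (inverse (rho q)) * qcomm q (Wm 0) (Gp k))"
    by (simp only: hom_add hom_smult rel_Wm)
  finally show ?thesis .
qed

lemma hom_Wp:
  assumes "rho q \<noteq> 0"
  shows "H (Wp (Suc k)) = H (Wm k + scal (inverse (rho q)) * qcomm q (Gp k) (Wp 0))"
proof -
  have "H (Wp (Suc k)) = H (Wm k + scal (inverse (rho q)) * (scal (rho q) * Wp (k + 1) - scal (rho q) * Wm k))"
    using assms by (simp add: right_diff_distrib scal_scal scal_1)
  also have "\<dots> = H (Wm k + scal (inverse (rho q)) * qcomm q (Gp k) (Wp 0))"
    by (simp only: hom_add hom_smult rel_Wp)
  finally show ?thesis .
qed


end

text \<open>Replacing \<open>Gt n\<close> by \<open>Gp n\<close> plus a commutator of lower degree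
  merges the two leading terms into one. The same \<open>L\<close> serves every \<open>H\<close>
  with values in \<open>B\<close>, so that two homomorphisms can be compared.\<close>

lemma ace_hom_Z_top:
  fixes q :: "'k::field" and B :: "('k, 'b) module"
  assumes q: "q \<noteq> 0" and r: "q + inverse q \<noteq> 0"
  obtains L where "L \<in> ace_low n"
    "\<forall>H. ace_hom B H q \<longrightarrow> H (fps_nth (Z_series q) (Suc n)) =
      H (scal (Z_lead q (Suc n) * (inverse q ^ Suc n + q ^ Suc n)) * Gp n + L)"
proof -
  obtain L where L: "L \<in> ace_low n" and Z: "fps_nth (Z_series q) (Suc n) =
    scal (Z_lead q (Suc n)) * (scal (inverse q ^ Suc n) * Gp n + scal (q ^ Suc n) * Gt n) + L"
    using Z_series_top[OF q] by blast
  \<comment> \<open>What the replacement of \<open>Gt n\<close> adds; it has degree at most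
    \<open>n\<close>, as only \<open>Wm n\<close> and \<open>Wp 0\<close> occur.\<close>
  define C where "C = scal (q ^ Suc n) * scal (q + inverse q) * comm (Wm n) (Wp 0)"
  have eq: "\<forall>H. ace_hom B H q \<longrightarrow> H (fps_nth (Z_series q) (Suc n)) =
      H (scal (Z_lead q (Suc n) * (inverse q ^ Suc n + q ^ Suc n)) * Gp n + (scal (Z_lead q (Suc n)) * C + L))"
  proof (intro allI impI)
    fix H assume "ace_hom B H q"
    then interpret ace_hom B H q .
    have "H (fps_nth (Z_series q) (Suc n)) = H (scal (Z_lead q (Suc n)) * (scal (inverse q ^ Suc n) * Gp n
        + scal (q ^ Suc n) * (Gp n + scal (q + inverse q) * comm (Wm n) (Wp 0))) + L)"
      unfolding Z by (simp only: hom_add[of _ L] hom_add[of "scal (inverse q ^ Suc n) * Gp n"] hom_smult hom_Gt[OF r])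
    also have "scal (Z_lead q (Suc n)) * (scal (inverse q ^ Suc n) * Gp n
        + scal (q ^ Suc n) * (Gp n + scal (q + inverse q) * comm (Wm n) (Wp 0))) + L =
      scal (Z_lead q (Suc n) * (inverse q ^ Suc n + q ^ Suc n)) * Gp n + (scal (Z_lead q (Suc n)) * C + L)"
      by (simp add: C_def distrib_left distrib_right scal_add scal_scal scal_mult ac_simps del: power_Suc)
    finally show "H (fps_nth (Z_series q) (Suc n)) =
      H (scal (Z_lead q (Suc n) * (inverse q ^ Suc n + q ^ Suc n)) * Gp n + (scal (Z_lead q (Suc n)) * C + L))" .
  qed
  have low: "scal (Z_lead q (Suc n)) * C + L \<in> ace_low n"
    unfolding C_def comm_def by (intro ace_low_closed L ace_low_gen) auto
  show thesis by (rule that[OF low eq])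
qed

section \<open>Nonvanishing of the constants\<close>

lemma rho_nonzero: "q \<noteq> 0 \<Longrightarrow> q ^ 4 \<noteq> 1 \<Longrightarrow> rho q \<noteq> (0::'k::field)"
proof
  assume q: "q \<noteq> 0" "q ^ 4 \<noteq> 1" and "rho q = 0"
  then have "q ^ 2 = inverse q ^ 2" by (simp add: rho_def)
  moreover have "q ^ 2 * inverse q ^ 2 = 1" using q by (simp flip: power_mult_distrib)
  ultimately have "q ^ 2 * q ^ 2 = 1" by simp
  then show False using q by (simp add: power4_eq_xxxx power2_eq_square mult.assoc)
qed

lemma q_plus_nonzero: "q \<noteq> 0 \<Longrightarrow> q ^ 4 \<noteq> 1 \<Longrightarrow> q + inverse q \<noteq> (0::'k::field)"
proof
  assume "q \<noteq> 0" "q ^ 4 \<noteq> 1" "q + inverse q = 0"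
  then have "q * q = - 1" by (simp add: field_simps eq_neg_iff_add_eq_0)
  then have "q ^ 4 = 1" by (simp add: power4_eq_xxxx mult.assoc)
  then show False using \<open>q ^ 4 \<noteq> 1\<close> by simp
qed

lemma q_minus_nonzero: "q \<noteq> 0 \<Longrightarrow> q ^ 4 \<noteq> 1 \<Longrightarrow> q - inverse q \<noteq> (0::'k::field)"
proof
  assume "q \<noteq> 0" "q ^ 4 \<noteq> 1" "q - inverse q = 0"
  then have "q * q = 1" by (simp add: field_simps)
  then have "q ^ 4 = 1" by (simp add: power4_eq_xxxx mult.assoc)
  then show False using \<open>q ^ 4 \<noteq> 1\<close> by simp
qed

lemma Z_lead_nonzero:
  assumes "q \<noteq> 0" "q ^ 4 \<noteq> (1::'k::field)"
  shows "Z_lead q n \<noteq> 0"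
  using q_plus_nonzero[OF assms] q_minus_nonzero[OF assms] rho_nonzero[OF assms]
  by (simp add: Z_lead_def G0_def rho_def)

text \<open>Here the coefficient of \<open>Gp n\<close> is zero, so the value of the central element
  is already fixed by the generators of degree at most \<open>n\<close>.\<close>

lemma ace_hom_Z_eq:
  fixes q :: "'k::field"
  assumes q: "q \<noteq> 0" "q ^ 4 \<noteq> 1" and "ace_hom B H q" "ace_hom B H' q"
    and low: "\<And>g. ace_deg g \<le> n \<Longrightarrow> H (gen g) = H' (gen g)"
    and "inverse q ^ Suc n + q ^ Suc n = 0"
  shows "H (fps_nth (Z_series q) (Suc n)) = H' (fps_nth (Z_series q) (Suc n))"
proof -
  interpret H: ace_hom B H q by fact
  interpret H': ace_hom B H' q by fact
  note fh = H.free_hom_axioms H'.free_hom_axioms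
  obtain L where L: "L \<in> ace_low n" and
    LZ: "\<forall>H. ace_hom B H q \<longrightarrow> H (fps_nth (Z_series q) (Suc n)) =
      H (scal (Z_lead q (Suc n) * (inverse q ^ Suc n + q ^ Suc n)) * Gp n + L)"
    by (rule ace_hom_Z_top[OF q(1) q_plus_nonzero[OF q], of n B])
  show ?thesis
    using free_hom_eq_on_low[OF fh low L] by (simp only: assms(6) LZ[rule_format, OF assms(3)] LZ[rule_format, OF assms(4)] mult_zero_right
        scal_0 mult_zero_left add_0_left)
qed

text \<open>The central element gives \<open>Gp n\<close> after division by \<open>l\<close>; from
  it the solved relations give first \<open>Gt n\<close> and then the W's of degree n+1.\<close>

lemma ace_hom_step:
  fixes q :: "'k::field"
  assumes q: "q \<noteq> 0" "q ^ 4 \<noteq> 1" and "ace_hom B H q" "ace_hom B H' q"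
    and low: "\<And>g. ace_deg g \<le> n \<Longrightarrow> H (gen g) = H' (gen g)"
    and nz: "inverse q ^ Suc n + q ^ Suc n \<noteq> 0"
    and Z: "H (fps_nth (Z_series q) (Suc n)) = H' (fps_nth (Z_series q) (Suc n))"
    and g: "ace_deg g \<le> Suc n"
  shows "H (gen g) = H' (gen g)"
proof -
  interpret H: ace_hom B H q by fact
  interpret H': ace_hom B H' q by fact
  note fh = H.free_hom_axioms H'.free_hom_axioms
  note r = q_plus_nonzero[OF q] and rho = rho_nonzero[OF q]
  define l where "l = Z_lead q (Suc n) * (inverse q ^ Suc n + q ^ Suc n)"
  have l: "l \<noteq> 0" using nz Z_lead_nonzero[OF q] by (simp add: l_def)
  obtain L where L: "L \<in> ace_low n" and
    LZ: "\<forall>H. ace_hom B H q \<longrightarrow> H (fps_nth (Z_series q) (Suc n)) = H (scal l * Gp n + L)"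
    unfolding l_def by (rule ace_hom_Z_top[OF q(1) r, of n B])
  have Gp_eq: "K (Gp n) = K (scal (inverse l) * (fps_nth (Z_series q) (Suc n) - L))"
    if "ace_hom B K q" for K
  proof -
    interpret ace_hom B K q by fact
    have "K (scal (inverse l) * (fps_nth (Z_series q) (Suc n) - L)) = K (scal (inverse l) * (scal l * Gp n + L - L))"
      by (simp only: hom_smult hom_diff LZ[rule_format, OF that])
    then show ?thesis using l by (simp add: scal_scal scal_1)
  qed
  have G: "H (Gp n) = H' (Gp n)"
    unfolding Gp_eq[OF assms(3)] Gp_eq[OF assms(4)] using free_hom_eq_on_low[OF fh low L] Z
    by (simp add: H.hom_smult H'.hom_smult H.hom_diff H'.hom_diff)
  have W: "H (Wm n) = H' (Wm n)" "H (Wp n) = H' (Wp n)" "H (Wm 0) = H' (Wm 0)" "H (Wp 0) = H' (Wp 0)"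
    using low by auto
  have "H (Gt n) = H' (Gt n)" "H (Wm (Suc n)) = H' (Wm (Suc n))" "H (Wp (Suc n)) = H' (Wp (Suc n))"
    unfolding H.hom_Gt[OF r] H'.hom_Gt[OF r] H.hom_Wm[OF rho] H'.hom_Wm[OF rho] H.hom_Wp[OF rho] H'.hom_Wp[OF rho]
    by (simp_all add: comm_def H.hom_add H.hom_scal H'.hom_add H'.hom_scal H.hom_qcomm H'.hom_qcomm
        H.hom_diff H'.hom_diff H.hom_mult H'.hom_mult G W)
  \<comment> \<open>In degree exactly n+1 there are only \<open>Wm (Suc n)\<close>,
    \<open>Wp (Suc n)\<close>, \<open>Gp n\<close> and \<open>Gt n\<close>.\<close>
  then show ?thesis
    using G low[of g] g by (cases g) (auto simp: le_Suc_eq)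
qed

text \<open>Induction over the degree, starting from \<open>Wm 0\<close> and \<open>Wp 0\<close>,
  the only generators of degree 0. The conditions concern indices below \<open>n\<close> only, so
  the lemma applies up to the first exceptional index.\<close>

lemma ace_hom_eq:
  fixes q :: "'k::field"
  assumes q: "q \<noteq> 0" "q ^ 4 \<noteq> 1" and H: "ace_hom B H q" "ace_hom B H' q"
    and W: "H (Wm 0) = H' (Wm 0)" "H (Wp 0) = H' (Wp 0)"
    and nz: "\<And>i. i < n \<Longrightarrow> inverse q ^ Suc i + q ^ Suc i \<noteq> 0"
    and Z: "\<And>i. i < n \<Longrightarrow> H (fps_nth (Z_series q) (Suc i)) = H' (fps_nth (Z_series q) (Suc i))"
    and g: "ace_deg g \<le> n"
  shows "H (gen g) = H' (gen g)"
  using nz Z g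
proof (induction n arbitrary: g)
  case 0
  then show ?case using W by (cases g) auto
next
  case (Suc n)
  show ?case
    by (rule ace_hom_step[OF q H Suc.IH, of n]) (use Suc.prems in auto)
qed

section \<open>The generating function of the central binomial coefficients\<close>

text \<open>The coefficients of (1 - 4 t^2 / r^2)^(-1/2), with zeros at the odd indices so that both
  parities of the claim share one formula.\<close>

definition alt_coeff :: "'k::field \<Rightarrow> nat \<Rightarrow> 'k" where
  "alt_coeff r n = (if even n then of_nat (n choose (n div 2)) * inverse r ^ n else 0)"

lemma alt_coeff_0: "alt_coeff r 0 = 1"
  by (simp add: alt_coeff_def)

lemma alt_coeff_odd: "alt_coeff r (2 * j + 1) = 0"
  by (simp add: alt_coeff_def)

definition alt_series :: "'k::field \<Rightarrow> 'k fps" where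
  "alt_series r = Abs_fps (alt_coeff r)"

text \<open>The absorption identity is used twice, with the symmetry of row 2j+1 of the binomial
  coefficients in between.\<close>

lemma central_binomial_Suc: "Suc j * (2 * Suc j choose Suc j) = 2 * (2 * j + 1) * (2 * j choose j)"
proof -
  have "Suc j * (2 * Suc j choose Suc j) = 2 * Suc j * (2 * j + 1 choose j)"
    using Suc_times_binomial_eq[of "2 * j + 1" j] by simp
  also have "\<dots> = 2 * (Suc j * (Suc (2 * j) choose j))" by simp
  also have "Suc j * (Suc (2 * j) choose j) = (2 * j + 1) * (2 * j choose j)"
    using Suc_times_binomial_eq[of "2 * j" j] binomial_symmetric[of j "2 * j + 1"]
    by (simp add: mult.commute)
  finally show ?thesis by simp
qed

lemma alt_coeff_rec:
  assumes "(r::'k::field_char_0) \<noteq> 0"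
  shows "of_nat (n + 2) * alt_coeff r (n + 2) = 4 * inverse r ^ 2 * of_nat (n + 1) * alt_coeff r n"
proof (cases "even n")
  case True
  then obtain j where j: "n = 2 * j" by (elim evenE)
  define A C where "A = (2 * Suc j choose Suc j)" and "C = (2 * j choose j)"
  have "(n + 2) * A = 4 * (n + 1) * C"
    using central_binomial_Suc[of j, folded A_def C_def] by (simp add: j algebra_simps)
  then have eq: "of_nat (n + 2) * of_nat A = (4 * of_nat (n + 1) * of_nat C :: 'k)"
    by (metis of_nat_mult of_nat_numeral)
  have "alt_coeff r (n + 2) = of_nat A * inverse r ^ (n + 2)" "alt_coeff r n = of_nat C * inverse r ^ n"
    by (simp_all add: alt_coeff_def j A_def C_def)
  then have "of_nat (n + 2) * alt_coeff r (n + 2) = of_nat (n + 2) * of_nat A * (inverse r ^ 2 * inverse r ^ n)"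
    by (simp add: power2_eq_square mult_ac)
  then show ?thesis
    unfolding eq \<open>alt_coeff r n = _\<close> by (simp only: mult_ac)
qed (simp add: alt_coeff_def)

text \<open>With c = 4 / r^2 and w = 1 - c t^2, the recursion for the coefficients says f' w = c t
  f. Hence the derivative of f^2 w is zero, and in characteristic 0 this series equals its constant
  term 1.\<close>

lemma alt_series_square:
  assumes r: "(r::'k::field_char_0) \<noteq> 0"
  shows "alt_series r ^ 2 * (1 - fps_const (4 * inverse r ^ 2) * fps_X ^ 2) = 1"
proof -
  let ?f = "alt_series r" and ?c = "fps_const (4 * inverse r ^ 2) :: 'k fps"
  let ?w = "1 - ?c * fps_X ^ 2"
  have ode: "fps_deriv ?f * ?w = ?c * fps_X * ?f"
  proof (rule fps_ext)
    fix n
    have "fps_nth (fps_deriv ?f * ?w) n = fps_nth (fps_deriv ?f - ?c * (fps_X ^ 2 * fps_deriv ?f)) n"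
      by (simp add: algebra_simps)
    also have "\<dots> = fps_nth (?c * (fps_X * ?f)) n"
    proof (cases n)
      case 0
      then show ?thesis by (simp add: alt_series_def alt_coeff_def fps_X_power_mult_nth)
    next
      case (Suc m)
      have "of_nat (m + 2) * alt_coeff r (m + 2) = 4 * inverse r ^ 2 * of_nat (m + 1) * alt_coeff r m"
        by (rule alt_coeff_rec[OF r])
      then have "of_nat (m + 2) * alt_coeff r (m + 2) - 4 * inverse r ^ 2 * (of_nat m * alt_coeff r m)
          = 4 * inverse r ^ 2 * alt_coeff r m"
        by (simp add: algebra_simps)
      then show ?thesis
        using Suc by (cases m) (simp_all add: alt_series_def fps_X_power_mult_nth)
    qed
    finally show "fps_nth (fps_deriv ?f * ?w) n = fps_nth (?c * fps_X * ?f) n"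
      by (simp add: mult.assoc)
  qed
  have dw: "fps_deriv ?w = - (2 * ?c * fps_X)"
    by (simp add: fps_deriv_power' power2_eq_square mult_ac)
  have "fps_deriv (?f ^ 2 * ?w) = 2 * ?f * (fps_deriv ?f * ?w) + ?f ^ 2 * fps_deriv ?w"
    by (simp add: power2_eq_square algebra_simps)
  also have "\<dots> = 0" unfolding ode dw by (simp add: power2_eq_square algebra_simps)
  finally have "?f ^ 2 * ?w = fps_const (fps_nth (?f ^ 2 * ?w) 0)"
    by (simp only: fps_deriv_eq_0_iff)
  also have "fps_nth (?f ^ 2 * ?w) 0 = 1"
    by (simp add: alt_series_def alt_coeff_def power2_eq_square fps_mult_nth_0)
  finally show ?thesis by simp
qed

section \<open>Substituting \<open>S\<close> and \<open>T\<close> into the generating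
  function\<close>

lemma T_ser_eq:
  assumes "q \<noteq> (0::'k::field)"
  shows "T_ser q * (fps_const q * fps_X\<^sup>2 + fps_const (inverse q)) = fps_const (q + inverse q) * fps_X"
proof -
  let ?D = "fps_const q * fps_X\<^sup>2 + fps_const (inverse q)"
  have "?D * inverse ?D = 1" by (rule inverse_mult_eq_1') (use assms in simp)
  moreover have "T_ser q = fps_const (q + inverse q) * fps_X * inverse ?D"
    unfolding T_ser_def by (rule fps_divide_unit) (use assms in simp)
  ultimately show ?thesis by (simp only: mult.assoc mult.commute[of _ "?D"] mult.right_neutral)
      (simp add: mult_ac)
qed

lemma S_ser_mult_eq:
  assumes "q \<noteq> (0::'k::field)"
  shows "S_ser q * (fps_const q + fps_const (inverse q) * fps_X\<^sup>2) = fps_const (q + inverse q) * fps_X"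
  using T_ser_eq[of "inverse q"] assms by (simp add: S_ser_eq add.commute)

text \<open>The substitution turns \<open>1 - 4t\<^sup>2/(q + q\<^sup>-\<^sup>1)\<^sup>2\<close> into the square of a rational function.\<close>

lemma alt_series_T:
  fixes q :: "'k::field_char_0"
  assumes q: "q \<noteq> 0" and r: "q + inverse q \<noteq> 0"
  shows "(alt_series (q + inverse q) oo T_ser q) * (fps_const (inverse q) - fps_const q * fps_X\<^sup>2) =
    fps_const (inverse q) + fps_const q * fps_X\<^sup>2"
proof -
  let ?r = "q + inverse q" and ?T = "T_ser q"
  define F where "F = alt_series ?r oo ?T"
  define D where "D = fps_const q * fps_X\<^sup>2 + fps_const (inverse q)"
  define E where "E = fps_const (inverse q) - fps_const q * fps_X\<^sup>2"
  have T0: "fps_nth ?T 0 = 0" by (rule T_ser_0[OF q])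
  have TD: "?T * D = fps_const ?r * fps_X" unfolding D_def by (rule T_ser_eq[OF q])
  have "(alt_series ?r ^ 2 * (1 - fps_const (4 * inverse ?r ^ 2) * fps_X ^ 2)) oo ?T = 1"
    unfolding alt_series_square[OF r] by simp
  then have F2: "F ^ 2 * (1 - fps_const (4 * inverse ?r ^ 2) * ?T ^ 2) = 1"
    by (simp add: F_def fps_compose_mult_distrib[OF T0] fps_compose_sub_distrib fps_compose_power[OF T0, symmetric] T0)
  have "(1 - fps_const (4 * inverse ?r ^ 2) * ?T ^ 2) * D ^ 2 = D ^ 2 - fps_const (4 * inverse ?r ^ 2) * (?T * D) ^ 2"
    by (simp add: power_mult_distrib algebra_simps)
  also have "fps_const (4 * inverse ?r ^ 2) * (?T * D) ^ 2 = fps_const (4 * inverse ?r ^ 2 * ?r ^ 2) * fps_X ^ 2"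
    unfolding TD by (simp add: power_mult_distrib fps_const_power mult_ac flip: fps_const_mult)
  also have "4 * inverse ?r ^ 2 * ?r ^ 2 = 4"
    using r by (simp add: mult.assoc flip: power_mult_distrib)
  \<comment> \<open>D and E are the sum and the difference of q^-1 and q t^2, so their squares
    differ by four times the product, which is 4 t^2.\<close>
  also have "D ^ 2 - fps_const 4 * fps_X ^ 2 = E ^ 2 + 4 * (fps_const q * fps_const (inverse q) - 1) * fps_X ^ 2"
    by (simp add: D_def E_def power2_eq_square algebra_simps flip: fps_const_mult numeral_fps_const)
  finally have DE: "(1 - fps_const (4 * inverse ?r ^ 2) * ?T ^ 2) * D ^ 2 = E ^ 2" using q by simp
  have "(F * E) ^ 2 = F ^ 2 * ((1 - fps_const (4 * inverse ?r ^ 2) * ?T ^ 2) * D ^ 2)"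
    unfolding DE by (simp add: power_mult_distrib)
  also have "\<dots> = D ^ 2" by (simp add: F2 flip: mult.assoc)
  \<comment> \<open>The square leaves the sign open; it is decided by the constant terms of
    \<open>F * E\<close> and \<open>D\<close>, both q^-1.\<close>
  finally have "F * E = D \<or> F * E = - D" by (simp add: power2_eq_iff)
  moreover have "F * E \<noteq> - D"
  proof
    assume "F * E = - D"
    then have "fps_nth (F * E) 0 = fps_nth (- D) 0" by simp
    then have "inverse q = - inverse q"
      by (simp add: F_def E_def D_def alt_series_def alt_coeff_def)
    then show False using q by simp
  qed
  ultimately show ?thesis by (simp add: F_def D_def E_def add.commute)
qed

text \<open>Exchanging q and q^-1 preserves q + q^-1 and turns \<open>T\<close> into
  \<open>S\<close>.\<close>

lemma alt_series_S:
  fixes q :: "'k::field_char_0"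
  assumes q: "q \<noteq> 0" and r: "q + inverse q \<noteq> 0"
  shows "(alt_series (q + inverse q) oo S_ser q) * (fps_const q - fps_const (inverse q) * fps_X\<^sup>2) =
    fps_const q + fps_const (inverse q) * fps_X\<^sup>2"
  using alt_series_T[of "inverse q"] assms by (simp add: S_ser_eq add.commute)

text \<open>This will be the coefficient of 1 in the series of the central elements. All four
  factors are rational in t, so the identity is checked after multiplication by the denominators
  \<open>?D\<close> of S T and \<open>?E\<close> of F G.\<close>

lemma alt_series_ST:
  fixes q :: "'k::field_char_0"
  assumes q: "q \<noteq> 0" and r: "q + inverse q \<noteq> 0"
  shows "(alt_series (q + inverse q) oo S_ser q) * (alt_series (q + inverse q) oo T_ser q) *
    (fps_const ((q + inverse q)\<^sup>2) - fps_const (2 * (q\<^sup>2 + inverse q ^ 2)) * (S_ser q * T_ser q)) =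
    fps_const ((q + inverse q)\<^sup>2)"
proof -
  let ?r = "q + inverse q"
  define F G S T where "F = alt_series ?r oo S_ser q" and "G = alt_series ?r oo T_ser q"
    and "S = S_ser q" and "T = T_ser q"
  define a b X R c where "a = fps_const q" and "b = fps_const (inverse q)" and "X = (fps_X :: 'k fps) ^ 2"
    and "R = fps_const (?r\<^sup>2)" and "c = fps_const (2 * (q\<^sup>2 + inverse q ^ 2))"
  have ab: "a * b = 1" using q by (simp add: a_def b_def)
  have c: "c = 2 * (a ^ 2 + b ^ 2)"
    by (simp add: c_def a_def b_def fps_const_power numeral_fps_const)
  have S: "S * (a + b * X) = fps_const ?r * fps_X" and T: "T * (a * X + b) = fps_const ?r * fps_X"
    using S_ser_mult_eq[OF q] T_ser_eq[OF q] by (simp_all add: S_def T_def a_def b_def X_def)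
  have F: "F * (a - b * X) = a + b * X" and G: "G * (b - a * X) = b + a * X"
    using alt_series_S[OF assms] alt_series_T[OF assms] by (simp_all add: F_def G_def a_def b_def X_def)
  have ST: "S * T * ((a + b * X) * (a * X + b)) = R * X"
    using arg_cong2[OF S T, of "(*)"] by (simp add: R_def X_def power2_eq_square mult_ac flip: fps_const_mult)
  have nz: "a + b * X \<noteq> 0" "a * X + b \<noteq> 0" "a - b * X \<noteq> 0" "b - a * X \<noteq> 0"
  proof -
    have "fps_nth (a + b * X) 0 = q" "fps_nth (a * X + b) 0 = inverse q"
      "fps_nth (a - b * X) 0 = q" "fps_nth (b - a * X) 0 = inverse q"
      by (simp_all add: a_def b_def X_def)
    then show "a + b * X \<noteq> 0" "a * X + b \<noteq> 0" "a - b * X \<noteq> 0" "b - a * X \<noteq> 0"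
      using q by (auto simp del: fps_add_nth fps_sub_nth fps_mult_nth_0)
  qed
  let ?D = "(a + b * X) * (a * X + b)" and ?E = "(a - b * X) * (b - a * X)"
  have "F * G * (R - c * (S * T)) * (?D * ?E) = (F * (a - b * X)) * (G * (b - a * X)) * (R * ?D - c * (S * T * ?D))"
    by (simp add: algebra_simps)
  also have "\<dots> = ?D * R * (?D - c * X)" unfolding F G ST by (simp add: algebra_simps)
  \<comment> \<open>The constant \<open>c\<close> is chosen for this: \<open>?D\<close> and
    \<open>?E\<close> differ only in the sign of their middle term (a^2 + b^2) X.\<close>
  also have "?D - c * X = ?E"
    unfolding c by (simp add: algebra_simps power2_eq_square)
  finally have "F * G * (R - c * (S * T)) * (?D * ?E) = R * (?D * ?E)" by (simp add: mult_ac)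
  then show ?thesis using nz by (simp add: F_def G_def S_def T_def R_def c_def)
qed

text \<open>Multiplied by t, the left-hand side of the first equation is S T (1 + q^2 t^2), and 1 +
  q^2 t^2 is q times the denominator of \<open>T\<close>; the second equation uses the denominator
  of \<open>S\<close>. They will cancel the coefficients of \<open>V\<close> and \<open>U\<close> in
  the series of the central elements.\<close>

lemma ST_cross:
  fixes q :: "'k::field"
  assumes q: "q \<noteq> 0"
  shows "fps_shift 1 (S_ser q * T_ser q) + fps_const (q\<^sup>2) * (fps_X * S_ser q * T_ser q) =
      fps_const ((q + inverse q) * q) * S_ser q"
    and "fps_shift 1 (S_ser q * T_ser q) + fps_const (inverse q ^ 2) * (fps_X * S_ser q * T_ser q) =
      fps_const ((q + inverse q) * inverse q) * T_ser q"
proof -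
  define S T where "S = S_ser q" and "T = T_ser q"
  define a b R where "a = fps_const q" and "b = fps_const (inverse q)" and "R = fps_const (q + inverse q)"
  have ab: "a * b = 1" using q by (simp add: a_def b_def)
  have S: "S * (a + b * fps_X ^ 2) = R * fps_X" and T: "T * (a * fps_X ^ 2 + b) = R * fps_X"
    using S_ser_mult_eq[OF q] T_ser_eq[OF q] by (simp_all add: S_def T_def a_def b_def R_def)
  have X: "fps_X * fps_shift 1 (S * T) = S * T"
    by (rule fps_ext) (auto simp: S_def T_def fps_mult_nth_0 S_ser_0[OF q])
  have "fps_X * (fps_shift 1 (S * T) + a ^ 2 * (fps_X * S * T)) = fps_X * (R * a * S)"
  proof -
    have "S * T + fps_X * (a ^ 2 * (fps_X * S * T)) = S * T * (a * b) + fps_X * (a ^ 2 * (fps_X * S * T))"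
      unfolding ab by simp
    also have "\<dots> = S * a * (T * (a * fps_X ^ 2 + b))" by (simp add: algebra_simps power2_eq_square)
    also have "\<dots> = fps_X * (R * a * S)" unfolding T by (simp add: mult_ac)
    finally show ?thesis unfolding distrib_left X .
  qed
  then show "fps_shift 1 (S_ser q * T_ser q) + fps_const (q\<^sup>2) * (fps_X * S_ser q * T_ser q) =
      fps_const ((q + inverse q) * q) * S_ser q"
    by (simp add: S_def T_def a_def R_def fps_const_power)
  have "fps_X * (fps_shift 1 (S * T) + b ^ 2 * (fps_X * S * T)) = fps_X * (R * b * T)"
  proof -
    have "S * T + fps_X * (b ^ 2 * (fps_X * S * T)) = S * T * (a * b) + fps_X * (b ^ 2 * (fps_X * S * T))"
      unfolding ab by simp
    also have "\<dots> = T * b * (S * (a + b * fps_X ^ 2))" by (simp add: algebra_simps power2_eq_square)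
    also have "\<dots> = fps_X * (R * b * T)" unfolding S by (simp add: mult_ac)
    finally show ?thesis unfolding distrib_left X .
  qed
  then show "fps_shift 1 (S_ser q * T_ser q) + fps_const (inverse q ^ 2) * (fps_X * S_ser q * T_ser q) =
      fps_const ((q + inverse q) * inverse q) * T_ser q"
    by (simp add: S_def T_def b_def R_def fps_const_power)
qed

section \<open>The alternating elements of the quantum torus\<close>

lemma (in k_algebra) scale_zero_right: "c \<odot> \<zero> = \<zero>"
  using scale_scale[of \<zero> c 0] scale_zero_left[of \<zero>] by simp

text \<open>Transfers the linearity of \<open>qc\<close> in its second argument to the
  first.\<close>

lemma (in k_algebra) qc_flip: "u \<in> carrier B \<Longrightarrow> v \<in> carrier B \<Longrightarrow> qc r u v = qc (- inverse r) v u"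
  by (simp add: qc_def scale_closed a_comm)

locale q_torus = k_algebra B for B :: "('k::field_char_0, 'b) module" (structure) +
  fixes q :: 'k and x xi y yi :: 'b
  assumes q_nz: "q \<noteq> 0"
    and gens_closed: "x \<in> carrier B" "xi \<in> carrier B" "y \<in> carrier B" "yi \<in> carrier B"
    and gens_inv: "x \<otimes> xi = \<one>" "xi \<otimes> x = \<one>" "y \<otimes> yi = \<one>" "yi \<otimes> y = \<one>"
    and gens_comm: "x \<otimes> y = q\<^sup>2 \<odot> (y \<otimes> x)"
begin

lemma q2: "q\<^sup>2 * inverse q ^ 2 = 1" "inverse q ^ 2 * q\<^sup>2 = 1"
  using q_nz by (simp_all flip: power_mult_distrib)

text \<open>Multiply the given relation by \<open>ai\<close> on both sides.\<close>

lemma swap_inv: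
  assumes c: "a \<in> carrier B" "ai \<in> carrier B" "b \<in> carrier B" and i: "a \<otimes> ai = \<one>" "ai \<otimes> a = \<one>"
    and ab: "a \<otimes> b = c \<odot> (b \<otimes> a)"
  shows "b \<otimes> ai = c \<odot> (ai \<otimes> b)"
proof -
  have "b \<otimes> ai = ai \<otimes> (a \<otimes> b) \<otimes> ai" using c i by (simp flip: m_assoc)
  also have "\<dots> = c \<odot> (ai \<otimes> b \<otimes> (a \<otimes> ai))"
    unfolding ab using c by (simp add: scale_mult_left scale_mult_right m_assoc)
  finally show ?thesis using c i by simp
qed

lemma swap_flip:
  assumes "a \<in> carrier B" "b \<in> carrier B" "d * c = 1" "a \<otimes> b = c \<odot> (b \<otimes> a)"
  shows "b \<otimes> a = d \<odot> (a \<otimes> b)"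
  using assms by (simp add: scale_scale scale_one)

lemma normal_order:
  "y \<otimes> x = inverse q ^ 2 \<odot> (x \<otimes> y)" "y \<otimes> xi = q\<^sup>2 \<odot> (xi \<otimes> y)"
  "yi \<otimes> x = q\<^sup>2 \<odot> (x \<otimes> yi)" "yi \<otimes> xi = inverse q ^ 2 \<odot> (xi \<otimes> yi)"
proof -
  note c = gens_closed
  show yx: "y \<otimes> x = inverse q ^ 2 \<odot> (x \<otimes> y)"
    by (rule swap_flip[OF c(1,3) q2(2) gens_comm])
  show yxi: "y \<otimes> xi = q\<^sup>2 \<odot> (xi \<otimes> y)"
    by (rule swap_inv[OF c(1,2,3) gens_inv(1,2) gens_comm])
  have "x \<otimes> yi = inverse q ^ 2 \<odot> (yi \<otimes> x)"
    by (rule swap_inv[OF c(3,4,1) gens_inv(3,4) yx])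
  then show "yi \<otimes> x = q\<^sup>2 \<odot> (x \<otimes> yi)"
    by (rule swap_flip[OF c(1,4) q2(1)])
  have "xi \<otimes> yi = q\<^sup>2 \<odot> (yi \<otimes> xi)"
    by (rule swap_inv[OF c(3,4,2) gens_inv(3,4) yxi])
  then show "yi \<otimes> xi = inverse q ^ 2 \<odot> (xi \<otimes> yi)"
    by (rule swap_flip[OF c(2,4) q2(2)])
qed

text \<open>The rules for a pair of letters followed by a further factor, as they occur in products
  nested to the right. With them every product of generators is rewritten with the powers of x in
  front of those of y.\<close>

lemma normal_order_left:
  assumes "z \<in> carrier B"
  shows "y \<otimes> (x \<otimes> z) = inverse q ^ 2 \<odot> (x \<otimes> (y \<otimes> z))" "y \<otimes> (xi \<otimes> z) = q\<^sup>2 \<odot> (xi \<otimes> (y \<otimes> z))"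
    "yi \<otimes> (x \<otimes> z) = q\<^sup>2 \<odot> (x \<otimes> (yi \<otimes> z))" "yi \<otimes> (xi \<otimes> z) = inverse q ^ 2 \<odot> (xi \<otimes> (yi \<otimes> z))"
    "x \<otimes> (xi \<otimes> z) = z" "xi \<otimes> (x \<otimes> z) = z" "y \<otimes> (yi \<otimes> z) = z" "yi \<otimes> (y \<otimes> z) = z"
  using assms gens_closed by (simp_all add: normal_order gens_inv scale_mult_left flip: m_assoc)

section \<open>Products of the symmetric elements of the torus\<close>

definition "X = x \<oplus> xi"
definition "Y = y \<oplus> yi"
definition "V = x \<otimes> yi \<oplus> xi \<otimes> y"
definition "U = x \<otimes> y \<oplus> xi \<otimes> yi"

lemma torus_closed: "X \<in> carrier B" "Y \<in> carrier B" "V \<in> carrier B" "U \<in> carrier B"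
  by (simp_all add: X_def Y_def V_def U_def gens_closed)

lemmas torus_simps = X_def Y_def V_def U_def gens_closed gens_inv normal_order normal_order_left
  l_distr r_distr m_assoc scale_mult_left scale_mult_right scale_add_right scale_closed scale_scale scale_one a_ac

lemma X_Y: "X \<otimes> Y = V \<oplus> U"
  by (simp add: torus_simps)

lemma Y_X: "Y \<otimes> X = q\<^sup>2 \<odot> V \<oplus> inverse q ^ 2 \<odot> U"
  by (simp add: torus_simps)

text \<open>The squares of \<open>X\<close> and \<open>Y\<close> each contain the constant 2,
  whereas \<open>V \<otimes> U\<close> has no constant term; the scalar on the left makes up for
  this.\<close>

lemma V_U: "V \<otimes> U \<oplus> (2 * (q\<^sup>2 + inverse q ^ 2)) \<odot> \<one> = q\<^sup>2 \<odot> (X \<otimes> X) \<oplus> inverse q ^ 2 \<odot> (Y \<otimes> Y)"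
proof -
  have "2 * (q\<^sup>2 + inverse q ^ 2) = (q\<^sup>2 + q\<^sup>2) + (inverse q ^ 2 + inverse q ^ 2)" by simp
  then have "(2 * (q\<^sup>2 + inverse q ^ 2)) \<odot> \<one> = (q\<^sup>2 \<odot> \<one> \<oplus> q\<^sup>2 \<odot> \<one>) \<oplus> (inverse q ^ 2 \<odot> \<one> \<oplus> inverse q ^ 2 \<odot> \<one>)"
    by (simp only: scale_add_left one_closed)
  then show ?thesis by (simp add: torus_simps q2 del: power_inverse)
qed

lemma qc_X_V: "qc q X V = (q - inverse q ^ 3) \<odot> Y"
proof -
  \<comment> \<open>The part of both products that is neither y nor y^-1. It acquires the factor q^2
    when the order is reversed, so the q-commutator cancels it.\<close>
  define A where "A = x \<otimes> (x \<otimes> yi) \<oplus> xi \<otimes> (xi \<otimes> y)"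
  have A: "A \<in> carrier B" by (simp add: A_def gens_closed)
  have "X \<otimes> V = A \<oplus> Y" "V \<otimes> X = q\<^sup>2 \<odot> A \<oplus> inverse q ^ 2 \<odot> Y"
    by (simp_all add: A_def torus_simps)
  then have "qc q X V = (q \<odot> A \<oplus> q \<odot> Y) \<oplus> ((- inverse q * q\<^sup>2) \<odot> A \<oplus> (- inverse q * inverse q ^ 2) \<odot> Y)"
    using A torus_closed by (simp add: qc_def scale_add_right scale_scale scale_closed)
  also have "\<dots> = (q + - inverse q * q\<^sup>2) \<odot> A \<oplus> (q + - inverse q * inverse q ^ 2) \<odot> Y"
    by (rule scale_collect[OF A torus_closed(2)])
  also have "q + - inverse q * q\<^sup>2 = 0"
    using q_nz by (simp add: power2_eq_square flip: mult.assoc)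
  also have "q + - inverse q * inverse q ^ 2 = q - inverse q ^ 3"
    by (simp add: power2_eq_square power3_eq_cube)
  finally show ?thesis using A torus_closed by (simp add: scale_zero_left scale_closed)
qed

lemma qc_V_Y: "qc q V Y = (q - inverse q ^ 3) \<odot> X"
proof -
  define A where "A = x \<otimes> (yi \<otimes> yi) \<oplus> xi \<otimes> (y \<otimes> y)"
  have A: "A \<in> carrier B" by (simp add: A_def gens_closed)
  have "V \<otimes> Y = A \<oplus> X" "Y \<otimes> V = q\<^sup>2 \<odot> A \<oplus> inverse q ^ 2 \<odot> X"
    by (simp_all add: A_def torus_simps)
  then have "qc q V Y = (q \<odot> A \<oplus> q \<odot> X) \<oplus> ((- inverse q * q\<^sup>2) \<odot> A \<oplus> (- inverse q * inverse q ^ 2) \<odot> X)"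
    using A torus_closed by (simp add: qc_def scale_add_right scale_scale scale_closed)
  also have "\<dots> = (q + - inverse q * q\<^sup>2) \<odot> A \<oplus> (q + - inverse q * inverse q ^ 2) \<odot> X"
    by (rule scale_collect[OF A torus_closed(1)])
  also have "q + - inverse q * q\<^sup>2 = 0"
    using q_nz by (simp add: power2_eq_square flip: mult.assoc)
  also have "q + - inverse q * inverse q ^ 2 = q - inverse q ^ 3"
    by (simp add: power2_eq_square power3_eq_cube)
  finally show ?thesis using A torus_closed by (simp add: scale_zero_left scale_closed)
qed

section \<open>The claimed values and the relations they satisfy\<close>

abbreviation "r \<equiv> q + inverse q"

definition "gV = r * q * (q - inverse q)"
definition "gU = r * inverse q * (q - inverse q)"

text \<open>\<open>AG k\<close> and \<open>AGt k\<close> have index k+1. Since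
  \<open>alt_coeff r\<close> vanishes at odd arguments, one of the two summands is always zero, and
  the other is the claimed value for the parity at hand.\<close>

fun alt_value :: "ace_gen \<Rightarrow> 'b" where
  "alt_value (AWm k) = alt_coeff r k \<odot> X"
| "alt_value (AWp k) = alt_coeff r k \<odot> Y"
| "alt_value (AG k) = (G0 q * alt_coeff r (Suc k)) \<odot> \<one> \<oplus> (gV * alt_coeff r k) \<odot> V"
| "alt_value (AGt k) = (G0 q * alt_coeff r (Suc k)) \<odot> \<one> \<oplus> (gU * alt_coeff r k) \<odot> U"

definition "alt_hom = free_lift B alt_value"

lemma alt_value_closed: "alt_value \<in> UNIV \<rightarrow> carrier B"
proof
  fix g show "alt_value g \<in> carrier B"
    by (cases g) (simp_all add: torus_closed scale_closed)
qed

lemma alt_hom_free_hom: "free_hom B alt_hom"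
proof -
  have "alt_hom (scal c * f) = c \<odot> alt_hom f" for c f
    by (simp add: alt_hom_def free_lift_mult[OF alt_value_closed] free_alg_UNIV scale_mult_left
        free_lift_scal[OF alt_value_closed] free_lift_closed[OF alt_value_closed])
  then have "alt_hom \<in> alg_hom (free_alg UNIV) B"
    using free_lift_ring_hom[OF alt_value_closed] by (simp add: alg_hom_def alt_hom_def) (simp add: free_alg_def)
  then show ?thesis by unfold_locales
qed

lemma alt_hom_gen: "alt_hom (gen g) = alt_value g"
  by (simp add: alt_hom_def free_lift_gen[OF alt_value_closed])

sublocale alt: free_hom B alt_hom
  by (rule alt_hom_free_hom)

text \<open>The commutator of \<open>X\<close> and \<open>Y\<close> is (1 - q^2) V + (1 - q^-2) U,
  and up to sign these coefficients are \<open>gV\<close> and \<open>gU\<close> divided by r. The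
  multiples of 1 in \<open>Gt k\<close> and \<open>Gp k\<close> are equal and cancel.\<close>

lemma alt_rel_W:
  assumes r: "r \<noteq> 0"
  shows "alt_hom (comm (Wm k) (Wp 0)) = alt_hom (scal (inverse r) * (Gt k - Gp k))"
proof -
  let ?c = "alt_coeff r k" and ?d = "G0 q * alt_coeff r (Suc k)"
  have U_V: "(a \<odot> V \<oplus> b \<odot> U) \<oplus> (c \<odot> V \<oplus> d \<odot> U) = (a + c) \<odot> V \<oplus> (b + d) \<odot> U" for a b c d
    by (rule scale_collect[OF torus_closed(3,4)])
  have cc: "1 - q\<^sup>2 = - (inverse r * gV)" "1 - inverse q ^ 2 = inverse r * gU"
    using r q_nz by (simp_all add: gV_def gU_def right_diff_distrib power2_eq_square flip: mult.assoc)
  have "alt_hom (comm (Wm k) (Wp 0)) = (?c \<odot> V \<oplus> ?c \<odot> U) \<oplus> ((- ?c * q\<^sup>2) \<odot> V \<oplus> (- ?c * inverse q ^ 2) \<odot> U)"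
    by (simp add: comm_def alt.hom_diff alt.hom_mult alt_hom_gen alt_coeff_0 scale_one torus_closed
        scale_mult_left scale_mult_right X_Y Y_X scale_add_right scale_scale scale_closed)
  also have "\<dots> = (?c * (1 - q\<^sup>2)) \<odot> V \<oplus> (?c * (1 - inverse q ^ 2)) \<odot> U"
    unfolding U_V by (simp add: algebra_simps)
  finally have L: "alt_hom (comm (Wm k) (Wp 0)) = (?c * (1 - q\<^sup>2)) \<odot> V \<oplus> (?c * (1 - inverse q ^ 2)) \<odot> U" .
  have can: "(a \<odot> \<one> \<oplus> b \<odot> U) \<oplus> ((- a) \<odot> \<one> \<oplus> c \<odot> V) = c \<odot> V \<oplus> b \<odot> U" for a b c
  proof -
    have "(a \<odot> \<one> \<oplus> b \<odot> U) \<oplus> ((- a) \<odot> \<one> \<oplus> c \<odot> V) = (a + - a) \<odot> \<one> \<oplus> (c \<odot> V \<oplus> b \<odot> U)"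
      unfolding scale_add_left[OF one_closed] by (simp add: torus_closed scale_closed a_ac)
    then show ?thesis by (simp add: scale_zero_left torus_closed scale_closed)
  qed
  have "alt_hom (scal (inverse r) * (Gt k - Gp k)) =
    ((inverse r * ?d) \<odot> \<one> \<oplus> (inverse r * gU * ?c) \<odot> U) \<oplus> ((- (inverse r * ?d)) \<odot> \<one> \<oplus> (- (inverse r * gV * ?c)) \<odot> V)"
    by (simp add: alt.hom_smult alt.hom_diff alt_hom_gen torus_closed scale_add_right scale_scale scale_closed mult.assoc)
  then show ?thesis unfolding L can cc by (simp add: mult_ac)
qed

lemma rho_G0: "G0 q * (q - inverse q) = rho q" and rho_gV: "gV * (q - inverse q ^ 3) = - rho q"
  using q_nz by (simp_all add: G0_def rho_def gV_def field_simps power2_eq_square power3_eq_cube)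

lemma qc_one: "u \<in> carrier B \<Longrightarrow> qc s u \<one> = (s - inverse s) \<odot> u" "u \<in> carrier B \<Longrightarrow> qc s \<one> u = (s - inverse s) \<odot> u"
  using scale_add_left[of u s "- inverse s"] by (simp_all add: qc_def)

text \<open>The multiple of 1 in \<open>Gp k\<close> produces the term with
  \<open>Wm (k + 1)\<close>, the multiple of \<open>V\<close> the one with
  \<open>Wp k\<close>.\<close>

lemma alt_rel_Wm:
  "alt_hom (qcomm q (Wm 0) (Gp k)) = alt_hom (scal (rho q) * Wm (k + 1) - scal (rho q) * Wp k)"
proof -
  let ?c = "alt_coeff r k" and ?d = "alt_coeff r (Suc k)"
  have "alt_hom (qcomm q (Wm 0) (Gp k)) = (?d * (G0 q * (q - inverse q))) \<odot> X \<oplus> (?c * (gV * (q - inverse q ^ 3))) \<odot> Y"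
    by (simp add: alt.hom_qcomm alt_hom_gen alt_coeff_0 scale_one torus_closed qc_add qc_scale scale_closed
        qc_one qc_X_V scale_scale mult_ac)
  also have "\<dots> = alt_hom (scal (rho q) * Wm (k + 1) - scal (rho q) * Wp k)"
    unfolding rho_G0 rho_gV
    by (simp add: alt.hom_diff alt.hom_smult alt_hom_gen torus_closed scale_scale mult_ac)
  finally show ?thesis .
qed

lemma alt_rel_Wp:
  "alt_hom (qcomm q (Gp k) (Wp 0)) = alt_hom (scal (rho q) * Wp (k + 1) - scal (rho q) * Wm k)"
proof -
  let ?c = "alt_coeff r k" and ?d = "alt_coeff r (Suc k)"
  \<comment> \<open>The sum is moved into the second argument, where \<open>qc\<close> is linear;
    the next step flips each summand back.\<close>
  have "alt_hom (qcomm q (Gp k) (Wp 0)) = qc (- inverse q) Y ((G0 q * ?d) \<odot> \<one> \<oplus> (gV * ?c) \<odot> V)"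
    by (simp add: alt.hom_qcomm alt_hom_gen alt_coeff_0 scale_one torus_closed qc_flip[of _ Y] scale_closed)
  also have "\<dots> = (G0 q * ?d) \<odot> qc q \<one> Y \<oplus> (gV * ?c) \<odot> qc q V Y"
    by (simp add: qc_add qc_scale torus_closed scale_closed qc_flip[of _ Y])
  also have "\<dots> = (?d * (G0 q * (q - inverse q))) \<odot> Y \<oplus> (?c * (gV * (q - inverse q ^ 3))) \<odot> X"
    by (simp add: torus_closed qc_one qc_V_Y scale_scale mult_ac)
  also have "\<dots> = alt_hom (scal (rho q) * Wp (k + 1) - scal (rho q) * Wm k)"
    unfolding rho_G0 rho_gV
    by (simp add: alt.hom_diff alt.hom_smult alt_hom_gen torus_closed scale_scale mult_ac)
  finally show ?thesis .
qed

lemma alt_ace_hom: "r \<noteq> 0 \<Longrightarrow> ace_hom B alt_hom q"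
  using alt_rel_W alt_rel_Wm alt_rel_Wp by unfold_locales

end

text \<open>A scalar series times one fixed element. As the values of the generators are scalar
  multiples of 1, \<open>X\<close>, \<open>Y\<close>, \<open>V\<close>, \<open>U\<close> or sums of
  these, all series in question reduce to finite sums of such terms.\<close>

definition sc_term :: "'k::field fps \<Rightarrow> ('g, 'k) ncpoly \<Rightarrow> ('g, 'k) ncpoly fps" where
  "sc_term a u = scal_fps a * fps_const u"

lemma sc_term_nth: "fps_nth (sc_term a u) n = scal (fps_nth a n) * u"
  by (simp add: sc_term_def scal_fps_def)

lemma sc_term_zero_left: "sc_term 0 u = 0"
  by (rule fps_ext) (simp add: sc_term_nth scal_0)

lemma sc_term_add_left: "sc_term (a + b) u = sc_term a u + sc_term b u"
  by (simp add: sc_term_def scal_fps_add distrib_right)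

lemma sc_term_diff_left: "sc_term (a - b) u = sc_term a u - sc_term b u"
  using sc_term_add_left[of "a - b" b u] by simp

lemma sc_term_add_right: "sc_term a (u + v) = sc_term a u + sc_term a v"
  by (rule fps_ext) (simp add: sc_term_nth distrib_left)

lemma sc_term_diff_right: "sc_term a (u - v) = sc_term a u - sc_term a v"
  using sc_term_add_right[of a "u - v" v] by simp

lemma sc_term_scal: "sc_term a (scal c * u) = sc_term (a * fps_const c) u"
  by (rule fps_ext) (simp add: sc_term_nth scal_scal)

lemma sc_term_one: "sc_term a 1 = scal_fps a"
  by (simp add: sc_term_def)

lemma sc_term_scal_one: "sc_term a (scal c) = sc_term (a * fps_const c) 1"
  using sc_term_scal[of a c 1] by simp

lemma scal_fps_sc_term: "scal_fps a * sc_term b u = sc_term (a * b) u"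
  by (simp add: sc_term_def scal_fps_mult mult.assoc)

lemma sc_term_mult: "sc_term a u * sc_term b v = sc_term (a * b) (u * v)"
proof -
  have "sc_term a u * sc_term b v = scal_fps a * (fps_const u * scal_fps b) * fps_const v"
    by (simp add: sc_term_def mult.assoc)
  also have "\<dots> = sc_term (a * b) (u * v)"
    unfolding scal_fps_commute[of b "fps_const u", symmetric] by (simp add: sc_term_def scal_fps_mult mult.assoc)
  finally show ?thesis .
qed

lemma fps_subst_sc_term: "fps_subst (sc_term a u) f = sc_term (a oo f) u"
proof (rule fps_ext)
  fix n
  have "fps_nth (fps_subst (sc_term a u) f) n = (\<Sum>i=0..n. scal (fps_nth a i * fps_nth (f ^ i) n) * u)"
    by (simp add: fps_subst_nth sc_term_nth scal_scal mult.commute)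
  then show "fps_nth (fps_subst (sc_term a u) f) n = fps_nth (sc_term (a oo f) u) n"
    by (simp add: sc_term_nth fps_compose_nth scal_sum sum_distrib_right)
qed

lemma fps_subst_add: "fps_subst (F + G) f = fps_subst F f + fps_subst G f"
  by (rule fps_ext) (simp add: fps_subst_nth distrib_left sum.distrib)

context free_hom begin

text \<open>Series over the free algebra are compared through the coefficientwise values of \<open>H\<close>, since
  power series over a ring record are not available.\<close>

definition fcong :: "('g, 'k) ncpoly fps \<Rightarrow> ('g, 'k) ncpoly fps \<Rightarrow> bool" where
  "fcong F G \<longleftrightarrow> (\<forall>n. H (fps_nth F n) = H (fps_nth G n))"

lemma fcong_refl: "fcong F F"
  by (simp add: fcong_def)

lemma fcong_trans [trans]: "fcong F G \<Longrightarrow> fcong G E \<Longrightarrow> fcong F E"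
  by (simp add: fcong_def)

lemma fcong_add: "fcong F G \<Longrightarrow> fcong F' G' \<Longrightarrow> fcong (F + F') (G + G')"
  by (simp add: fcong_def hom_add)

lemma fcong_diff: "fcong F G \<Longrightarrow> fcong F' G' \<Longrightarrow> fcong (F - F') (G - G')"
  by (simp add: fcong_def hom_diff)

lemma fcong_mult: "fcong F G \<Longrightarrow> fcong F' G' \<Longrightarrow> fcong (F * F') (G * G')"
  unfolding fcong_def fps_mult_nth by (auto intro!: hom_sum_cong simp: hom_mult)

lemma fcong_subst: "fcong F G \<Longrightarrow> fcong (fps_subst F f) (fps_subst G f)"
  unfolding fcong_def fps_subst_nth by (auto intro!: hom_sum_cong simp: hom_smult)

lemma fcong_sc_term: "H u = H v \<Longrightarrow> fcong (sc_term a u) (sc_term a v)"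
  by (simp add: fcong_def sc_term_nth hom_smult)

end

text \<open>The series of the central elements with the claimed values inserted; \<open>w\<close>,
  \<open>w'\<close>, \<open>v\<close>, \<open>u\<close> are lifts of \<open>X\<close>,
  \<open>Y\<close>, \<open>V\<close>, \<open>U\<close> to the free algebra. By \<open>rel\<close>
  everything becomes a combination of \<open>v\<close>, \<open>u\<close>, the two squares and 1,
  whose coefficients are computed one by one.\<close>

lemma (in free_hom) fcong_Z_const:
  fixes F G S T P :: "'k fps"
  assumes k: "k * gv * gu = 1" "k * g0 * g0 = R" "k * g0 * gv = - e" "k * g0 * gu = - e'"
    and P: "P + fps_const a * (fps_X * S * T) = fps_const e * S"
      "P + fps_const b * (fps_X * S * T) = fps_const e' * T"
    and FG: "F * G * (fps_const R - fps_const c * (S * T)) = fps_const R"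
    and rel: "H (w * w') = H (v + u)" "H (w' * w) = H (scal a * v + scal b * u)"
      "H (v * u) = H (scal a * (w * w) + scal b * (w' * w') - scal c)"
  shows "fcong (scal_fps P * sc_term F w * sc_term G w'
    + scal_fps (fps_X * S * T) * sc_term F w' * sc_term G w
    - scal_fps (fps_const a * S * T) * sc_term F w * sc_term G w
    - scal_fps (fps_const b * S * T) * sc_term F w' * sc_term G w'
    + scal_fps (fps_const k) * (sc_term (fps_const g0 * F) 1 + sc_term (fps_const gv * S * F) v)
        * (sc_term (fps_const g0 * G) 1 + sc_term (fps_const gu * T * G) u))
    (fps_const (scal R))" (is "fcong ?Z _")
proof -
  have kk: "fps_const k * (fps_const g0 * F) * (fps_const g0 * G) = fps_const R * F * G"
    "fps_const k * (fps_const g0 * F) * (fps_const gu * T * G) = - fps_const e' * T * F * G"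
    "fps_const k * (fps_const gv * S * F) * (fps_const g0 * G) = - fps_const e * S * F * G"
    "fps_const k * (fps_const gv * S * F) * (fps_const gu * T * G) = S * T * F * G"
  proof -
    have c: "fps_const k * (fps_const i * A) * (fps_const j * B) = fps_const (k * i * j) * (A * B)"
      for i j and A B :: "'k fps"
      by (simp only: mult_ac flip: fps_const_mult)
    show "fps_const k * (fps_const g0 * F) * (fps_const g0 * G) = fps_const R * F * G"
      unfolding c k by (simp only: mult_ac)
    show "fps_const k * (fps_const g0 * F) * (fps_const gu * T * G) = - fps_const e' * T * F * G"
      unfolding mult.assoc[of "fps_const gu"] c k by (simp only: mult_ac fps_const_neg)
    have "k * gv * g0 = - e" using k(3) by (simp only: mult_ac)
    then show "fps_const k * (fps_const gv * S * F) * (fps_const g0 * G) = - fps_const e * S * F * G"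
      unfolding mult.assoc[of "fps_const gv"] c by (simp only: mult_ac fps_const_neg)
    show "fps_const k * (fps_const gv * S * F) * (fps_const gu * T * G) = S * T * F * G"
      unfolding mult.assoc[of "fps_const gv"] mult.assoc[of "fps_const gu"] c k by (simp only: mult_ac fps_const_1_eq_1 mult_1_left)
  qed
  have Z: "?Z = sc_term (P * F * G) (w * w') + sc_term (fps_X * S * T * F * G) (w' * w)
    - sc_term (fps_const a * S * T * F * G) (w * w) - sc_term (fps_const b * S * T * F * G) (w' * w')
    + (sc_term (fps_const R * F * G) 1 + sc_term (- fps_const e' * T * F * G) u
      + (sc_term (- fps_const e * S * F * G) v + sc_term (S * T * F * G) (v * u)))"
    unfolding kk[symmetric] distrib_left distrib_right scal_fps_sc_term sc_term_mult by (simp only: mult_1_left mult_1_right add_ac)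
  let ?Y = "sc_term (P * F * G) (v + u)
    + sc_term (fps_X * S * T * F * G) (scal a * v + scal b * u)
    - sc_term (fps_const a * S * T * F * G) (w * w) - sc_term (fps_const b * S * T * F * G) (w' * w')
    + (sc_term (fps_const R * F * G) 1 + sc_term (- fps_const e' * T * F * G) u
      + (sc_term (- fps_const e * S * F * G) v
        + sc_term (S * T * F * G) (scal a * (w * w) + scal b * (w' * w') - scal c)))"
  have ZY: "fcong ?Z ?Y"
    unfolding Z by (intro fcong_add fcong_diff fcong_sc_term rel refl)
  \<comment> \<open>The coefficients of \<open>v\<close> and \<open>u\<close> vanish by
    \<open>P\<close>, those of the two squares cancel, and that of 1 is given by
    \<open>FG\<close>.\<close>
  have c1: "P * F * G + fps_X * S * T * F * G * fps_const a + - fps_const e * S * F * G = 0"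
  proof -
    have "P * F * G + fps_X * S * T * F * G * fps_const a + - fps_const e * S * F * G =
        (P + fps_const a * (fps_X * S * T) - fps_const e * S) * F * G"
      by (simp only: ring_distribs mult_ac mult_minus_left mult_minus_right diff_conv_add_uminus)
    then show ?thesis unfolding P by simp
  qed
  have c2: "P * F * G + fps_X * S * T * F * G * fps_const b + - fps_const e' * T * F * G = 0"
  proof -
    have "P * F * G + fps_X * S * T * F * G * fps_const b + - fps_const e' * T * F * G =
        (P + fps_const b * (fps_X * S * T) - fps_const e' * T) * F * G"
      by (simp only: ring_distribs mult_ac mult_minus_left mult_minus_right diff_conv_add_uminus)
    then show ?thesis unfolding P by simp
  qed
  have c3: "S * T * F * G * fps_const d - fps_const d * S * T * F * G = 0" for d
    by (simp only: mult_ac diff_self)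
  have c4: "fps_const R * F * G - S * T * F * G * fps_const c = fps_const R"
  proof -
    have "fps_const R * F * G - S * T * F * G * fps_const c = F * G * (fps_const R - fps_const c * (S * T))"
      by (simp only: right_diff_distrib mult_ac)
    then show ?thesis unfolding FG .
  qed
  have "?Y = sc_term (P * F * G + fps_X * S * T * F * G * fps_const a + - fps_const e * S * F * G) v
    + sc_term (P * F * G + fps_X * S * T * F * G * fps_const b + - fps_const e' * T * F * G) u
    + sc_term (S * T * F * G * fps_const a - fps_const a * S * T * F * G) (w * w)
    + sc_term (S * T * F * G * fps_const b - fps_const b * S * T * F * G) (w' * w')
    + sc_term (fps_const R * F * G - S * T * F * G * fps_const c) 1"
    unfolding sc_term_add_right sc_term_diff_right sc_term_scal sc_term_scal_one[of _ c]
      sc_term_add_left sc_term_diff_left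
    by (simp only: diff_conv_add_uminus ab_group_add_class.minus_add_distrib group_add_class.minus_minus add_ac)
  then have Y: "?Y = fps_const (scal R)"
    unfolding c1 c2 c3 c4 by (simp add: sc_term_zero_left sc_term_one scal_fps_const)
  show ?thesis using ZY unfolding Y .
qed

section \<open>The claimed values annihilate the central elements\<close>

context q_torus begin

lemma alt_W_series:
  "alt.fcong Wm_series (sc_term (alt_series r) (Wm 0))" "alt.fcong Wp_series (sc_term (alt_series r) (Wp 0))"
  by (simp_all add: alt.fcong_def Wm_series_def Wp_series_def sc_term_nth alt_series_def alt.hom_smult
      alt_hom_gen alt_coeff_0 scale_one torus_closed)

text \<open>The factor \<open>fps_X\<close> reflects that the coefficient of \<open>V\<close> or
  \<open>U\<close> at index k+1 is taken from index k. At index 0 only \<open>G0 q\<close> remains,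
  in agreement with the convention.\<close>

lemma alt_G_series:
  assumes v: "alt_hom v = V" and u: "alt_hom u = U"
  shows "alt.fcong (G_series q) (sc_term (fps_const (G0 q) * alt_series r) 1 + sc_term (fps_const gV * fps_X * alt_series r) v)"
    and "alt.fcong (Gt_series q) (sc_term (fps_const (G0 q) * alt_series r) 1 + sc_term (fps_const gU * fps_X * alt_series r) u)"
  by (auto simp: alt.fcong_def G_series_def Gt_series_def sc_term_nth alt.hom_add alt_series_def mult.assoc
      alt.hom_scal alt.hom_smult v u alt_hom_gen alt_coeff_0 torus_closed scale_zero_left scale_closed
      split: nat.split)

text \<open>The whole series takes the constant value (q + q^-1)^2, which is the value of its
  coefficient 0.\<close>

lemma alt_hom_Z:
  assumes q4: "q ^ 4 \<noteq> 1"
  shows "alt_hom (fps_nth (Z_series q) (Suc n)) = \<zero>"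
proof -
  note r = q_plus_nonzero[OF q_nz q4] and rm = q_minus_nonzero[OF q_nz q4]
  have nz: "gV \<noteq> 0" "gU \<noteq> 0" using r rm q_nz by (simp_all add: gV_def gU_def)
  define S T F G where "S = S_ser q" and "T = T_ser q" and "F = alt_series r oo S" and "G = alt_series r oo T"
  define k where "k = inverse ((q\<^sup>2 - inverse q ^ 2)\<^sup>2)"
  have S0: "fps_nth S 0 = 0" "fps_nth T 0 = 0" by (simp_all add: S_def T_def S_ser_0 T_ser_0 q_nz)
  have "q\<^sup>2 - inverse q ^ 2 = r * (q - inverse q)" by (simp add: algebra_simps power2_eq_square)
  then have kr: "k * (r * (q - inverse q)) ^ 2 = 1" using r rm by (simp add: k_def)
  have k: "k * gV * gU = 1" "k * G0 q * G0 q = r\<^sup>2" "k * G0 q * gV = - (r * q)" "k * G0 q * gU = - (r * inverse q)"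
  proof -
    have "k * gV * gU = k * (r * (q - inverse q)) ^ 2 * (q * inverse q)"
      unfolding gV_def gU_def by (simp only: power2_eq_square mult_ac)
    then show "k * gV * gU = 1" unfolding kr using q_nz by simp
    have "k * G0 q * G0 q = k * (r * (q - inverse q)) ^ 2 * r\<^sup>2"
      unfolding G0_def by (simp only: power2_eq_square mult_ac mult_minus_left mult_minus_right group_add_class.minus_minus)
    then show "k * G0 q * G0 q = r\<^sup>2" unfolding kr by simp
    have "k * G0 q * gV = - (k * (r * (q - inverse q)) ^ 2 * (r * q))"
      unfolding G0_def gV_def by (simp only: power2_eq_square mult_ac mult_minus_left mult_minus_right)
    then show "k * G0 q * gV = - (r * q)" unfolding kr by simp
    have "k * G0 q * gU = - (k * (r * (q - inverse q)) ^ 2 * (r * inverse q))"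
      unfolding G0_def gU_def by (simp only: power2_eq_square mult_ac mult_minus_left mult_minus_right)
    then show "k * G0 q * gU = - (r * inverse q)" unfolding kr by simp
  qed
  \<comment> \<open>The value of \<open>Gp 0\<close> is a multiple of \<open>V\<close> alone,
    because \<open>alt_coeff\<close> vanishes at 1; likewise for \<open>Gt 0\<close> and
    \<open>U\<close>.\<close>
  define v u where "v = scal (inverse gV) * Gp 0" and "u = scal (inverse gU) * Gt 0"
  have c1: "alt_coeff r (Suc 0) = 0" by (simp add: alt_coeff_def)
  have v: "alt_hom v = V" and u: "alt_hom u = U"
    using nz by (simp_all add: v_def u_def alt.hom_smult alt_hom_gen c1 alt_coeff_0 torus_closed scale_closed
        scale_zero_left scale_scale scale_one)
  have W: "alt_hom (Wm 0) = X" "alt_hom (Wp 0) = Y"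
    by (simp_all add: alt_hom_gen alt_coeff_0 scale_one torus_closed)
  have "alt_hom (v * u) = alt_hom ((v * u + scal (2 * (q\<^sup>2 + inverse q ^ 2))) - scal (2 * (q\<^sup>2 + inverse q ^ 2)))"
    by simp
  also have "\<dots> = alt_hom ((scal (q\<^sup>2) * (Wm 0 * Wm 0) + scal (inverse q ^ 2) * (Wp 0 * Wp 0))
      - scal (2 * (q\<^sup>2 + inverse q ^ 2)))"
    using V_U by (simp only: alt.hom_diff alt.hom_add alt.hom_mult[of v] alt.hom_mult[of "Wm 0"]
        alt.hom_mult[of "Wp 0"] alt.hom_smult alt.hom_scal v u W)
  finally have vu: "alt_hom (v * u) = alt_hom (scal (q\<^sup>2) * (Wm 0 * Wm 0) + scal (inverse q ^ 2) * (Wp 0 * Wp 0)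
      - scal (2 * (q\<^sup>2 + inverse q ^ 2)))" .
  have WW: "alt_hom (Wm 0 * Wp 0) = alt_hom (v + u)"
      "alt_hom (Wp 0 * Wm 0) = alt_hom (scal (q\<^sup>2) * v + scal (inverse q ^ 2) * u)"
    by (simp_all only: alt.hom_add alt.hom_mult[of "Wm 0"] alt.hom_mult[of "Wp 0"] alt.hom_smult v u W X_Y Y_X)
  have GS: "(fps_const (G0 q) * alt_series r oo s) = fps_const (G0 q) * (alt_series r oo s)"
      "(fps_const b * fps_X * alt_series r oo s) = fps_const b * s * (alt_series r oo s)"
    if "fps_nth s 0 = 0" for s b
    using that by (simp_all add: fps_compose_mult_distrib)
  have "alt.fcong (Z_series q) (scal_fps (fps_shift 1 (S * T)) * sc_term F (Wm 0) * sc_term G (Wp 0)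
    + scal_fps (fps_X * S * T) * sc_term F (Wp 0) * sc_term G (Wm 0)
    - scal_fps (fps_const (q\<^sup>2) * S * T) * sc_term F (Wm 0) * sc_term G (Wm 0)
    - scal_fps (fps_const (inverse q ^ 2) * S * T) * sc_term F (Wp 0) * sc_term G (Wp 0)
    + scal_fps (fps_const k) * (sc_term (fps_const (G0 q) * F) 1 + sc_term (fps_const gV * S * F) v)
        * (sc_term (fps_const (G0 q) * G) 1 + sc_term (fps_const gU * T * G) u))"
    unfolding Z_series_def Let_def F_def G_def fps_subst_sc_term[symmetric] GS[OF S0(1), symmetric] GS[OF S0(2), symmetric]
      fps_subst_add[symmetric] S_def[symmetric] T_def[symmetric] k_def[symmetric]
    by (intro alt.fcong_add alt.fcong_diff alt.fcong_mult alt.fcong_refl alt.fcong_subst alt_W_series alt_G_series[OF v u])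
  then have "alt.fcong (Z_series q) (fps_const (scal (r\<^sup>2)))"
    by (rule alt.fcong_trans[OF _ alt.fcong_Z_const[OF k _ _ _ WW vu]])
      (use ST_cross[OF q_nz] alt_series_ST[OF q_nz r] in \<open>simp_all only: S_def T_def F_def G_def\<close>)
  then show ?thesis by (simp add: alt.fcong_def alt.hom_zero)
qed

end

section \<open>Specialising the central generators\<close>

text \<open>Evaluation at \<open>z = 1\<close> for the indices in \<open>N\<close> and at \<open>z = 0\<close> for the others.\<close>

definition eval01 :: "nat set \<Rightarrow> 'k::field zpoly \<Rightarrow> 'k" where
  "eval01 N f = (\<Sum>w\<in>Poly_Mapping.keys f. Poly_Mapping.lookup f w * of_bool (Poly_Mapping.keys w \<subseteq> N))"

lemma eval01_alt:
  assumes "finite A" "Poly_Mapping.keys f \<subseteq> A"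
  shows "eval01 N f = (\<Sum>w\<in>A. Poly_Mapping.lookup f w * of_bool (Poly_Mapping.keys w \<subseteq> N))"
  unfolding eval01_def by (rule sum.mono_neutral_left) (use assms in \<open>auto simp: in_keys_iff\<close>)

lemma eval01_add: "eval01 N (f + g) = eval01 N f + eval01 N g"
proof -
  let ?A = "Poly_Mapping.keys f \<union> Poly_Mapping.keys g"
  have A: "finite ?A" "Poly_Mapping.keys f \<subseteq> ?A" "Poly_Mapping.keys g \<subseteq> ?A" "Poly_Mapping.keys (f + g) \<subseteq> ?A"
    using keys_add[of f g] by auto
  show ?thesis
    unfolding eval01_alt[OF A(1,2)] eval01_alt[OF A(1,3)] eval01_alt[OF A(1,4)]
    by (simp add: lookup_add distrib_right sum.distrib)
qed

lemma eval01_single: "eval01 N (Poly_Mapping.single w c) = c * of_bool (Poly_Mapping.keys w \<subseteq> N)"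
  by (subst eval01_alt[of "{w}"]) auto

lemma eval01_zvar: "eval01 N (zvar i) = of_bool (i \<in> N)"
  by (simp add: zvar_def eval01_single)

lemma eval01_one: "eval01 N 1 = 1"
  using eval01_single[of N 0 1] by simp

lemma eval01_sum: "eval01 N (sum f A) = (\<Sum>i\<in>A. eval01 N (f i))"
  by (induction A rule: infinite_finite_induct) (simp_all add: eval01_add, simp_all add: eval01_def)

text \<open>Exponents are natural numbers, so the support of a product of monomials is the union of
  their supports; hence the 0/1 weight of monomials is multiplicative.\<close>

lemma eval01_mult: "eval01 N (f * g) = eval01 N f * eval01 N g"
proof -
  have k: "Poly_Mapping.keys (v + w) \<subseteq> N \<longleftrightarrow> Poly_Mapping.keys v \<subseteq> N \<and> Poly_Mapping.keys w \<subseteq> N"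
    for v w :: "nat \<Rightarrow>\<^sub>0 nat"
    by (auto simp: subset_iff in_keys_iff lookup_add)
  let ?s = "\<lambda>f w. Poly_Mapping.single w (Poly_Mapping.lookup f w)"
  have "eval01 N ((\<Sum>v\<in>Poly_Mapping.keys f. ?s f v) * (\<Sum>w\<in>Poly_Mapping.keys g. ?s g w)) =
      eval01 N (\<Sum>v\<in>Poly_Mapping.keys f. ?s f v) * eval01 N (\<Sum>w\<in>Poly_Mapping.keys g. ?s g w)"
    unfolding sum_product eval01_sum by (simp add: mult_single eval01_single k of_bool_conj mult_ac)
  then show ?thesis by (simp flip: poly_sum)
qed

lemma eval01_empty: "eval01 {} f = Poly_Mapping.lookup f 0"
proof -
  have "eval01 {} f = (\<Sum>w\<in>Poly_Mapping.keys f. if w = 0 then Poly_Mapping.lookup f 0 else 0)"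
    unfolding eval01_def by (rule sum.cong) auto
  then show ?thesis by (simp add: in_keys_iff)
qed

text \<open>As \<open>zvar n\<close> is z_(n+1), the case \<open>{n}\<close> differs from the case
  \<open>{}\<close> only by z_(n+1) = 1.\<close>

definition set_z :: "nat set \<Rightarrow> 'k::field \<Rightarrow> 'k onsager_z \<Rightarrow> (onsager_gen, 'k) ncpoly set" where
  "set_z N q = induced_hom (onsager_alg q) (\<lambda>(a, f). eval01 N f \<odot>\<^bsub>onsager_alg q\<^esub> a)"

lemma set_z_empty: "set_z {} = set_z_zero"
  by (simp add: fun_eq_iff set_z_def set_z_zero_def eval01_empty)

lemma set_z_props:
  fixes q :: "'k::field"
  shows "set_z N q \<in> alg_hom (onsager_z_alg q) (onsager_alg q)"
    and "a \<in> carrier (onsager_alg q) \<Longrightarrow>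
      set_z N q (tensor (onsager_alg q) zpoly_alg a f) = eval01 N f \<odot>\<^bsub>onsager_alg q\<^esub> a"
proof -
  interpret B: k_algebra "onsager_alg q"
    unfolding onsager_alg_def by (rule presented_k_algebra[OF onsager_rels_carrier])
  let ?B = "onsager_alg q" and ?X = "carrier (onsager_alg q) \<times> carrier (zpoly_alg :: ('k, 'k zpoly) module)"
  define h where "h = (\<lambda>(a, f :: 'k zpoly). eval01 N f \<odot>\<^bsub>?B\<^esub> a)"
  note R = tensor_rels_carrier[OF B.k_algebra_axioms zpoly_k_algebra]
  have h: "h \<in> ?X \<rightarrow> carrier ?B" by (auto simp: h_def B.scale_closed)
  have cu: "f \<in> carrier zpoly_alg" for f :: "'k zpoly" by (simp add: zpoly_alg_def)
  have L: "free_lift ?B h (gen (a, f)) = eval01 N f \<odot>\<^bsub>?B\<^esub> a"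
    and G: "gen (a, f) \<in> carrier (free_alg ?X)" if "a \<in> carrier ?B" for a f
    using that cu by (simp_all add: B.free_lift_gen[OF h] gen_in_free) (simp add: h_def)
  have one: "free_lift ?B h 1 = \<one>\<^bsub>?B\<^esub>"
    using B.free_lift_scal[OF h, of 1] by (simp add: scal_1 B.scale_one)
  have Z: "f \<oplus>\<^bsub>zpoly_alg\<^esub> g = f + g" "f \<otimes>\<^bsub>zpoly_alg\<^esub> g = f * g" "\<one>\<^bsub>zpoly_alg\<^esub> = (1 :: 'k zpoly)"
      "c \<odot>\<^bsub>zpoly_alg\<^esub> f = Poly_Mapping.single 0 c * f" for c and f g :: "'k zpoly"
    by (simp_all add: zpoly_alg_def)
  have e1: "eval01 N (1 :: 'k zpoly) = 1"
    using eval01_single[of N 0 "1 :: 'k"] by simp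
  have rels: "free_lift ?B h u = free_lift ?B h v" if "(u, v) \<in> tensor_rels ?B zpoly_alg" for u v
    using that
    by (cases rule: tensor_rels.cases)
      (simp_all add: B.free_lift_add[OF h] B.free_lift_mult[OF h] L G scal_in_free
        B.free_lift_scal[OF h] B.scale_closed Z eval01_add B.scale_add_left B.scale_add_right
        B.scale_mult_left B.scale_mult_right B.scale_scale eval01_mult eval01_single e1 B.scale_one one mult.commute)
  have th: "set_z N q = induced_hom ?B h" by (simp add: set_z_def h_def)
  show "set_z N q \<in> alg_hom (onsager_z_alg q) (onsager_alg q)"
    unfolding th onsager_z_alg_def tensor_alg_def by (rule B.induced_hom_alg_hom(1)[OF R h]) (rule rels)
  show "a \<in> carrier (onsager_alg q) \<Longrightarrow>
      set_z N q (tensor (onsager_alg q) zpoly_alg a f) = eval01 N f \<odot>\<^bsub>onsager_alg q\<^esub> a"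
    unfolding th tensor_def using B.induced_hom_alg_hom(2)[OF R h, of "(a, f)"] rels by (simp add: h_def cu)
qed

lemma alg_hom_comp: "f \<in> alg_hom A B \<Longrightarrow> g \<in> alg_hom B C \<Longrightarrow> (\<lambda>x. g (f x)) \<in> alg_hom A C"
  by (auto simp: alg_hom_def ring_hom_def Pi_iff)

lemma alg_iso_inv:
  assumes A: "k_algebra A" and h: "h \<in> alg_iso A B"
  shows "inv_into (carrier A) h \<in> alg_hom B A"
proof -
  interpret A: k_algebra A by fact
  have bij: "bij_betw h (carrier A) (carrier B)" and hom: "h \<in> alg_hom A B"
    using h by (auto simp: alg_iso_def)
  then have "h \<in> ring_iso A B" by (simp add: ring_iso_def alg_hom_def)
  then have "inv_into (carrier A) h \<in> ring_hom B A"
    using ring_iso_set_sym[OF A.ring_axioms] by (auto simp: ring_iso_def)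
  moreover have "inv_into (carrier A) h (c \<odot>\<^bsub>B\<^esub> u) = c \<odot>\<^bsub>A\<^esub> inv_into (carrier A) h u"
    if "u \<in> carrier B" for c u
  proof -
    obtain a where a: "a \<in> carrier A" "u = h a" using bij \<open>u \<in> carrier B\<close> by (auto simp: bij_betw_def)
    have inj: "inj_on h (carrier A)" using bij by (simp add: bij_betw_def)
    have "c \<odot>\<^bsub>B\<^esub> u = h (c \<odot>\<^bsub>A\<^esub> a)" using a hom by (simp add: alg_hom_def)
    then show ?thesis using a inj by (simp add: A.scale_closed)
  qed
  ultimately show ?thesis by (simp add: alg_hom_def)
qed

lemma onsager_k_algebra: "k_algebra (onsager_alg q)"
  unfolding onsager_alg_def by (rule presented_k_algebra[OF onsager_rels_carrier])

lemma onsager_z_k_algebra: "k_algebra (onsager_z_alg q)"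
  unfolding onsager_z_alg_def tensor_alg_def
  by (rule presented_k_algebra[OF tensor_rels_carrier[OF onsager_k_algebra zpoly_k_algebra]])

lemma tensor_closed:
  assumes "a \<in> carrier (onsager_alg q)"
  shows "tensor (onsager_alg q) zpoly_alg a f \<in> carrier (onsager_z_alg q)"
proof -
  note R = tensor_rels_carrier[OF onsager_k_algebra[of q] zpoly_k_algebra]
  have "gen (a, f) \<in> carrier (free_alg (carrier (onsager_alg q) \<times> carrier zpoly_alg))"
    using assms by (intro gen_in_free) (auto simp: zpoly_alg_def)
  then show ?thesis
    using residue_alg_hom[OF R] unfolding tensor_def onsager_z_alg_def tensor_alg_def
    by (auto simp: alg_hom_def ring_hom_def)
qed

lemma presented_free_hom:
  "R \<subseteq> carrier (free_alg UNIV) \<times> carrier (free_alg UNIV) \<Longrightarrow> free_hom (presented_alg UNIV R) (residue UNIV R)"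
  by (simp add: free_hom_def free_hom_axioms_def presented_k_algebra residue_alg_hom)

lemma torus_q_torus:
  fixes q :: "'k::field_char_0"
  assumes "q \<noteq> 0"
  shows "q_torus (torus_alg q) q (tX q) (tXinv q) (tY q) (tYinv q)"
proof -
  interpret free_hom "torus_alg q" "torus_elem q"
    unfolding torus_alg_def torus_elem_def by (rule presented_free_hom[OF torus_rels_carrier])
  have rel: "torus_elem q u = torus_elem q v" if "(u, v) \<in> torus_rels q" for u v
    unfolding torus_elem_def by (rule rel_residue_eq[OF torus_rels_carrier that])
  show ?thesis
  proof (unfold_locales; (rule assms hom_closed)?)
    show "tX q \<otimes>\<^bsub>torus_alg q\<^esub> tXinv q = \<one>\<^bsub>torus_alg q\<^esub>" "tXinv q \<otimes>\<^bsub>torus_alg q\<^esub> tX q = \<one>\<^bsub>torus_alg q\<^esub>"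
      "tY q \<otimes>\<^bsub>torus_alg q\<^esub> tYinv q = \<one>\<^bsub>torus_alg q\<^esub>" "tYinv q \<otimes>\<^bsub>torus_alg q\<^esub> tY q = \<one>\<^bsub>torus_alg q\<^esub>"
      unfolding hom_mult[symmetric] hom_one[symmetric] by (rule rel; simp add: torus_rels_def)+
    show "tX q \<otimes>\<^bsub>torus_alg q\<^esub> tY q = q\<^sup>2 \<odot>\<^bsub>torus_alg q\<^esub> (tY q \<otimes>\<^bsub>torus_alg q\<^esub> tX q)"
      unfolding hom_mult[symmetric] hom_smult[symmetric] mult.assoc[symmetric]
      by (rule rel) (simp add: torus_rels_def)
  qed
qed

lemma ace_rels_carrier: "ace_rels q \<subseteq> carrier (free_alg UNIV) \<times> carrier (free_alg UNIV)"
  by (auto simp: free_alg_def)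

text \<open>For N empty this is the map \<Psi>.\<close>

definition ace_eval where
  "ace_eval N q \<phi> f = torus_hom q (set_z N q (inv_into (carrier (onsager_z_alg q)) \<phi> (ace_elem q f)))"

section \<open>Evaluations of the central extension in the quantum torus\<close>

context
  fixes q :: "'k::field_char_0" and \<phi> :: "'k onsager_z \<Rightarrow> (ace_gen, 'k) ncpoly set"
  assumes q: "q \<noteq> 0" "q ^ 4 \<noteq> 1" and iso: "standard_iso q \<phi>"
begin

interpretation O: k_algebra "onsager_alg q" by (rule onsager_k_algebra)
interpretation T: q_torus "torus_alg q" q "tX q" "tXinv q" "tY q" "tYinv q"
  by (rule torus_q_torus[OF q(1)])

lemma ace_eval_ace_hom: "ace_hom (torus_alg q) (ace_eval N q \<phi>) q"
proof -
  have 1: "ace_elem q \<in> alg_hom (free_alg UNIV) (ace_alg q)"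
    unfolding ace_elem_def ace_alg_def by (rule residue_alg_hom[OF ace_rels_carrier])
  have "\<phi> \<in> alg_iso (onsager_z_alg q) (ace_alg q)"
    using iso by (simp add: standard_iso_def)
  note 2 = alg_iso_inv[OF onsager_z_k_algebra this]
  have hom: "ace_eval N q \<phi> \<in> alg_hom (free_alg UNIV) (torus_alg q)"
    using alg_hom_comp[OF alg_hom_comp[OF alg_hom_comp[OF 1 2] set_z_props(1)] torus_hom_props(1)[OF q(1)], of N]
    unfolding ace_eval_def .
  have rel: "ace_eval N q \<phi> u = ace_eval N q \<phi> v" if "(u, v) \<in> ace_rels q" for u v
    using rel_residue_eq[OF ace_rels_carrier that] by (simp add: ace_eval_def ace_elem_def)
  show ?thesis
    by unfold_locales (rule hom rel ace_rels.intros)+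
qed

lemma ace_eval_tensor:
  assumes "a \<in> carrier (onsager_alg q)" "ace_elem q f = \<phi> (tensor (onsager_alg q) zpoly_alg a z)"
  shows "ace_eval N q \<phi> f = eval01 N z \<odot>\<^bsub>torus_alg q\<^esub> torus_hom q a"
proof -
  have "inj_on \<phi> (carrier (onsager_z_alg q))"
    using iso by (auto simp: standard_iso_def alg_iso_def bij_betw_def)
  then have "inv_into (carrier (onsager_z_alg q)) \<phi> (ace_elem q f) = tensor (onsager_alg q) zpoly_alg a z"
    unfolding assms(2) by (rule inv_into_f_f) (rule tensor_closed[OF assms(1)])
  then have "ace_eval N q \<phi> f = torus_hom q (eval01 N z \<odot>\<^bsub>onsager_alg q\<^esub> a)"
    by (simp only: ace_eval_def set_z_props(2)[OF assms(1)])
  also have "\<dots> = eval01 N z \<odot>\<^bsub>torus_alg q\<^esub> torus_hom q a"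
    using torus_hom_props(1)[OF q(1)] assms(1) unfolding alg_hom_def by blast
  finally show ?thesis .
qed

lemma ace_eval_W: "ace_eval N q \<phi> (Wm 0) = T.X" "ace_eval N q \<phi> (Wp 0) = T.Y"
proof -
  have c: "onsager_elem q f \<in> carrier (onsager_alg q)" for f
    unfolding onsager_elem_def onsager_alg_def
    by (rule free_hom.hom_closed[OF presented_free_hom[OF onsager_rels_carrier]])
  have "ace_elem q (Wm 0) = \<phi> (tensor (onsager_alg q) zpoly_alg (onsager_elem q (gen OW0)) 1)"
    and "ace_elem q (Wp 0) = \<phi> (tensor (onsager_alg q) zpoly_alg (onsager_elem q (gen OW1)) 1)"
    using iso by (simp_all add: standard_iso_def)
  note this[THEN ace_eval_tensor[OF c], of N]
  then show "ace_eval N q \<phi> (Wm 0) = T.X" "ace_eval N q \<phi> (Wp 0) = T.Y"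
    by (simp_all add: torus_hom_props(2,3)[OF q(1)] T.X_def T.Y_def T.scale_one T.gens_closed eval01_one)
qed

text \<open>The power of q + q^-1 is the normalisation in \<open>Z_elem\<close>; the central element
  of index i+1 corresponds to \<open>zvar i\<close>, whose value is 1 or 0.\<close>

lemma ace_eval_Z:
  "ace_eval N q \<phi> (fps_nth (Z_series q) (Suc i)) = ((q + inverse q) ^ Suc i * of_bool (i \<in> N)) \<odot>\<^bsub>torus_alg q\<^esub> \<one>\<^bsub>torus_alg q\<^esub>"
proof -
  interpret E: ace_hom "torus_alg q" "ace_eval N q \<phi>" q by (rule ace_eval_ace_hom)
  let ?r = "(q + inverse q) ^ Suc i"
  have "ace_elem q (scal (inverse ?r) * fps_nth (Z_series q) (Suc i)) =
      \<phi> (tensor (onsager_alg q) zpoly_alg \<one>\<^bsub>onsager_alg q\<^esub> (zvar i))"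
    using iso by (simp add: standard_iso_def Z_elem_def)
  from ace_eval_tensor[OF O.one_closed this]
  have eq: "ace_eval N q \<phi> (scal (inverse ?r) * fps_nth (Z_series q) (Suc i)) = of_bool (i \<in> N) \<odot>\<^bsub>torus_alg q\<^esub> \<one>\<^bsub>torus_alg q\<^esub>"
    using torus_hom_props(1)[OF q(1)] ring_hom_one[of "torus_hom q" "onsager_alg q" "torus_alg q"]
    by (simp add: eval01_zvar alg_hom_def)
  have "ace_eval N q \<phi> (fps_nth (Z_series q) (Suc i)) =
      ace_eval N q \<phi> (scal ?r * (scal (inverse ?r) * fps_nth (Z_series q) (Suc i)))"
    using q_plus_nonzero[OF q] by (simp add: scal_scal scal_1 del: power_Suc)
  also have "\<dots> = ?r \<odot>\<^bsub>torus_alg q\<^esub> (of_bool (i \<in> N) \<odot>\<^bsub>torus_alg q\<^esub> \<one>\<^bsub>torus_alg q\<^esub>)"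
    unfolding E.hom_smult[of ?r] eq ..
  also have "\<dots> = (?r * of_bool (i \<in> N)) \<odot>\<^bsub>torus_alg q\<^esub> \<one>\<^bsub>torus_alg q\<^esub>"
    by (rule T.scale_scale) simp
  finally show ?thesis .
qed

text \<open>The two evaluations give equal values to the central elements of index 1 to n, and
  uniqueness applies up to degree \<open>n\<close>.\<close>

lemma ace_eval_low_eq:
  assumes "\<And>i. i < n \<Longrightarrow> inverse q ^ Suc i + q ^ Suc i \<noteq> 0" "ace_deg g \<le> n"
  shows "ace_eval {} q \<phi> (gen g) = ace_eval {n} q \<phi> (gen g)"
proof (rule ace_hom_eq[OF q ace_eval_ace_hom ace_eval_ace_hom _ _ assms(1) _ assms(2)])
  show "ace_eval {} q \<phi> (fps_nth (Z_series q) (Suc i)) = ace_eval {n} q \<phi> (fps_nth (Z_series q) (Suc i))"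
    if "i < n" for i
    using that by (simp add: ace_eval_Z del: power_Suc)
qed (simp_all add: ace_eval_W)

text \<open>At the least exceptional index the central element has the same value under both
  evaluations, although one value is 0 and the other an invertible multiple of 1.\<close>

lemma torus_trivial:
  assumes "inverse q ^ Suc m + q ^ Suc m = 0"
  shows "\<one>\<^bsub>torus_alg q\<^esub> = \<zero>\<^bsub>torus_alg q\<^esub>"
proof -
  define n where "n = (LEAST n. inverse q ^ Suc n + q ^ Suc n = 0)"
  have n: "inverse q ^ Suc n + q ^ Suc n = 0"
    unfolding n_def using assms by (rule LeastI[where P="\<lambda>n. inverse q ^ Suc n + q ^ Suc n = 0"])
  have nz: "inverse q ^ Suc i + q ^ Suc i \<noteq> 0" if "i < n" for i
    using that unfolding n_def by (rule not_less_Least[where P="\<lambda>n. inverse q ^ Suc n + q ^ Suc n = 0"])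
  have "ace_eval {} q \<phi> (fps_nth (Z_series q) (Suc n)) = ace_eval {n} q \<phi> (fps_nth (Z_series q) (Suc n))"
    by (rule ace_hom_Z_eq[OF q ace_eval_ace_hom ace_eval_ace_hom ace_eval_low_eq[OF nz] n])
  then have eq: "\<zero>\<^bsub>torus_alg q\<^esub> = (q + inverse q) ^ Suc n \<odot>\<^bsub>torus_alg q\<^esub> \<one>\<^bsub>torus_alg q\<^esub>"
    by (simp add: ace_eval_Z T.scale_zero_left del: power_Suc)
  have "\<one>\<^bsub>torus_alg q\<^esub> = inverse ((q + inverse q) ^ Suc n) \<odot>\<^bsub>torus_alg q\<^esub>
      ((q + inverse q) ^ Suc n \<odot>\<^bsub>torus_alg q\<^esub> \<one>\<^bsub>torus_alg q\<^esub>)"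
    using q_plus_nonzero[OF q] by (simp add: T.scale_scale T.scale_one del: power_Suc)
  then show ?thesis unfolding eq[symmetric] T.scale_zero_right .
qed

text \<open>Uniqueness settles the case without exceptional index; otherwise the torus is zero and
  any two elements are equal.\<close>

lemma ace_eval_eq: "ace_eval {} q \<phi> (gen g) = T.alt_value g"
proof (cases "\<exists>m. inverse q ^ Suc m + q ^ Suc m = 0")
  case False
  have "ace_eval {} q \<phi> (gen g) = T.alt_hom (gen g)"
  proof (rule ace_hom_eq[OF q ace_eval_ace_hom T.alt_ace_hom[OF q_plus_nonzero[OF q]], where n="ace_deg g"])
    show "inverse q ^ Suc i + q ^ Suc i \<noteq> 0" for i using False by blast
    show "ace_eval {} q \<phi> (fps_nth (Z_series q) (Suc i)) = T.alt_hom (fps_nth (Z_series q) (Suc i))" for i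
      by (simp add: ace_eval_Z T.alt_hom_Z[OF q(2)] T.scale_zero_left del: power_Suc)
  qed (simp_all add: ace_eval_W T.alt_hom_gen alt_coeff_0 T.scale_one T.torus_closed)
  then show ?thesis by (simp add: T.alt_hom_gen)
next
  case True
  then have "\<one>\<^bsub>torus_alg q\<^esub> = \<zero>\<^bsub>torus_alg q\<^esub>" using torus_trivial by blast
  then have triv: "u = \<zero>\<^bsub>torus_alg q\<^esub>" if "u \<in> carrier (torus_alg q)" for u
    using T.r_one[OF that] T.r_null[OF that] by simp
  have 1: "ace_eval {} q \<phi> (gen g) \<in> carrier (torus_alg q)"
    using ace_eval_ace_hom by (intro free_hom.hom_closed) (simp add: ace_hom_def)
  have 2: "T.alt_value g \<in> carrier (torus_alg q)"
    using T.alt_value_closed by auto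
  show ?thesis unfolding triv[OF 1] triv[OF 2] ..
qed

lemma gamma_eq: "torus_hom q (gamma q \<phi> (ace_elem q (gen g))) = T.alt_value g"
  using ace_eval_eq by (simp add: ace_eval_def gamma_def set_z_empty)

lemma w_eq:
  "w_minus q \<phi> k = alt_coeff (q + inverse q) k \<odot>\<^bsub>torus_alg q\<^esub> (tX q \<oplus>\<^bsub>torus_alg q\<^esub> tXinv q)"
  "w_plus q \<phi> k = alt_coeff (q + inverse q) k \<odot>\<^bsub>torus_alg q\<^esub> (tY q \<oplus>\<^bsub>torus_alg q\<^esub> tYinv q)"
  by (simp_all add: w_minus_def w_plus_def gamma_eq T.X_def T.Y_def)

lemma g_even:
  assumes "even k"
  shows "g_alt q \<phi> k = (G0 q * alt_coeff (q + inverse q) k) \<odot>\<^bsub>torus_alg q\<^esub> \<one>\<^bsub>torus_alg q\<^esub>"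
    and "gt_alt q \<phi> k = (G0 q * alt_coeff (q + inverse q) k) \<odot>\<^bsub>torus_alg q\<^esub> \<one>\<^bsub>torus_alg q\<^esub>"
proof -
  \<comment> \<open>For k = \<open>Suc l\<close> the index \<open>l\<close> is odd, which removes
    \<open>V\<close> and \<open>U\<close>; k = 0 is the convention.\<close>
  have "alt_coeff (q + inverse q) l = 0" if "k = Suc l" for l
    using assms that by (simp add: alt_coeff_def)
  then show "g_alt q \<phi> k = (G0 q * alt_coeff (q + inverse q) k) \<odot>\<^bsub>torus_alg q\<^esub> \<one>\<^bsub>torus_alg q\<^esub>"
    and "gt_alt q \<phi> k = (G0 q * alt_coeff (q + inverse q) k) \<odot>\<^bsub>torus_alg q\<^esub> \<one>\<^bsub>torus_alg q\<^esub>"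
    by (cases k; simp add: g_alt_def gt_alt_def gamma_eq alt_coeff_0 T.torus_closed T.scale_zero_left
        T.scale_closed)+
qed

lemma g_odd:
  "g_alt q \<phi> (2 * j + 1) = ((q + inverse q) * q * (q - inverse q) * alt_coeff (q + inverse q) (2 * j))
    \<odot>\<^bsub>torus_alg q\<^esub> (tX q \<otimes>\<^bsub>torus_alg q\<^esub> tYinv q \<oplus>\<^bsub>torus_alg q\<^esub> tXinv q \<otimes>\<^bsub>torus_alg q\<^esub> tY q)"
  "gt_alt q \<phi> (2 * j + 1) = ((q + inverse q) * inverse q * (q - inverse q) * alt_coeff (q + inverse q) (2 * j))
    \<odot>\<^bsub>torus_alg q\<^esub> (tX q \<otimes>\<^bsub>torus_alg q\<^esub> tY q \<oplus>\<^bsub>torus_alg q\<^esub> tXinv q \<otimes>\<^bsub>torus_alg q\<^esub> tYinv q)"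
proof -
  have "alt_coeff (q + inverse q) (Suc (2 * j)) = 0" by (simp add: alt_coeff_def)
  then show "g_alt q \<phi> (2 * j + 1) = ((q + inverse q) * q * (q - inverse q) * alt_coeff (q + inverse q) (2 * j))
    \<odot>\<^bsub>torus_alg q\<^esub> (tX q \<otimes>\<^bsub>torus_alg q\<^esub> tYinv q \<oplus>\<^bsub>torus_alg q\<^esub> tXinv q \<otimes>\<^bsub>torus_alg q\<^esub> tY q)"
  "gt_alt q \<phi> (2 * j + 1) = ((q + inverse q) * inverse q * (q - inverse q) * alt_coeff (q + inverse q) (2 * j))
    \<odot>\<^bsub>torus_alg q\<^esub> (tX q \<otimes>\<^bsub>torus_alg q\<^esub> tY q \<oplus>\<^bsub>torus_alg q\<^esub> tXinv q \<otimes>\<^bsub>torus_alg q\<^esub> tYinv q)"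
    using T.torus_closed
    by (simp_all add: g_alt_def gt_alt_def gamma_eq T.scale_zero_left T.scale_closed T.gV_def T.gU_def
        flip: T.V_def T.U_def)
qed

end

text \<open>The cases m = 0, 1, 2 give the three exponents of the theorem.\<close>

lemma power_int_diff_even:
  assumes "(r::'k::field) \<noteq> 0"
  shows "r powi (int m - 2 * int j) = r ^ m * inverse r ^ (2 * j)"
proof -
  have "r powi (int m - 2 * int j) = r powi int m / r powi int (2 * j)"
    using assms power_int_diff[of r "int m" "int (2 * j)"] by simp
  then show ?thesis by (simp only: power_int_of_nat divide_inverse power_inverse)
qed

theorem theorem9p1:
  fixes q :: "'k::field_char_0"
    and \<phi> :: "'k onsager_z \<Rightarrow> (ace_gen, 'k) ncpoly set"
  assumes "q \<noteq> 0" and "q ^ 4 \<noteq> 1"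
    and "standard_iso q \<phi>"
  shows "\<forall>j::nat.
    (\<forall>k. k = 2 * j \<longrightarrow>
       w_plus q \<phi> k =
         (of_nat (2 * j choose j) * (q + inverse q) powi (- 2 * int j))
           \<odot>\<^bsub>torus_alg q\<^esub> (tY q \<oplus>\<^bsub>torus_alg q\<^esub> tYinv q) \<and>
       w_minus q \<phi> k =
         (of_nat (2 * j choose j) * (q + inverse q) powi (- 2 * int j))
           \<odot>\<^bsub>torus_alg q\<^esub> (tX q \<oplus>\<^bsub>torus_alg q\<^esub> tXinv q) \<and>
       g_alt q \<phi> k = gt_alt q \<phi> k \<and>
       gt_alt q \<phi> k =
         (- of_nat (2 * j choose j) * (q - inverse q) * (q + inverse q) powi (2 - 2 * int j))
           \<odot>\<^bsub>torus_alg q\<^esub> \<one>\<^bsub>torus_alg q\<^esub>) \<and>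
    (\<forall>k. k = 2 * j + 1 \<longrightarrow>
       w_plus q \<phi> k = \<zero>\<^bsub>torus_alg q\<^esub> \<and>
       w_minus q \<phi> k = \<zero>\<^bsub>torus_alg q\<^esub> \<and>
       g_alt q \<phi> k =
         (of_nat (2 * j choose j) * q * (q - inverse q) * (q + inverse q) powi (1 - 2 * int j))
           \<odot>\<^bsub>torus_alg q\<^esub>
             (tX q \<otimes>\<^bsub>torus_alg q\<^esub> tYinv q \<oplus>\<^bsub>torus_alg q\<^esub> tXinv q \<otimes>\<^bsub>torus_alg q\<^esub> tY q) \<and>
       gt_alt q \<phi> k =
         (of_nat (2 * j choose j) * inverse q * (q - inverse q) * (q + inverse q) powi (1 - 2 * int j))
           \<odot>\<^bsub>torus_alg q\<^esub>
             (tX q \<otimes>\<^bsub>torus_alg q\<^esub> tY q \<oplus>\<^bsub>torus_alg q\<^esub> tXinv q \<otimes>\<^bsub>torus_alg q\<^esub> tYinv q))"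
proof -
  note r = q_plus_nonzero[OF assms(1,2)]
  interpret q_torus "torus_alg q" q "tX q" "tXinv q" "tY q" "tYinv q"
    by (rule torus_q_torus[OF assms(1)])
  have c: "alt_coeff (q + inverse q) (2 * j) = of_nat (2 * j choose j) * inverse (q + inverse q) ^ (2 * j)" for j
    by (simp add: alt_coeff_def)
  have p: "(q + inverse q) powi (- 2 * int j) = inverse (q + inverse q) ^ (2 * j)"
    "(q + inverse q) powi (1 - 2 * int j) = (q + inverse q) * inverse (q + inverse q) ^ (2 * j)"
    "(q + inverse q) powi (2 - 2 * int j) = (q + inverse q)\<^sup>2 * inverse (q + inverse q) ^ (2 * j)" for j
    using power_int_diff_even[OF r, of 0 j] power_int_diff_even[OF r, of 1 j] power_int_diff_even[OF r, of 2 j]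
    by simp_all
  have e: "even (2 * j)" for j :: nat by simp
  note w = w_eq[OF assms] and ge = g_even[OF assms e] and go = g_odd[OF assms]
  note closed = torus_closed(1,2)[unfolded X_def Y_def]
  show ?thesis
  proof (intro allI conjI impI, goal_cases)
    case (4 j k)
    show ?case unfolding 4 ge(2) c p by (simp only: G0_def mult_ac mult_minus_left mult_minus_right)
  next
    case (7 j k)
    show ?case unfolding 7 go c p by (simp only: mult_ac)
  next
    case (8 j k)
    show ?case unfolding 8 go c p by (simp only: mult_ac)
  qed (simp_all only: w ge c p alt_coeff_odd scale_zero_left closed)
qed

end
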